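(* Let $\mathscr{O},\Omega\subset\mathbb{R}^d$ be two sets with $\emptyset\ne\mathscr{O}\subset\subset\Omega$ such that $\Omega\setminus\mathscr{O}$ is a $\mathcal{C}^{1,1}$-smooth bounded domain. Let $p\in(1,\infty)$, $s\in(0,1)$, and $q\in[1,p_s^* )$. For $t\in\mathbb{R}$ let $\mathscr{O}_t=te_1+\mathscr{O}$ with $e_1=(1,0,\dots,0)$, let $L_{\mathscr{O}}=\{t\ge 0:\mathscr{O}_t\subset\Omega\}$, and let $R_{\mathscr{O}}=\sup L_{\mathscr{O}}$. If both $\mathscr{O}$ and $\Omega$ are Steiner symmetric with respect to the hyperplane $\partial H_0=\{x\in\mathbb{R}^d:x_1=0\}$, then $L_{\mathscr{O}}$ is the interval $[0,R_{\mathscr{O}})$, and $\lambda^s_{p,q}(\Omega\setminus\mathscr{O}_t)$ is strictly decreasing for $0\le t<R_{\mathscr{O}}$.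
   Context: $p_s^*=\frac{dp}{d-sp}$ if $sp<d$ and $p_s^*=\infty$ if $sp\ge d$. The Gagliardo seminorm is $$[u]_{s,p}=\left(\int_{\mathbb{R}^d}\int_{\mathbb{R}^d}\frac{|u(x)-u(y)|^p}{|x-y|^{d+sp}}\,dy\,dx\right)^{1/p}.$$ For an open set $U\subset\mathbb{R}^d$, $W^{s,p}_0(U)=\{u\in L^p(\mathbb{R}^d): [u]_{s,p}<\infty,\ u=0 \text{ in }\mathbb{R}^d\setminus U\}$. For a bounded open set $U$, $$\lambda^s_{p,q}(U)=\inf\left\{[u]_{s,p}^p : u\in W^{s,p}_0(U),\ \|u\|_{L^q(U)}=1\right\}.$$ $\mathscr{O}\subset\subset\Omega$ means that the closure of $\mathscr{O}$ is compact and contained in the interior of $\Omega$. For $a\in\mathbb{R}$ let $H_a=\{x=(x_1,x')\in\mathbb{R}\times\mathbb{R}^{d-1}:x_1<a\}$ and $\sigma_a(x)=(2a-x_1,x')$. For $A\subseteq\mathbb{R}^d$ let $$P_a(A)=[(A\cup\sigma_a(A))\cap H_a]\cup[A\cap\sigma_a(A)],\qquad P^a(A)=[(A\cup\sigma_a(A))\cap H_a^{\mathsf{c}}]\cup[A\cap\sigma_a(A)].$$ A set $A\subseteq\mathbb{R}^d$ is Steiner symmetric with respect to $\partial H_{a_0}$ ($a_0\in\mathbb{R}$) if and only if $P_a(A)=A$ for all $a\ge a_0$ and $P^a(A)=A$ for all $a\le a_0$; this characterization may be taken as the definition. *)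

theory Defs
  imports "HOL-Analysis.Analysis"
begin

text \<open>
  The space dimension is \<open>d = CARD('n)\<close>. Elements of Lebesgue spaces are represented by Borel
  functions; every Lebesgue class has a Borel representative. Identities between functions are
  understood almost everywhere.
\<close>

definition sobolev_exponent :: "real \<Rightarrow> real \<Rightarrow> real \<Rightarrow> ereal" where
  "sobolev_exponent d s p = (if s * p < d then ereal (d * p / (d - s * p)) else \<infinity>)"

text \<open>On the null set \<open>x = y\<close> the quotient below is \<open>0\<close>, as \<open>0 / 0 = 0\<close>.\<close>

definition gagliardo_energy :: "real \<Rightarrow> real \<Rightarrow> (real ^ 'n \<Rightarrow> real) \<Rightarrow> ennreal" where
  "gagliardo_energy s p u =
     (\<integral>\<^sup>+ x. \<integral>\<^sup>+ y. ennreal (\<bar>u x - u y\<bar> powr p / norm (x - y) powr (real CARD('n) + s * p))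
        \<partial>lborel \<partial>lborel)"

text \<open>
  The seminorm is real-valued and has its intended meaning for functions of finite energy; finiteness
  is required separately by \<open>W0\<close>.
\<close>

definition gagliardo_seminorm :: "real \<Rightarrow> real \<Rightarrow> (real ^ 'n \<Rightarrow> real) \<Rightarrow> real" where
  "gagliardo_seminorm s p u = enn2real (gagliardo_energy s p u) powr (1 / p)"

definition W0 :: "real \<Rightarrow> real \<Rightarrow> (real ^ 'n) set \<Rightarrow> (real ^ 'n \<Rightarrow> real) set" where
  "W0 s p U = {u. u \<in> borel_measurable borel \<and>
                  integrable lborel (\<lambda>x. \<bar>u x\<bar> powr p) \<and>
                  gagliardo_energy s p u < \<infinity> \<and>
                  (AE x in lborel. x \<notin> U \<longrightarrow> u x = 0)}"

text \<open>
  If \<open>\<bar>u\<bar>\<^sup>q\<close> is not integrable on \<open>U\<close>, the Bochner integral, hence \<open>Lq_norm q U u\<close>, is \<open>0\<close>. Such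
  functions therefore never satisfy the normalisation \<open>Lq_norm q U u = 1\<close>.
\<close>

definition Lq_norm :: "real \<Rightarrow> (real ^ 'n) set \<Rightarrow> (real ^ 'n \<Rightarrow> real) \<Rightarrow> real" where
  "Lq_norm q U u = (LINT x:U|lborel. \<bar>u x\<bar> powr q) powr (1 / q)"

text \<open>
  For a nonempty bounded open \<open>U\<close> the set below is nonempty, and it is bounded below by \<open>0\<close>,
  so the real infimum is the intended one.
\<close>

definition frac_eigenvalue :: "real \<Rightarrow> real \<Rightarrow> real \<Rightarrow> (real ^ 'n) set \<Rightarrow> real" where
  "frac_eigenvalue s p q U =
     Inf {gagliardo_seminorm s p u powr p | u. u \<in> W0 s p U \<and> Lq_norm q U u = 1}"

definition C11_function :: "(real ^ 'n \<Rightarrow> real) \<Rightarrow> bool" where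
  "C11_function \<gamma> \<longleftrightarrow>
     (\<exists>g L. (\<forall>x. (\<gamma> has_derivative (\<lambda>h. g x \<bullet> h)) (at x)) \<and> L-lipschitz_on UNIV g)"

text \<open>
  Locally at each boundary point the set is the strict epigraph, in some direction \<open>\<nu>\<close>, of a
  \<open>C\<^sup>1\<^sup>,\<^sup>1\<close> function of the variables orthogonal to \<open>\<nu>\<close>. The function \<open>\<gamma>\<close> is evaluated only on the
  hyperplane orthogonal to \<open>\<nu>\<close>. A \<open>C\<^sup>1\<^sup>,\<^sup>1\<close> function on that hyperplane extends to the whole space by
  composition with the projection, and one given only near the boundary point can be cut off.
\<close>

definition C11_boundary :: "(real ^ 'n) set \<Rightarrow> bool" where
  "C11_boundary D \<longleftrightarrow>
     (\<forall>z \<in> frontier D. \<exists>r \<nu> \<gamma>. r > 0 \<and> norm \<nu> = 1 \<and> C11_function \<gamma> \<and>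
        D \<inter> ball z r = {x \<in> ball z r. x \<bullet> \<nu> > \<gamma> (x - (x \<bullet> \<nu>) *\<^sub>R \<nu>)})"

definition bounded_C11_domain :: "(real ^ 'n) set \<Rightarrow> bool" where
  "bounded_C11_domain D \<longleftrightarrow>
     open D \<and> connected D \<and> D \<noteq> {} \<and> bounded D \<and> C11_boundary D"

definition compactly_inside :: "(real ^ 'n) set \<Rightarrow> (real ^ 'n) set \<Rightarrow> bool"
    (infix "\<subset>\<subset>" 50) where
  "A \<subset>\<subset> B \<longleftrightarrow> compact (closure A) \<and> closure A \<subseteq> interior B"

text \<open>
  The index type carries no order. The distinguished (``first'') coordinate is the parameter \<open>k\<close>.
\<close>

definition halfspace :: "'n \<Rightarrow> real \<Rightarrow> (real ^ 'n) set" where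
  "halfspace k a = {x. x $ k < a}"

definition reflection :: "'n \<Rightarrow> real \<Rightarrow> real ^ 'n \<Rightarrow> real ^ 'n" where
  "reflection k a x = (\<chi> i. if i = k then 2 * a - x $ k else x $ i)"

definition polarization_lower :: "'n \<Rightarrow> real \<Rightarrow> (real ^ 'n) set \<Rightarrow> (real ^ 'n) set" where
  "polarization_lower k a A =
     ((A \<union> reflection k a ` A) \<inter> halfspace k a) \<union> (A \<inter> reflection k a ` A)"

definition polarization_upper :: "'n \<Rightarrow> real \<Rightarrow> (real ^ 'n) set \<Rightarrow> (real ^ 'n) set" where
  "polarization_upper k a A =
     ((A \<union> reflection k a ` A) \<inter> - halfspace k a) \<union> (A \<inter> reflection k a ` A)"

definition steiner_symmetric :: "'n \<Rightarrow> real \<Rightarrow> (real ^ 'n) set \<Rightarrow> bool" where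
  "steiner_symmetric k a0 A \<longleftrightarrow>
     (\<forall>a\<ge>a0. polarization_lower k a A = A) \<and> (\<forall>a\<le>a0. polarization_upper k a A = A)"

definition shift :: "'n \<Rightarrow> real \<Rightarrow> (real ^ 'n) set \<Rightarrow> (real ^ 'n) set" where
  "shift k t A = (\<lambda>x. t *\<^sub>R axis k 1 + x) ` A"

definition admissible_shifts :: "'n \<Rightarrow> (real ^ 'n) set \<Rightarrow> (real ^ 'n) set \<Rightarrow> real set" where
  "admissible_shifts k A B = {t. t \<ge> 0 \<and> shift k t A \<subseteq> B}"

end

theory Submission
  imports Defs "HOL-Library.Diagonal_Subsequence"
begin

text \<open>
  Let \<open>t\<^sub>1 < t\<^sub>2\<close> and \<open>a = (t\<^sub>1 + t\<^sub>2) / 2\<close>. Since \<open>\<O>\<close> is symmetric, the reflection in the hyperplane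
  \<open>x\<^sub>k = a\<close> exchanges the two translates of \<open>\<O>\<close>, and Steiner symmetry implies that polarization
  with respect to this hyperplane maps functions supported in \<open>\<Omega> - \<O>(t\<^sub>1)\<close> to functions supported in
  \<open>\<Omega> - \<O>(t\<^sub>2)\<close>. Polarization preserves \<open>L\<^sup>q\<close> norms and does not increase the energy, by a
  four-point inequality for \<open>\<bar>t\<bar>\<^sup>p\<close>; strict convexity shows that equality forces \<open>u\<close> to be
  comparable with its reflection on the half-space. For a nonnegative minimizer \<open>u\<close> either comparison
  makes \<open>u\<close> vanish on an open subset of \<open>\<Omega> - \<O>(t\<^sub>1)\<close>, which contradicts minimality.

  Minimizers exist because bounded sequences in \<open>W\<^sub>0\<close> are precompact in \<open>L\<^sup>r\<close> for subcritical \<open>r\<close>: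
  averages over dyadic cubes of side \<open>2\<^bsup>-j\<^esup>\<close> approximate a function of bounded energy geometrically
  fast in \<open>L\<^sup>r\<close>, and for fixed \<open>j\<close> they range over a bounded subset of a finite-dimensional space.
\<close>

section \<open>Energies and the space \<open>W\<^sub>0\<close>\<close>

text \<open>Polarizing arbitrary competitors compares the two infima only weakly, because strictness
  for each single function is lost in the infimum. Hence a minimizer on
  \<open>\<Omega> - \<O>(t1)\<close> is required, and with it subcritical compactness. The two ways
  in which the energies could agree are refuted by two different open sets. If \<open>u\<close>
  dominates its reflection below the hyperplane, the part of \<open>\<O>(t2)\<close> outside
  \<open>\<O>(t1)\<close> is reflected into \<open>\<O>(t1)\<close>, where \<open>u\<close>
  vanishes. The boundary regularity enters here: it gives \<O> nonempty interior, so that this part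
  contains a ball. If the reflection dominates, the ball consists of points of \<Omega> whose
  reflections leave \<Omega>; it exists because the hyperplane lies at \<open>a > 0\<close>, off the
  symmetry plane. Energies and power integrals stay in \<open>ennreal\<close>, where Fatou and
  Tonelli apply without integrability conditions; real numbers return only at the level of the
  infimum.\<close>

definition gagliardo_density :: "real \<Rightarrow> real \<Rightarrow> (real ^ 'n \<Rightarrow> real) \<Rightarrow> real ^ 'n \<Rightarrow> real ^ 'n \<Rightarrow> real" where
  "gagliardo_density s p u x y = \<bar>u x - u y\<bar> powr p / norm (x - y) powr (real CARD('n) + s * p)"

lemma gagliardo_density_nonneg [simp]: "0 \<le> gagliardo_density s p u x y"
  by (simp add: gagliardo_density_def)

lemma borel_measurable_gagliardo_density [measurable]:
  fixes u :: "real ^ 'n \<Rightarrow> real"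
  assumes [measurable]: "u \<in> borel_measurable borel"
  shows "(\<lambda>z. gagliardo_density s p u (fst z) (snd z)) \<in> borel_measurable (lborel \<Otimes>\<^sub>M lborel)"
    "(\<lambda>z. gagliardo_density s p u (fst z) (snd z)) \<in> borel_measurable (borel \<Otimes>\<^sub>M borel)"
    "(\<lambda>y. gagliardo_density s p u x y) \<in> borel_measurable borel"
  unfolding gagliardo_density_def by measurable

lemma gagliardo_energy_density:
  "gagliardo_energy s p u = (\<integral>\<^sup>+ x. \<integral>\<^sup>+ y. ennreal (gagliardo_density s p u x y) \<partial>lborel \<partial>lborel)"
  by (simp add: gagliardo_energy_def gagliardo_density_def)

lemma gagliardo_energy_pair:
  fixes u :: "real ^ 'n \<Rightarrow> real"
  assumes [measurable]: "u \<in> borel_measurable borel"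
  shows "gagliardo_energy s p u =
    (\<integral>\<^sup>+ z. ennreal (gagliardo_density s p u (fst z) (snd z)) \<partial>(lborel \<Otimes>\<^sub>M lborel))"
  unfolding gagliardo_energy_density
  using lborel.nn_integral_fst[of "\<lambda>z. ennreal (gagliardo_density s p u (fst z) (snd z))" lborel]
  by simp

lemma gagliardo_density_mono:
  assumes "p > 0" "\<bar>v x - v y\<bar> \<le> \<bar>u x - u y\<bar>"
  shows "gagliardo_density s p v x y \<le> gagliardo_density s p u x y"
  unfolding gagliardo_density_def
  by (intro divide_right_mono powr_mono2) (use assms in auto)

lemma gagliardo_energy_contraction:
  assumes "p > 0" "\<And>x y. \<bar>v x - v y\<bar> \<le> \<bar>u x - u y\<bar>"
  shows "gagliardo_energy s p v \<le> gagliardo_energy s p u"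
  unfolding gagliardo_energy_density
  by (intro nn_integral_mono ennreal_leI gagliardo_density_mono assms)

lemma gagliardo_energy_scale:
  fixes u :: "real ^ 'n \<Rightarrow> real"
  assumes [measurable]: "u \<in> borel_measurable borel"
  shows "gagliardo_energy s p (\<lambda>x. c * u x) = ennreal (\<bar>c\<bar> powr p) * gagliardo_energy s p u"
proof -
  have m: "(\<lambda>x. c * u x) \<in> borel_measurable borel" by measurable
  have "gagliardo_density s p (\<lambda>x. c * u x) x y = \<bar>c\<bar> powr p * gagliardo_density s p u x y" for x y
    by (simp add: gagliardo_density_def abs_mult powr_mult flip: right_diff_distrib)
  then show ?thesis
    unfolding gagliardo_energy_pair[OF assms] gagliardo_energy_pair[OF m]
    by (simp add: ennreal_mult nn_integral_cmult)
qed

lemma gagliardo_seminorm_powr: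
  assumes "p > 0"
  shows "gagliardo_seminorm s p u powr p = enn2real (gagliardo_energy s p u)"
  using assms by (simp add: gagliardo_seminorm_def powr_powr)

section \<open>Membership in \<open>W0\<close>, normalisation and the infimum\<close>

abbreviation power_integral :: "real \<Rightarrow> ('a::euclidean_space \<Rightarrow> real) \<Rightarrow> ennreal" where
  "power_integral q f \<equiv> \<integral>\<^sup>+ x. ennreal (\<bar>f x\<bar> powr q) \<partial>lborel"

lemma W0_measurable [measurable_dest]: "u \<in> W0 s p U \<Longrightarrow> u \<in> borel_measurable borel"
  by (simp add: W0_def)

lemma W0_outside: "u \<in> W0 s p U \<Longrightarrow> AE x in lborel. x \<notin> U \<longrightarrow> u x = 0"
  by (simp add: W0_def)

lemma W0_energy: "u \<in> W0 s p U \<Longrightarrow> gagliardo_energy s p u < \<infinity>"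
  by (simp add: W0_def)

lemma W0_nn_integral_powr:
  assumes "u \<in> W0 s p U"
  shows "power_integral p u < \<infinity>"
  using assms by (auto simp: W0_def integrable_iff_bounded)

lemma W0I:
  assumes "u \<in> borel_measurable borel" "power_integral p u < \<infinity>"
    "gagliardo_energy s p u < \<infinity>" "AE x in lborel. x \<notin> U \<longrightarrow> u x = 0"
  shows "u \<in> W0 s p U"
proof -
  have "(\<lambda>x. \<bar>u x\<bar> powr p) \<in> borel_measurable lborel" using assms(1) by measurable
  then show ?thesis using assms by (simp add: W0_def integrable_iff_bounded)
qed

lemma W0_scale:
  assumes "u \<in> W0 s p U" "p > 0"
  shows "(\<lambda>x. c * u x) \<in> W0 s p U"
proof (rule W0I)
  note [measurable] = W0_measurable[OF assms(1)]
  show "(\<lambda>x. c * u x) \<in> borel_measurable borel" by measurable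
  show "(\<integral>\<^sup>+ x. ennreal (\<bar>c * u x\<bar> powr p) \<partial>lborel) < \<infinity>"
    using W0_nn_integral_powr[OF assms(1)]
    by (simp add: abs_mult powr_mult ennreal_mult nn_integral_cmult ennreal_mult_less_top)
  show "gagliardo_energy s p (\<lambda>x. c * u x) < \<infinity>"
    using W0_energy[OF assms(1)] by (simp add: gagliardo_energy_scale ennreal_mult_less_top)
  show "AE x in lborel. x \<notin> U \<longrightarrow> c * u x = 0"
    using W0_outside[OF assms(1)] by eventually_elim auto
qed

text \<open>An infinite integral causes no mismatch: the Bochner integral and
  \<open>enn2real\<close> then both return 0, so neither side of the equivalence holds.\<close>

lemma Lq_norm_eq_1_iff:
  fixes u :: "real ^ 'n \<Rightarrow> real"
  assumes "u \<in> W0 s p U" "U \<in> sets borel" "q > 0"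
  shows "Lq_norm q U u = 1 \<longleftrightarrow> power_integral q u = 1"
proof -
  note [measurable] = W0_measurable[OF assms(1)] assms(2)
  have eq: "(LINT x:U|lborel. \<bar>u x\<bar> powr q) = (LINT x|lborel. \<bar>u x\<bar> powr q)"
    unfolding set_lebesgue_integral_def
    by (rule integral_cong_AE) (use W0_outside[OF assms(1)] assms(3) in \<open>auto split: split_indicator elim: eventually_mono\<close>)
  also have "\<dots> = enn2real (power_integral q u)"
    by (rule integral_eq_nn_integral) auto
  finally have *: "(LINT x:U|lborel. \<bar>u x\<bar> powr q) = enn2real (power_integral q u)" (is "_ = ?r") .
  have "Lq_norm q U u = 1 \<longleftrightarrow> ?r = 1"
  proof -
    have "?r = (?r powr (1 / q)) powr q" using assms(3) by (simp add: powr_powr)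
    then show ?thesis unfolding Lq_norm_def * using assms(3) by (metis powr_one_eq_one)
  qed
  also have "\<dots> \<longleftrightarrow> power_integral q u = 1"
    by (cases "\<integral>\<^sup>+ x. ennreal (\<bar>u x\<bar> powr q) \<partial>lborel") auto
  finally show ?thesis .
qed

lemma frac_eigenvalue_le_energy:
  fixes v :: "real ^ 'n \<Rightarrow> real"
  assumes v: "v \<in> W0 s p U" and U: "U \<in> sets borel" and p: "p > 0" and q: "q > 0"
    and ge1: "1 \<le> power_integral q v"
    and fin: "power_integral q v < \<infinity>"
  shows "frac_eigenvalue s p q U \<le> enn2real (gagliardo_energy s p v)"
proof -
  note [measurable] = W0_measurable[OF v]
  obtain c where c: "power_integral q v = ennreal c" "c \<ge> 1"
    using ge1 fin by (cases "\<integral>\<^sup>+ x. ennreal (\<bar>v x\<bar> powr q) \<partial>lborel") auto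
  define k where "k = c powr (- (1 / q))"
  have k: "0 < k" "k \<le> 1" "k powr q = 1 / c"
    using c(2) q powr_powr[of c "- (1 / q)" q]
    by (auto simp: k_def powr_minus_divide ge_one_powr_ge_zero)
  define w where "w = (\<lambda>x. k * v x)"
  have w: "w \<in> W0 s p U" unfolding w_def by (rule W0_scale[OF v p])
  have "power_integral q w = ennreal (k powr q) * ennreal c"
    unfolding w_def using k(1) by (simp add: abs_mult powr_mult ennreal_mult nn_integral_cmult c(1))
  also have "\<dots> = 1" using k c(2) by (simp flip: ennreal_mult)
  finally have "Lq_norm q U w = 1" using Lq_norm_eq_1_iff[OF w U q] by simp
  then have "frac_eigenvalue s p q U \<le> gagliardo_seminorm s p w powr p"
    unfolding frac_eigenvalue_def
    by (intro cInf_lower bdd_belowI[of _ 0]) (use w in auto)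
  also have "\<dots> = enn2real (ennreal (k powr p) * gagliardo_energy s p v)"
    using p k by (simp add: gagliardo_seminorm_powr w_def gagliardo_energy_scale)
  also have "\<dots> \<le> enn2real (gagliardo_energy s p v)"
  proof (rule enn2real_mono)
    have "k powr p \<le> 1" using k p by (simp add: powr_le1)
    then have "ennreal (k powr p) * gagliardo_energy s p v \<le> 1 * gagliardo_energy s p v"
      by (intro mult_right_mono) (auto simp: ennreal_le_1)
    then show "ennreal (k powr p) * gagliardo_energy s p v \<le> gagliardo_energy s p v" by simp
    show "gagliardo_energy s p v < top" using W0_energy[OF v] by simp
  qed
  finally show ?thesis .
qed

text \<open>Once normalised, \<open>\<phi>\<close> shows that there are competitors at all, so that
  the real \<open>Inf\<close> is a genuine infimum and can be approached.\<close>

lemma frac_eigenvalue_minimizing_sequence: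
  fixes \<phi> :: "real ^ 'n \<Rightarrow> real"
  assumes \<phi>: "\<phi> \<in> W0 s p U" and U: "U \<in> sets borel" and p: "p > 0" and q: "q > 0"
    and pos: "0 < power_integral q \<phi>"
    and fin: "power_integral q \<phi> < \<infinity>"
  obtains u :: "nat \<Rightarrow> real ^ 'n \<Rightarrow> real" where
    "\<And>n. u n \<in> W0 s p U" "\<And>n. power_integral q (u n) = 1"
    "\<And>n. gagliardo_energy s p (u n) \<le> ennreal (frac_eigenvalue s p q U + 1 / real (Suc n))"
    "0 \<le> frac_eigenvalue s p q U"
proof -
  note [measurable] = W0_measurable[OF \<phi>]
  define S where "S = {gagliardo_seminorm s p u powr p | u. u \<in> W0 s p U \<and> Lq_norm q U u = 1}"
  obtain c where c: "power_integral q \<phi> = ennreal c" "c > 0"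
    using pos fin by (cases "\<integral>\<^sup>+ x. ennreal (\<bar>\<phi> x\<bar> powr q) \<partial>lborel") auto
  define k where "k = c powr (- (1 / q))"
  have k: "0 < k" "k powr q = 1 / c"
    using c(2) q powr_powr[of c "- (1 / q)" q] by (auto simp: k_def powr_minus_divide)
  define w where "w = (\<lambda>x. k * \<phi> x)"
  have w: "w \<in> W0 s p U" unfolding w_def by (rule W0_scale[OF \<phi> p])
  have "power_integral q w = ennreal (k powr q) * ennreal c"
    unfolding w_def using k(1) by (simp add: abs_mult powr_mult ennreal_mult nn_integral_cmult c(1))
  also have "\<dots> = 1" using k c(2) by (simp flip: ennreal_mult)
  finally have "Lq_norm q U w = 1" using Lq_norm_eq_1_iff[OF w U q] by simp
  then have ne: "S \<noteq> {}" unfolding S_def using w by blast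
  have "\<exists>u. u \<in> W0 s p U \<and> power_integral q u = 1 \<and>
     gagliardo_energy s p u \<le> ennreal (frac_eigenvalue s p q U + 1 / real (Suc n))" for n
  proof -
    have "\<exists>e\<in>S. e < Inf S + 1 / real (Suc n)"
      by (rule cInf_lessD[OF ne]) simp
    then have "\<exists>u. u \<in> W0 s p U \<and> Lq_norm q U u = 1 \<and>
        enn2real (gagliardo_energy s p u) < Inf S + 1 / real (Suc n)"
      using gagliardo_seminorm_powr[OF p, where ?'a = 'n] by (auto simp: S_def)
    then obtain u where u: "u \<in> W0 s p U" "Lq_norm q U u = 1"
      "enn2real (gagliardo_energy s p u) < Inf S + 1 / real (Suc n)"
      by blast
    have "gagliardo_energy s p u = ennreal (enn2real (gagliardo_energy s p u))"
      using W0_energy[OF u(1)] by (simp add: ennreal_enn2real_if less_top)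
    also have "\<dots> \<le> ennreal (frac_eigenvalue s p q U + 1 / real (Suc n))"
      using u(3) by (intro ennreal_leI) (simp add: S_def frac_eigenvalue_def)
    finally show ?thesis using u Lq_norm_eq_1_iff[OF u(1) U q] by blast
  qed
  then obtain u where u: "\<And>n. u n \<in> W0 s p U \<and> power_integral q (u n) = 1 \<and>
     gagliardo_energy s p (u n) \<le> ennreal (frac_eigenvalue s p q U + 1 / real (Suc n))"
    by metis
  have "0 \<le> frac_eigenvalue s p q U"
    unfolding frac_eigenvalue_def by (rule cInf_greatest) (use ne in \<open>auto simp: S_def\<close>)
  with u that show thesis by blast
qed

section \<open>Finite energy of cone functions\<close>

lemma emeasure_ball_pow:
  "0 \<le> r \<Longrightarrow> emeasure lborel (ball (0 :: real ^ 'n) r) = ennreal (unit_ball_vol (real CARD('n)) * r powr real CARD('n))"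
  by (subst emeasure_ball) (auto simp: powr_realpow')

lemma dyadic_shell:
  fixes t :: real assumes "t > 0"
  obtains n :: nat where "t < 1" "1 / 2 ^ Suc n \<le> t" "t < 1 / 2 ^ n"
  | n :: nat where "1 \<le> t" "2 ^ n \<le> t" "t < 2 ^ Suc n"
proof (cases "t < 1")
  case False
  define n where "n = (LEAST n. t < 2 ^ Suc n)"
  obtain m where "t < 2 ^ m" using real_arch_pow[of 2 t] by auto
  then have "t < 2 ^ Suc m" by (auto intro: less_trans)
  then have *: "t < 2 ^ Suc n" unfolding n_def by (rule LeastI)
  have "2 ^ n \<le> t"
  proof (cases n)
    case 0 then show ?thesis using False by simp
  next
    case (Suc m)
    then have "\<not> t < 2 ^ Suc m" using not_less_Least[of m "\<lambda>n. t < 2 ^ Suc n"] n_def by auto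
    then show ?thesis using Suc by simp
  qed
  with * False show ?thesis using that(2) by auto
next
  case True
  define n where "n = (LEAST n. 1 / 2 ^ Suc n \<le> t)"
  obtain m where "(1/2) ^ m < t" using real_arch_pow_inv[OF assms, of "1/2"] by auto
  then have "1 / 2 ^ m < t" by (simp add: power_divide)
  then have "1 / 2 ^ Suc m \<le> t" using assms by (simp add: field_simps)
  then have *: "1 / 2 ^ Suc n \<le> t" unfolding n_def by (rule LeastI)
  have "t < 1 / 2 ^ n"
  proof (cases n)
    case 0 then show ?thesis using True by simp
  next
    case (Suc m)
    then have "\<not> 1 / 2 ^ Suc m \<le> t" using not_less_Least[of m "\<lambda>n. 1 / 2 ^ Suc n \<le> t"] n_def by auto
    then show ?thesis using Suc by simp
  qed
  with * True show ?thesis using that(1) by auto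
qed

lemma suminf_geometric_ennreal_finite:
  fixes C a :: real assumes "C \<ge> 0" "a < 0"
  shows "(\<Sum>n. ennreal (C * 2 powr (a * real n))) < \<infinity>"
proof -
  have "summable (\<lambda>n. (2 powr a) ^ n)"
    using assms by (intro summable_geometric) (simp add: powr_less_one)
  then have "summable (\<lambda>n. C * 2 powr (a * real n))"
    by (intro summable_mult) (simp add: powr_powr flip: powr_realpow)
  then show ?thesis using assms by (subst suminf_ennreal2) auto
qed

text \<open>Near the origin the integrand is \<open>|h| powr (p - d - s * p)\<close>, integrable as
  \<open>s < 1\<close>; far away it is \<open>|h| powr (- d - s * p)\<close>, integrable as
  \<open>s > 0\<close>. On each dyadic shell it is bounded by a constant, and the shell is enlarged
  to a ball of explicit volume. The resulting series are geometric with ratios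
  \<open>2 powr (s * p - p)\<close> and \<open>2 powr (- (s * p))\<close>.\<close>

lemma nn_integral_truncated_kernel_finite:
  assumes "0 < s" "s < 1" "1 < p"
  shows "(\<integral>\<^sup>+ h. ennreal (min 1 (norm h) powr p / norm h powr (real CARD('n) + s * p)) \<partial>(lborel :: (real ^ 'n) measure)) < \<infinity>"
proof -
  define d where "d = real CARD('n)"
  define V where "V = unit_ball_vol d"
  have V: "V \<ge> 0" by (simp add: V_def d_def)
  \<comment> \<open>Bounds for the integrand on the inner and outer shells. The factor
    \<open>2 powr (d + s * p)\<close> comes from bounding the denominator at the inner radius of the
    shell.\<close>
  define cf where "cf n = 2 powr (d + s * p) * 2 powr ((d + s * p - p) * real n)" for n
  define cg where "cg n = 2 powr (- (d + s * p) * real n)" for n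
  have c_nonneg: "cf n \<ge> 0" "cg n \<ge> 0" for n by (simp_all add: cf_def cg_def)
  define f where "f = (\<lambda>n h. ennreal (cf n) * indicator (ball (0 :: real ^ 'n) (1 / 2 ^ n)) h)"
  define g where "g = (\<lambda>n h. ennreal (cg n) * indicator (ball (0 :: real ^ 'n) (2 ^ Suc n)) h)"
  have [measurable]: "f n \<in> borel_measurable lborel" "g n \<in> borel_measurable lborel" for n
    unfolding f_def g_def
    by (intro borel_measurable_times_ennreal borel_measurable_const borel_measurable_indicator; simp)+
  have le: "ennreal (min 1 (norm h) powr p / norm h powr (d + s * p)) \<le> (\<Sum>n. f n h) + (\<Sum>n. g n h)" for h :: "real ^ 'n"
  proof (cases "h = 0")
    case False
    then have "norm h > 0" by simp
    then show ?thesis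
    proof (cases rule: dyadic_shell)
      case (1 n)
      have "min 1 (norm h) powr p \<le> (1 / 2 ^ n) powr p" using 1 assms by (intro powr_mono2) auto
      moreover have "(1 / 2 ^ Suc n) powr (d + s * p) \<le> norm h powr (d + s * p)"
        using 1 assms by (intro powr_mono2) (auto simp: d_def)
      ultimately have "min 1 (norm h) powr p / norm h powr (d + s * p) \<le> (1 / 2 ^ n) powr p / (1 / 2 ^ Suc n) powr (d + s * p)"
        by (intro frac_le) auto
      also have "\<dots> = cf n"
      proof -
        have a: "(1 / 2 ^ n) = (2 :: real) powr (- real n)" for n by (simp add: powr_minus_divide powr_realpow)
        show ?thesis unfolding a powr_powr cf_def powr_diff[symmetric] powr_add[symmetric]
          by (rule arg_cong[where f = "\<lambda>t. 2 powr t"]) (simp add: algebra_simps)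
      qed
      finally have "ennreal (min 1 (norm h) powr p / norm h powr (d + s * p)) \<le> f n h"
        using 1 by (auto simp: f_def intro!: ennreal_leI)
      also have "\<dots> \<le> (\<Sum>n. f n h)" using sum_le_suminf[of "\<lambda>n. f n h" "{n}"] by simp
      also have "\<dots> \<le> (\<Sum>n. f n h) + (\<Sum>n. g n h)" by simp
      finally show ?thesis .
    next
      case (2 n)
      have "(2 ^ n) powr (d + s * p) \<le> norm h powr (d + s * p)"
        using 2 assms by (intro powr_mono2) (auto simp: d_def)
      then have "min 1 (norm h) powr p / norm h powr (d + s * p) \<le> 1 / (2 ^ n) powr (d + s * p)"
        using 2 by (intro frac_le) auto
      also have "\<dots> = cg n"
      proof -
        have a: "2 ^ n = (2 :: real) powr real n" by (simp add: powr_realpow)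
        show ?thesis unfolding a powr_powr cg_def powr_minus_divide[symmetric]
          by (rule arg_cong[where f = "\<lambda>t. 2 powr t"]) (simp add: algebra_simps)
      qed
      finally have "ennreal (min 1 (norm h) powr p / norm h powr (d + s * p)) \<le> g n h"
        using 2 by (auto simp: g_def intro!: ennreal_leI)
      also have "\<dots> \<le> (\<Sum>n. g n h)" using sum_le_suminf[of "\<lambda>n. g n h" "{n}"] by simp
      also have "\<dots> \<le> (\<Sum>n. f n h) + (\<Sum>n. g n h)" by simp
      finally show ?thesis .
    qed
  qed simp
  have "(\<integral>\<^sup>+ h. ennreal (min 1 (norm h) powr p / norm h powr (d + s * p)) \<partial>(lborel :: (real ^ 'n) measure)) \<le>
      (\<integral>\<^sup>+ h. (\<Sum>n. f n h) + (\<Sum>n. g n h) \<partial>lborel)"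
    by (intro nn_integral_mono le)
  also have "\<dots> = (\<Sum>n. \<integral>\<^sup>+ h. f n h \<partial>lborel) + (\<Sum>n. \<integral>\<^sup>+ h. g n h \<partial>lborel)"
    by (subst nn_integral_add) (auto simp: nn_integral_suminf)
  also have "(\<Sum>n. \<integral>\<^sup>+ h. f n h \<partial>lborel) = (\<Sum>n. ennreal (2 powr (d + s * p) * V * 2 powr ((s * p - p) * real n)))"
  proof (intro suminf_cong)
    fix n
    have "(1 / 2 ^ n) = (2 :: real) powr (- real n)" by (simp add: powr_minus_divide powr_realpow)
    then have "cf n * (V * (1 / 2 ^ n) powr d) = V * (2 powr (d + s * p) * 2 powr ((d + s * p - p) * real n) * 2 powr (- real n * d))"
      by (simp only: powr_powr cf_def mult_ac)
    also have "2 powr (d + s * p) * 2 powr ((d + s * p - p) * real n) * 2 powr (- real n * d) = 2 powr (d + s * p) * 2 powr ((s * p - p) * real n)"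
      unfolding powr_add[symmetric]
      by (rule arg_cong[where f = "\<lambda>t. 2 powr t"]) (simp add: algebra_simps)
    finally have "cf n * (V * (1 / 2 ^ n) powr d) = 2 powr (d + s * p) * V * 2 powr ((s * p - p) * real n)"
      by (simp only: mult_ac)
    moreover have "(\<integral>\<^sup>+ h. f n h \<partial>lborel) = ennreal (cf n * (V * (1 / 2 ^ n) powr d))"
      using V c_nonneg unfolding f_def
      by (subst nn_integral_cmult) (auto intro!: borel_measurable_indicator simp: emeasure_ball_pow ennreal_mult simp flip: d_def V_def)
    ultimately show "(\<integral>\<^sup>+ h. f n h \<partial>lborel) = ennreal (2 powr (d + s * p) * V * 2 powr ((s * p - p) * real n))"
      by metis
  qed
  also have "(\<Sum>n. \<integral>\<^sup>+ h. g n h \<partial>lborel) = (\<Sum>n. ennreal (2 powr d * V * 2 powr (- (s * p) * real n)))"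
  proof (intro suminf_cong)
    fix n
    have "2 ^ Suc n = (2 :: real) powr (real (Suc n))" by (simp only: powr_realpow zero_less_numeral)
    then have "cg n * (V * (2 ^ Suc n) powr d) = V * (2 powr (- (d + s * p) * real n) * 2 powr (real (Suc n) * d))"
      by (simp only: powr_powr cg_def mult_ac)
    also have "2 powr (- (d + s * p) * real n) * 2 powr (real (Suc n) * d) = 2 powr d * 2 powr (- (s * p) * real n)"
      unfolding powr_add[symmetric]
      by (rule arg_cong[where f = "\<lambda>t. 2 powr t"]) (simp add: algebra_simps)
    finally have "cg n * (V * (2 ^ Suc n) powr d) = 2 powr d * V * 2 powr (- (s * p) * real n)"
      by (simp only: mult_ac)
    moreover have "(\<integral>\<^sup>+ h. g n h \<partial>lborel) = ennreal (cg n * (V * (2 ^ Suc n) powr d))"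
      using V c_nonneg unfolding g_def
      by (subst nn_integral_cmult) (auto intro!: borel_measurable_indicator simp: emeasure_ball_pow ennreal_mult simp del: power_Suc simp flip: d_def V_def)
    ultimately show "(\<integral>\<^sup>+ h. g n h \<partial>lborel) = ennreal (2 powr d * V * 2 powr (- (s * p) * real n))"
      by metis
  qed
  also have "(\<Sum>n. ennreal (2 powr (d + s * p) * V * 2 powr ((s * p - p) * real n))) + (\<Sum>n. ennreal (2 powr d * V * 2 powr (- (s * p) * real n))) < \<infinity>"
  proof -
    have neg: "s * p - p < 0" "- (s * p) < 0" using assms by auto
    have nn: "0 \<le> 2 powr (d + s * p) * V" "0 \<le> 2 powr d * V" using V by auto
    show ?thesis
      using suminf_geometric_ennreal_finite[OF nn(1) neg(1)] suminf_geometric_ennreal_finite[OF nn(2) neg(2)]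
      by (simp only: infinity_ennreal_def ennreal_add_less_top)
  qed
  finally show ?thesis by (simp add: d_def)
qed

section \<open>Cone functions as test functions\<close>

lemma nn_integral_lborel_translate:
  fixes f :: "'a::euclidean_space \<Rightarrow> ennreal"
  assumes "f \<in> borel_measurable borel"
  shows "(\<integral>\<^sup>+ y. f (c + y) \<partial>lborel) = (\<integral>\<^sup>+ y. f y \<partial>lborel)"
  using nn_integral_distr[of "(+) c" lborel borel f] assms by (simp add: lborel_distr_plus)

definition bump :: "'a::real_normed_vector \<Rightarrow> real \<Rightarrow> 'a \<Rightarrow> real" where
  "bump z r x = max 0 (r - norm (x - z))"

lemma bump_nonneg [simp]: "0 \<le> bump z r x"
  by (simp add: bump_def)

lemma bump_le: "r \<ge> 0 \<Longrightarrow> bump z r x \<le> r"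
  by (simp add: bump_def)

lemma bump_pos_iff: "0 < bump z r x \<longleftrightarrow> x \<in> ball z r"
  by (auto simp: bump_def dist_norm norm_minus_commute)

lemma bump_outside: "x \<notin> ball z r \<Longrightarrow> bump z r x = 0"
  by (auto simp: bump_def dist_norm norm_minus_commute)

lemma bump_lipschitz: "\<bar>bump z r x - bump z r y\<bar> \<le> norm (x - y)"
  using norm_triangle_ineq3[of "x - z" "y - z"] by (auto simp: bump_def max_def)

lemma borel_measurable_bump [measurable]: "bump z r \<in> borel_measurable (borel :: 'a::euclidean_space measure)"
  unfolding bump_def[abs_def] by measurable

lemma nn_integral_bump_powr_finite:
  assumes "r \<ge> 0" "p > 0"
  shows "(\<integral>\<^sup>+ x. ennreal (\<bar>bump (z :: 'a::euclidean_space) r x\<bar> powr p) \<partial>lborel) < \<infinity>"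
proof -
  have "(\<integral>\<^sup>+ x. ennreal (\<bar>bump z r x\<bar> powr p) \<partial>lborel) \<le> (\<integral>\<^sup>+ x. ennreal (r powr p) * indicator (ball z r) x \<partial>lborel)"
    by (intro nn_integral_mono)
      (use assms in \<open>auto simp: bump_outside split: split_indicator intro!: ennreal_leI powr_mono2 bump_le\<close>)
  also have "\<dots> = ennreal (r powr p) * emeasure lborel (ball z r)"
    by (simp add: nn_integral_cmult_indicator)
  also have "\<dots> < \<infinity>"
    using emeasure_lborel_ball_finite[of z r] by (simp add: ennreal_mult_less_top)
  finally show ?thesis .
qed

lemma nn_integral_bump_powr_pos:
  assumes "r > 0"
  shows "0 < (\<integral>\<^sup>+ x. ennreal (\<bar>bump (z :: 'a::euclidean_space) r x\<bar> powr p) \<partial>lborel)"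
proof (rule ccontr)
  assume "\<not> ?thesis"
  then have "AE x in lborel. ennreal (\<bar>bump z r x\<bar> powr p) = 0"
    by (subst nn_integral_0_iff_AE[symmetric]) auto
  then have "AE x in lborel. x \<notin> ball z r"
  proof eventually_elim
    case (elim x)
    then have "bump z r x = 0" by (simp add: ennreal_eq_0_iff)
    then show ?case using bump_pos_iff[of z r x] by simp
  qed
  then have "emeasure lborel (ball z r) = 0"
    by (subst (asm) AE_iff_measurable[of "ball z r"]) auto
  moreover have "emeasure lborel (ball z r) > 0"
    using assms by (subst emeasure_ball) (auto simp: ennreal_zero_less_mult_iff)
  ultimately show False by simp
qed

text \<open>A pair contributes only if one of its points lies in the ball, and a bounded Lipschitz
  function has differences of at most \<open>max 1 r * min 1 |x - y|\<close>. By translation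
  invariance each of the two terms is a multiple of the volume of the ball times the integral of the
  truncated kernel.\<close>

lemma gagliardo_energy_bump_finite:
  fixes z :: "real ^ 'n"
  assumes "0 < s" "s < 1" "1 < p" "r \<ge> 0"
  shows "gagliardo_energy s p (bump z r) < \<infinity>"
proof -
  define C where "C = max 1 r powr p"
  have C: "C \<ge> 0" by (simp add: C_def)
  define K where "K h = ennreal (min 1 (norm h) powr p / norm h powr (real CARD('n) + s * p))" for h :: "real ^ 'n"
  have [measurable]: "K \<in> borel_measurable borel" unfolding K_def[abs_def] by measurable
  define I where "I = (\<lambda>x. indicator (ball z r) x :: ennreal)"
  have I [measurable]: "I \<in> borel_measurable borel" unfolding I_def
    by (intro borel_measurable_indicator) simp
  have fin: "(\<integral>\<^sup>+ h. K h \<partial>lborel) < \<infinity>"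
    unfolding K_def using nn_integral_truncated_kernel_finite[OF assms(1-3), where ?'n = 'n] .
  have trans: "(\<integral>\<^sup>+ y. K (x - y) \<partial>lborel) = (\<integral>\<^sup>+ h. K h \<partial>lborel)" for x
    using nn_integral_lborel_translate[of K "- x"] by (simp add: K_def norm_minus_commute)
  have Ifin: "(\<integral>\<^sup>+ x. I x \<partial>lborel) < \<infinity>"
    using emeasure_lborel_ball_finite[of z r] by (simp add: I_def)
  have 1: "(\<integral>\<^sup>+ x. \<integral>\<^sup>+ y. I x * K (x - y) \<partial>lborel \<partial>lborel) = (\<integral>\<^sup>+ x. I x \<partial>lborel) * (\<integral>\<^sup>+ h. K h \<partial>lborel)"
    by (simp add: nn_integral_cmult trans nn_integral_multc)
  have "(\<integral>\<^sup>+ x. \<integral>\<^sup>+ y. I y * K (x - y) \<partial>lborel \<partial>lborel) = (\<integral>\<^sup>+ y. \<integral>\<^sup>+ x. I y * K (x - y) \<partial>lborel \<partial>lborel)"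
    by (rule lborel_pair.Fubini'[symmetric]) measurable
  also have "\<dots> = (\<integral>\<^sup>+ x. \<integral>\<^sup>+ y. I x * K (x - y) \<partial>lborel \<partial>lborel)"
    by (simp add: K_def norm_minus_commute)
  finally have 2: "(\<integral>\<^sup>+ x. \<integral>\<^sup>+ y. I y * K (x - y) \<partial>lborel \<partial>lborel) = (\<integral>\<^sup>+ x. I x \<partial>lborel) * (\<integral>\<^sup>+ h. K h \<partial>lborel)"
    using 1 by simp
  have le: "ennreal (\<bar>bump z r x - bump z r y\<bar> powr p / norm (x - y) powr (real CARD('n) + s * p))
      \<le> ennreal C * (I x * K (x - y)) + ennreal C * (I y * K (x - y))" for x y
  proof (cases "x \<in> ball z r \<or> y \<in> ball z r")
    case True
    have "\<bar>bump z r x - bump z r y\<bar> \<le> r"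
      using bump_le[OF assms(4), of z x] bump_le[OF assms(4), of z y] bump_nonneg[of z r x] bump_nonneg[of z r y] by linarith
    with bump_lipschitz[of z r x y] have "\<bar>bump z r x - bump z r y\<bar> \<le> max 1 r * min 1 (norm (x - y))"
      using mult_right_mono[of 1 "max 1 r" "norm (x - y)"] by (cases "norm (x - y) \<le> 1") auto
    then have "\<bar>bump z r x - bump z r y\<bar> powr p \<le> (max 1 r * min 1 (norm (x - y))) powr p"
      using assms by (intro powr_mono2) auto
    also have "\<dots> = C * min 1 (norm (x - y)) powr p"
      unfolding C_def by (rule powr_mult)
    finally have "\<bar>bump z r x - bump z r y\<bar> powr p / norm (x - y) powr (real CARD('n) + s * p) \<le>
        C * (min 1 (norm (x - y)) powr p / norm (x - y) powr (real CARD('n) + s * p))"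
      by (simp add: divide_right_mono)
    then have "ennreal (\<bar>bump z r x - bump z r y\<bar> powr p / norm (x - y) powr (real CARD('n) + s * p)) \<le> ennreal C * K (x - y)"
      unfolding K_def using C by (subst ennreal_mult[symmetric]) (auto intro: ennreal_leI)
    also have "\<dots> \<le> ennreal C * (I x * K (x - y)) + ennreal C * (I y * K (x - y))"
      using True by (auto simp: I_def)
    finally show ?thesis .
  qed (simp add: bump_outside)
  have "gagliardo_energy s p (bump z r) \<le> (\<integral>\<^sup>+ x. \<integral>\<^sup>+ y. ennreal C * (I x * K (x - y)) + ennreal C * (I y * K (x - y)) \<partial>lborel \<partial>lborel)"
    unfolding gagliardo_energy_def by (intro nn_integral_mono le)
  also have "\<dots> = ennreal C * (\<integral>\<^sup>+ x. \<integral>\<^sup>+ y. I x * K (x - y) \<partial>lborel \<partial>lborel) + ennreal C * (\<integral>\<^sup>+ x. \<integral>\<^sup>+ y. I y * K (x - y) \<partial>lborel \<partial>lborel)"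
    by (simp add: nn_integral_add nn_integral_cmult)
  also have "\<dots> < \<infinity>"
    unfolding 1 2 using fin Ifin by (simp add: ennreal_mult_less_top)
  finally show ?thesis .
qed

section \<open>Dyadic averages\<close>

text \<open>Comparing integer parts makes membership an equivalence relation, so the cells are
  half-open cubes that tile the space, and it is measurable jointly in both points, as Fubini
  requires.\<close>

definition cell :: "nat \<Rightarrow> real ^ 'n \<Rightarrow> (real ^ 'n) set" where
  "cell j x = {y. \<forall>i. \<lfloor>2 ^ j * y $ i\<rfloor> = \<lfloor>2 ^ j * x $ i\<rfloor>}"

lemma mem_cell_self [simp]: "x \<in> cell j x"
  by (simp add: cell_def)

lemma mem_cell_commute: "y \<in> cell j x \<longleftrightarrow> x \<in> cell j y"
  by (auto simp: cell_def)

lemma cell_cong: "y \<in> cell j x \<Longrightarrow> cell j y = cell j x"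
  by (auto simp: cell_def)

lemma cell_Suc_subset: "cell (Suc j) x \<subseteq> cell j x"
proof
  fix y assume y: "y \<in> cell (Suc j) x"
  have half: "\<lfloor>2 ^ j * t\<rfloor> = \<lfloor>2 ^ Suc j * t\<rfloor> div 2" for t :: real
    using floor_divide_real_eq_div[of 2 "2 ^ Suc j * t"] by simp
  from y show "y \<in> cell j x" unfolding cell_def half by simp
qed

text \<open>The factor \<open>CARD('n)\<close> comes from bounding the Euclidean norm by the sum of
  the coordinates.\<close>

lemma cell_diam:
  assumes "y \<in> cell j x" "z \<in> cell j (x :: real ^ 'n)"
  shows "norm (y - z) \<le> real CARD('n) / 2 ^ j"
proof -
  have "\<bar>(y - z) $ i\<bar> \<le> 1 / 2 ^ j" for i
  proof -
    have "\<lfloor>2 ^ j * y $ i\<rfloor> = \<lfloor>2 ^ j * z $ i\<rfloor>" using assms by (simp add: cell_def)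
    then have "\<bar>2 ^ j * y $ i - 2 ^ j * z $ i\<bar> \<le> 1" by linarith
    then have "2 ^ j * \<bar>y $ i - z $ i\<bar> \<le> 1" by (simp add: abs_mult flip: right_diff_distrib)
    then show ?thesis by (simp add: field_simps)
  qed
  then have "(\<Sum>i\<in>UNIV. \<bar>(y - z) $ i\<bar>) \<le> (\<Sum>i\<in>(UNIV :: 'n set). 1 / 2 ^ j)" by (rule sum_mono)
  with norm_le_l1_cart[of "y - z"] show ?thesis by simp
qed

lemma mem_cell_iff:
  "y \<in> cell j x \<longleftrightarrow> (\<forall>i. real_of_int \<lfloor>2 ^ j * x $ i\<rfloor> / 2 ^ j \<le> y $ i \<and> y $ i < (real_of_int \<lfloor>2 ^ j * x $ i\<rfloor> + 1) / 2 ^ j)"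
  unfolding cell_def mem_Collect_eq floor_eq_iff by (simp add: field_simps)

lemma sets_cell [measurable]: "cell j x \<in> sets borel"
proof -
  have "cell j x = (\<Inter>i. {y. \<lfloor>2 ^ j * y $ i\<rfloor> = \<lfloor>2 ^ j * x $ i\<rfloor>})" by (auto simp: cell_def)
  also have "\<dots> \<in> sets borel" by measurable
  finally show ?thesis .
qed

lemma pred_cell [measurable (raw)]:
  assumes [measurable]: "f \<in> borel_measurable M" "g \<in> borel_measurable M"
  shows "Measurable.pred M (\<lambda>z. g z \<in> cell j (f z :: real ^ 'n))"
proof -
  have c: "(\<lambda>x :: real ^ 'n. x $ i) \<in> borel_measurable borel" for i
    by (intro borel_measurable_continuous_onI continuous_intros)
  have [measurable]: "(\<lambda>z. f z $ i) \<in> borel_measurable M" "(\<lambda>z. g z $ i) \<in> borel_measurable M" for i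
    using measurable_compose[OF assms(1) c] measurable_compose[OF assms(2) c] by auto
  show ?thesis unfolding cell_def mem_Collect_eq by measurable
qed

lemma emeasure_cell: "emeasure lborel (cell j (x :: real ^ 'n)) = ennreal ((1 / 2 ^ j) ^ CARD('n))"
proof -
  define a where "a = (\<chi> i. real_of_int \<lfloor>2 ^ j * x $ i\<rfloor> / 2 ^ j)"
  define b where "b = (\<chi> i. (real_of_int \<lfloor>2 ^ j * x $ i\<rfloor> + 1) / 2 ^ j)"
  have ab: "(b - a) $ i = 1 / 2 ^ j" for i by (simp add: a_def b_def field_simps)
  have prd: "prod ((\<bullet>) (b - a)) Basis = (1 / 2 ^ j) ^ CARD('n)"
  proof -
    have "prod ((\<bullet>) (b - a)) Basis = prod (\<lambda>_. 1 / 2 ^ j) (Basis :: (real ^ 'n) set)"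
      using ab by (intro prod.cong refl) (auto simp: Basis_vec_def inner_axis)
    then show ?thesis by simp
  qed
  have le: "a \<bullet> i \<le> b \<bullet> i" if "i \<in> Basis" for i
    using that ab by (auto simp: Basis_vec_def inner_axis a_def b_def divide_right_mono)
  \<comment> \<open>The half-open cube lies between an open and a closed box of the same
    volume.\<close>
  have "box a b \<subseteq> cell j x" "cell j x \<subseteq> cbox a b"
    by (auto simp: mem_cell_iff mem_box_cart a_def b_def less_imp_le)
  then have "emeasure lborel (box a b) \<le> emeasure lborel (cell j x)"
    "emeasure lborel (cell j x) \<le> emeasure lborel (cbox a b)"
    by (auto intro!: emeasure_mono)
  then show ?thesis using le prd
    by (simp add: emeasure_lborel_box emeasure_lborel_cbox)
qed

text \<open>
  The constant \<open>2\<^sup>p\<close> is not sharp; it comes from the elementary \<open>t \<le> L + L\<^bsup>1-p\<^esup> t\<^sup>p\<close>, integrated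
  and then optimised over \<open>L\<close>, which replaces Jensen's inequality.
\<close>

lemma powr_mean_deviation_le:
  fixes f :: "'a \<Rightarrow> real"
  assumes A: "A \<in> sets M" "emeasure M A = ennreal v" "v > 0"
    and int: "integrable M (\<lambda>y. indicator A y * f y)" and p: "p \<ge> 1"
  shows "ennreal (\<bar>(LINT y|M. indicator A y * f y) / v - c\<bar> powr p) \<le>
    ennreal (2 powr p / v) * (\<integral>\<^sup>+ y. indicator A y * ennreal (\<bar>f y - c\<bar> powr p) \<partial>M)"
    (is "_ \<le> _ * ?I")
proof (cases "?I = \<infinity>")
  case True
  have "ennreal (2 powr p / v) \<noteq> 0" using divide_pos_pos[of "2 powr p" v] A(3) by (simp add: ennreal_eq_0_iff not_le del: zero_less_divide_iff divide_le_0_iff)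
  then have "ennreal (2 powr p / v) * ?I = top" unfolding True by (simp add: ennreal_mult_top)
  then show ?thesis by simp
next
  case False
  then obtain J where J: "?I = ennreal J" "J \<ge> 0" by (cases ?I) auto
  have intA: "integrable M (\<lambda>y. indicator A y * c)"
    using A by (intro integrable_mult_left) (auto simp: less_top[symmetric])
  have eq: "indicator A y * (f y - c) = indicator A y * f y - indicator A y * c" for y
    by (simp add: algebra_simps)
  have int': "integrable M (\<lambda>y. indicator A y * (f y - c))"
    unfolding eq using int intA by simp
  have mA: "measure M A = v" using A by (simp add: measure_def)
  define m where "m = (LINT y|M. \<bar>indicator A y * (f y - c)\<bar>)"
  have m0: "m \<ge> 0" by (simp add: m_def)
  have meas: "(\<lambda>y. indicator A y * (f y - c)) \<in> borel_measurable M" using int' by auto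
  have "(LINT y|M. indicator A y * (f y - c)) = (LINT y|M. indicator A y * f y) - v * c"
    unfolding eq using int intA mA A by (simp add: Bochner_Integration.integral_diff)
  then have "\<bar>(LINT y|M. indicator A y * f y) / v - c\<bar> = \<bar>LINT y|M. indicator A y * (f y - c)\<bar> / v"
    using A(3) by (simp add: field_simps abs_divide[symmetric] del: abs_divide) (simp add: divide_simps)
  also have "\<dots> \<le> m / v" unfolding m_def using A(3) by (intro divide_right_mono integral_abs_bound) auto
  finally have dm: "\<bar>(LINT y|M. indicator A y * f y) / v - c\<bar> \<le> m / v" .
  have key: "m \<le> L * v + L powr (1 - p) * J" if L: "L > 0" for L
  proof -
    have pt: "\<bar>t\<bar> \<le> L + L powr (1 - p) * \<bar>t\<bar> powr p" for t :: real
    proof (cases "\<bar>t\<bar> \<le> L")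
      case True then show ?thesis by (simp add: add_increasing2)
    next
      case False
      then have t: "0 < \<bar>t\<bar>" using L by linarith
      have "\<bar>t\<bar> = \<bar>t\<bar> powr (1 - p) * \<bar>t\<bar> powr p" using t by (simp flip: powr_add)
      also have "\<dots> \<le> L powr (1 - p) * \<bar>t\<bar> powr p"
        using False L p by (intro mult_right_mono powr_mono2') auto
      finally show ?thesis using L by linarith
    qed
    have "ennreal m = (\<integral>\<^sup>+ y. ennreal \<bar>indicator A y * (f y - c)\<bar> \<partial>M)"
      unfolding m_def using int' by (subst nn_integral_eq_integral) auto
    also have "\<dots> \<le> (\<integral>\<^sup>+ y. ennreal L * indicator A y + ennreal (L powr (1 - p)) * (indicator A y * ennreal (\<bar>f y - c\<bar> powr p)) \<partial>M)"
    proof (intro nn_integral_mono)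
      fix y
      show "ennreal \<bar>indicator A y * (f y - c)\<bar> \<le> ennreal L * indicator A y + ennreal (L powr (1 - p)) * (indicator A y * ennreal (\<bar>f y - c\<bar> powr p))"
        using pt[of "f y - c"] L by (auto split: split_indicator simp flip: ennreal_mult ennreal_plus intro!: ennreal_leI)
    qed
    also have "\<dots> = ennreal L * ennreal v + ennreal (L powr (1 - p)) * ennreal J"
    proof -
      have "(\<lambda>y. indicator A y * ennreal (\<bar>f y - c\<bar> powr p)) = (\<lambda>y. indicator A y * ennreal (\<bar>indicator A y * (f y - c)\<bar> powr p))"
        by (auto split: split_indicator)
      moreover have "(\<lambda>y. indicator A y * ennreal (\<bar>indicator A y * (f y - c)\<bar> powr p)) \<in> borel_measurable M"
        using meas A(1) by measurable
      ultimately have "(\<lambda>y. indicator A y * ennreal (\<bar>f y - c\<bar> powr p)) \<in> borel_measurable M" by simp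
      then show ?thesis using A by (simp add: nn_integral_add nn_integral_cmult J(1))
    qed
    also have "\<dots> = ennreal (L * v + L powr (1 - p) * J)"
      using L A(3) J(2) by (simp add: ennreal_mult ennreal_plus)
    finally show ?thesis using L A(3) J(2) by (subst (asm) ennreal_le_iff) (auto intro!: add_nonneg_nonneg)
  qed
  have "(m / v) powr p \<le> 2 powr p / v * J"
  proof (cases "J = 0")
    case True
    have "m \<le> e" if "e > 0" for e using key[of "e / v"] True that A(3) by simp
    then have "m = 0" using m0 by (metis dense_ge order_antisym)
    then show ?thesis using J(2) A(3) by simp
  next
    case False
    \<comment> \<open>At this \<open>L\<close> both terms of \<open>key\<close> equal
      \<open>L * v\<close>.\<close>
    define L where "L = (J / v) powr (1 / p)"
    have Jv: "J / v > 0" using False J(2) A(3) by simp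
    have L: "L > 0" using False A(3) by (simp add: L_def)
    have Lp: "L powr p = J / v" using p Jv J(2) A(3) by (simp add: L_def powr_powr)
    have "L powr (1 - p) * (J / v) = L"
      unfolding Lp[symmetric] using L by (simp flip: powr_add)
    then have "L powr (1 - p) * J = L * v" using A(3) by (simp add: field_simps)
    then have "m \<le> 2 * L * v" using key[OF L] by simp
    then have "m / v \<le> 2 * L" using A(3) by (simp add: field_simps)
    then have "(m / v) powr p \<le> (2 * L) powr p" using m0 A(3) p by (intro powr_mono2) auto
    also have "\<dots> = 2 powr p * (J / v)" using L by (simp add: powr_mult Lp)
    finally show ?thesis by simp
  qed
  moreover have "\<bar>(LINT y|M. indicator A y * f y) / v - c\<bar> powr p \<le> (m / v) powr p"
    using dm p by (intro powr_mono2) auto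
  ultimately have "ennreal (\<bar>(LINT y|M. indicator A y * f y) / v - c\<bar> powr p) \<le> ennreal (2 powr p / v * J)"
    by (intro ennreal_leI) simp
  also have "\<dots> = ennreal (2 powr p / v) * ?I"
    unfolding J(1) using J(2) A(3) by (intro ennreal_mult) auto
  finally show ?thesis .
qed

section \<open>Averages over cells and the energy inside a cell\<close>

definition avg :: "nat \<Rightarrow> (real ^ 'n \<Rightarrow> real) \<Rightarrow> real ^ 'n \<Rightarrow> real" where
  "avg j u x = (LINT y|lborel. indicator (cell j x) y * u y) / (1 / 2 ^ j) ^ CARD('n)"

lemma avg_cong: "y \<in> cell j x \<Longrightarrow> avg j u y = avg j u x"
  by (simp add: avg_def cell_cong)

lemma borel_measurable_avg [measurable]:
  fixes u :: "real ^ 'n \<Rightarrow> real"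
  assumes [measurable]: "u \<in> borel_measurable borel"
  shows "avg j u \<in> borel_measurable borel"
proof -
  have "(\<lambda>x. LINT y|lborel. indicator (cell j x) y * u y) \<in> borel_measurable borel"
    by (rule lborel.borel_measurable_lebesgue_integral) measurable
  then show ?thesis unfolding avg_def[abs_def] by measurable
qed

text \<open>From \<open>|t| \<le> 1 + |t| powr p\<close>. The second bound is independent of
  \<open>x\<close>; it later bounds all averages of a normalised sequence.\<close>

lemma integrable_on_cell:
  fixes u :: "real ^ 'n \<Rightarrow> real"
  assumes [measurable]: "u \<in> borel_measurable borel" and p: "p \<ge> 1"
    and fin: "power_integral p u < \<infinity>"
  shows "integrable lborel (\<lambda>y. indicator (cell j x) y * u y)"
    and "(\<integral>\<^sup>+ y. ennreal \<bar>indicator (cell j x) y * u y\<bar> \<partial>lborel) \<le>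
      ennreal ((1 / 2 ^ j) ^ CARD('n)) + power_integral p u"
proof -
  have "(\<integral>\<^sup>+ y. ennreal \<bar>indicator (cell j x) y * u y\<bar> \<partial>lborel) \<le> (\<integral>\<^sup>+ y. indicator (cell j x) y + ennreal (\<bar>u y\<bar> powr p) \<partial>lborel)"
  proof (intro nn_integral_mono)
    fix y
    have "\<bar>u y\<bar> \<le> 1 + \<bar>u y\<bar> powr p"
    proof (cases "\<bar>u y\<bar> \<le> 1")
      case False
      then have "\<bar>u y\<bar> powr 1 \<le> \<bar>u y\<bar> powr p" using p by (intro powr_mono) auto
      then show ?thesis by simp
    qed (simp add: add_increasing2)
    then have "ennreal \<bar>u y\<bar> \<le> 1 + ennreal (\<bar>u y\<bar> powr p)"
      by (metis ennreal_1 ennreal_leI ennreal_plus powr_ge_zero zero_le_one)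
    then show "ennreal \<bar>indicator (cell j x) y * u y\<bar> \<le> indicator (cell j x) y + ennreal (\<bar>u y\<bar> powr p)"
      by (auto split: split_indicator)
  qed
  also have "\<dots> = ennreal ((1 / 2 ^ j) ^ CARD('n)) + power_integral p u"
    by (subst nn_integral_add) (auto simp: emeasure_cell)
  finally show le: "(\<integral>\<^sup>+ y. ennreal \<bar>indicator (cell j x) y * u y\<bar> \<partial>lborel) \<le>
      ennreal ((1 / 2 ^ j) ^ CARD('n)) + power_integral p u" .
  also have "\<dots> < \<infinity>" using fin by simp
  finally show "integrable lborel (\<lambda>y. indicator (cell j x) y * u y)"
    by (intro integrableI_bounded) auto
qed

text \<open>Within a cell the distance is at most the diameter, so the kernel is bounded from
  below.\<close>

lemma powr_diff_le_density:
  fixes u :: "real ^ 'n \<Rightarrow> real"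
  assumes "y \<in> cell j x" "z \<in> cell j x" "0 < s" "1 < p"
  shows "\<bar>u y - u z\<bar> powr p \<le> (real CARD('n) / 2 ^ j) powr (real CARD('n) + s * p) * gagliardo_density s p u y z"
proof (cases "y = z")
  case False
  then have "0 < norm (y - z) powr (real CARD('n) + s * p)" by simp
  then have "\<bar>u y - u z\<bar> powr p = norm (y - z) powr (real CARD('n) + s * p) * gagliardo_density s p u y z"
    by (simp add: gagliardo_density_def)
  also have "\<dots> \<le> (real CARD('n) / 2 ^ j) powr (real CARD('n) + s * p) * gagliardo_density s p u y z"
    using assms by (intro mult_right_mono powr_mono2 cell_diam[of _ _ x]) auto
  finally show ?thesis .
qed (use assms in simp)

text \<open>Taken over the product space, so that a single exchange of integrals in
  \<open>nn_integral_cell_energy_le\<close> suffices to integrate out \<open>x\<close>.\<close>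

definition cell_energy :: "real \<Rightarrow> real \<Rightarrow> nat \<Rightarrow> (real ^ 'n \<Rightarrow> real) \<Rightarrow> real ^ 'n \<Rightarrow> ennreal" where
  "cell_energy s p j u x = (\<integral>\<^sup>+ z. indicator (cell j x) (fst z) * (indicator (cell j x) (snd z) *
     ennreal (gagliardo_density s p u (fst z) (snd z))) \<partial>(lborel \<Otimes>\<^sub>M lborel))"

lemma cell_energy_le:
  assumes "u \<in> borel_measurable borel"
  shows "cell_energy s p j u x \<le> gagliardo_energy s p u"
  unfolding cell_energy_def gagliardo_energy_pair[OF assms]
  by (intro nn_integral_mono) (auto split: split_indicator)

lemma borel_measurable_cell_energy [measurable]:
  fixes u :: "real ^ 'n \<Rightarrow> real"
  assumes [measurable]: "u \<in> borel_measurable borel"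
  shows "cell_energy s p j u \<in> borel_measurable borel"
  unfolding cell_energy_def[abs_def]
  by (rule lborel_pair.P.borel_measurable_nn_integral) measurable

text \<open>After the exchange of integrals and dropping the condition on the second point,
  \<open>x\<close> ranges over the cell of the first point and contributes exactly its
  volume.\<close>

lemma nn_integral_cell_energy_le:
  fixes u :: "real ^ 'n \<Rightarrow> real"
  assumes [measurable]: "u \<in> borel_measurable borel"
  shows "(\<integral>\<^sup>+ x. cell_energy s p j u x \<partial>lborel) \<le> ennreal ((1 / 2 ^ j) ^ CARD('n)) * gagliardo_energy s p u"
proof -
  interpret pair_sigma_finite lborel "lborel \<Otimes>\<^sub>M lborel :: ((real ^ 'n) \<times> (real ^ 'n)) measure" ..
  have "(\<integral>\<^sup>+ x. cell_energy s p j u x \<partial>lborel) =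
    (\<integral>\<^sup>+ z. \<integral>\<^sup>+ x. indicator (cell j x) (fst z) * (indicator (cell j x) (snd z) *
     ennreal (gagliardo_density s p u (fst z) (snd z))) \<partial>lborel \<partial>(lborel \<Otimes>\<^sub>M lborel))"
    unfolding cell_energy_def by (rule Fubini'[symmetric]) measurable
  also have "\<dots> \<le> (\<integral>\<^sup>+ z. \<integral>\<^sup>+ x. indicator (cell j (fst z)) x * ennreal (gagliardo_density s p u (fst z) (snd z)) \<partial>lborel \<partial>(lborel \<Otimes>\<^sub>M lborel))"
    by (intro nn_integral_mono) (auto split: split_indicator simp: mem_cell_commute)
  also have "\<dots> = ennreal ((1 / 2 ^ j) ^ CARD('n)) * gagliardo_energy s p u"
    unfolding gagliardo_energy_pair[OF assms]
    by (simp add: nn_integral_multc emeasure_cell nn_integral_cmult)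
  finally show ?thesis .
qed

text \<open>The mean deviation bound around the constant \<open>u y\<close> turns the deviation into
  an integral of the energy density.\<close>

lemma powr_diff_avg_le:
  fixes u :: "real ^ 'n \<Rightarrow> real"
  assumes [measurable]: "u \<in> borel_measurable borel" and s: "0 < s" and p: "1 < p"
    and fin: "power_integral p u < \<infinity>" and y: "y \<in> cell j x"
  shows "ennreal (\<bar>u y - avg j u x\<bar> powr p) \<le>
    ennreal (2 powr p / (1 / 2 ^ j) ^ CARD('n) * (real CARD('n) / 2 ^ j) powr (real CARD('n) + s * p)) *
      (\<integral>\<^sup>+ z. indicator (cell j x) z * ennreal (gagliardo_density s p u y z) \<partial>lborel)"
proof -
  define v where "v = (1 / 2 ^ j :: real) ^ CARD('n)"
  define D where "D = (real CARD('n) / 2 ^ j) powr (real CARD('n) + s * p)"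
  have v: "v > 0" and D: "D \<ge> 0" by (simp_all add: v_def D_def)
  have "ennreal (\<bar>u y - avg j u x\<bar> powr p) = ennreal (\<bar>(LINT y|lborel. indicator (cell j x) y * u y) / v - u y\<bar> powr p)"
    by (simp add: avg_def v_def abs_minus_commute)
  also have "\<dots> \<le> ennreal (2 powr p / v) * (\<integral>\<^sup>+ z. indicator (cell j x) z * ennreal (\<bar>u z - u y\<bar> powr p) \<partial>lborel)"
    by (rule powr_mean_deviation_le)
      (use v p integrable_on_cell[OF assms(1) _ fin] in \<open>auto simp: emeasure_cell v_def\<close>)
  also have "\<dots> \<le> ennreal (2 powr p / v) * (\<integral>\<^sup>+ z. ennreal D * (indicator (cell j x) z * ennreal (gagliardo_density s p u y z)) \<partial>lborel)"
  proof (intro mult_left_mono nn_integral_mono)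
    fix z
    show "indicator (cell j x) z * ennreal (\<bar>u z - u y\<bar> powr p) \<le> ennreal D * (indicator (cell j x) z * ennreal (gagliardo_density s p u y z))"
      using powr_diff_le_density[OF y _ s p, of z u] D
      by (auto split: split_indicator simp: D_def abs_minus_commute simp flip: ennreal_mult intro!: ennreal_leI)
  qed auto
  also have "\<dots> = ennreal (2 powr p / v) * (ennreal D * (\<integral>\<^sup>+ z. indicator (cell j x) z * ennreal (gagliardo_density s p u y z) \<partial>lborel))"
    by (subst nn_integral_cmult) auto
  also have "\<dots> = ennreal (2 powr p / v * D) * (\<integral>\<^sup>+ z. indicator (cell j x) z * ennreal (gagliardo_density s p u y z) \<partial>lborel)"
  proof -
    have "0 \<le> 2 powr p / v" using v by simp
    then show ?thesis using D by (simp only: ennreal_mult mult.assoc)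
  qed
  finally show ?thesis by (simp add: v_def D_def)
qed

lemma dyadic_powr: "(1 / 2 ^ j :: real) ^ n = 2 powr (- real n * real j)"
  by (simp add: powr_minus_divide powr_realpow power_mult mult.commute flip: powr_realpow' power_one_over)
   (simp add: powr_realpow power_mult field_simps flip: of_nat_mult)

text \<open>Dividing \<open>(2 powr (- j)) powr (d + s * p)\<close> by the cell volume leaves the
  rate \<open>2 powr (- (s * p) * j)\<close>. This estimate at exponent \<open>p\<close> serves to
  identify \<open>u\<close> as the limit of its averages.\<close>

lemma nn_integral_diff_avg_le:
  fixes u :: "real ^ 'n \<Rightarrow> real"
  assumes [measurable]: "u \<in> borel_measurable borel" and s: "0 < s" and p: "1 < p"
    and fin: "power_integral p u < \<infinity>"
  shows "(\<integral>\<^sup>+ x. ennreal (\<bar>u x - avg j u x\<bar> powr p) \<partial>lborel) \<le>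
    ennreal (2 powr p * real CARD('n) powr (real CARD('n) + s * p) * 2 powr (- (s * p) * real j)) * gagliardo_energy s p u"
proof -
  define d where "d = real CARD('n)"
  define c where "c = 2 powr p * d powr (d + s * p) * 2 powr (- (s * p) * real j)"
  have c: "2 powr p / (1 / 2 ^ j) ^ CARD('n) * (real CARD('n) / 2 ^ j) powr (real CARD('n) + s * p) = c"
  proof -
    have 1: "(1 / 2 ^ j :: real) ^ CARD('n) = 2 powr (- d * real j)" by (simp add: dyadic_powr d_def)
    have 2: "d / 2 ^ j = d * 2 powr (- real j)" by (simp add: powr_minus_divide powr_realpow)
    show ?thesis
      unfolding 1 d_def[symmetric] 2 powr_mult powr_powr c_def
      by (simp add: powr_diff powr_add powr_minus field_simps)
  qed
  have "(\<integral>\<^sup>+ x. ennreal (\<bar>u x - avg j u x\<bar> powr p) \<partial>lborel) \<le>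
     (\<integral>\<^sup>+ x. ennreal c * (\<integral>\<^sup>+ z. ennreal (gagliardo_density s p u x z) \<partial>lborel) \<partial>lborel)"
  proof (intro nn_integral_mono)
    fix x
    have "ennreal (\<bar>u x - avg j u x\<bar> powr p) \<le> ennreal c * (\<integral>\<^sup>+ z. indicator (cell j x) z * ennreal (gagliardo_density s p u x z) \<partial>lborel)"
      using powr_diff_avg_le[OF assms(1) s p fin mem_cell_self, of x j] unfolding c .
    also have "\<dots> \<le> ennreal c * (\<integral>\<^sup>+ z. ennreal (gagliardo_density s p u x z) \<partial>lborel)"
      by (intro mult_left_mono nn_integral_mono) (auto split: split_indicator)
    finally show "ennreal (\<bar>u x - avg j u x\<bar> powr p) \<le> ennreal c * (\<integral>\<^sup>+ z. ennreal (gagliardo_density s p u x z) \<partial>lborel)" .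
  qed
  also have "\<dots> = ennreal c * gagliardo_energy s p u"
    unfolding gagliardo_energy_density
    by (rule nn_integral_cmult) (rule lborel.borel_measurable_nn_integral, measurable)
  finally show ?thesis by (simp add: c_def d_def)
qed

text \<open>The mean deviation bound is used twice: on the small cell around the constant
  \<open>avg j u x\<close>, then on the large cell around each \<open>u y\<close>. This gives
  \<open>4 powr p\<close>. The two volumes against the kernel bound give
  \<open>2 powr ((d - s * p) * j)\<close>, with an extra \<open>2 powr d\<close> because the first
  cell is one level finer.\<close>

lemma avg_increment_powr_le:
  fixes u :: "real ^ 'n \<Rightarrow> real"
  assumes [measurable]: "u \<in> borel_measurable borel" and s: "0 < s" and p: "1 < p"
    and fin: "power_integral p u < \<infinity>"
  defines "d \<equiv> real CARD('n)"
  shows "ennreal (\<bar>avg (Suc j) u x - avg j u x\<bar> powr p) \<le>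
    ennreal (4 powr p * 2 powr d * d powr (d + s * p) * 2 powr ((d - s * p) * real j)) * cell_energy s p j u x"
proof -
  define v where "v j = (1 / 2 ^ j :: real) ^ CARD('n)" for j
  have v: "v j > 0" for j by (simp add: v_def)
  define D where "D = (real CARD('n) / 2 ^ j) powr (real CARD('n) + s * p)"
  have D: "D \<ge> 0" by (simp_all add: D_def)
  have c: "2 powr p / v (Suc j) * (2 powr p / v j * D) = 4 powr p * 2 powr d * d powr (d + s * p) * 2 powr ((d - s * p) * real j)"
  proof -
    have 1: "v i = 2 powr (- d * real i)" for i by (simp add: dyadic_powr d_def v_def)
    have 2: "d / 2 ^ j = d * 2 powr (- real j)" by (simp add: powr_minus_divide powr_realpow)
    have 4: "(4 :: real) powr p = 2 powr p * 2 powr p" by (simp flip: powr_mult)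
    show ?thesis
      unfolding 1 D_def d_def[symmetric] 2 powr_mult powr_powr 4
      by (simp add: powr_diff powr_add powr_minus field_simps)
  qed
  have "ennreal (\<bar>avg (Suc j) u x - avg j u x\<bar> powr p) \<le>
      ennreal (2 powr p / v (Suc j)) * (\<integral>\<^sup>+ y. indicator (cell (Suc j) x) y * ennreal (\<bar>u y - avg j u x\<bar> powr p) \<partial>lborel)"
    unfolding avg_def[of "Suc j"] v_def[symmetric]
    by (rule powr_mean_deviation_le)
      (use v p integrable_on_cell[OF assms(1) _ fin] in \<open>auto simp: emeasure_cell v_def\<close>)
  also have "\<dots> \<le> ennreal (2 powr p / v (Suc j)) * (\<integral>\<^sup>+ y. ennreal (2 powr p / v j * D) * (indicator (cell j x) y *
        (\<integral>\<^sup>+ z. indicator (cell j x) z * ennreal (gagliardo_density s p u y z) \<partial>lborel)) \<partial>lborel)"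
  proof (intro mult_left_mono nn_integral_mono)
    fix y
    show "indicator (cell (Suc j) x) y * ennreal (\<bar>u y - avg j u x\<bar> powr p) \<le> ennreal (2 powr p / v j * D) * (indicator (cell j x) y *
        (\<integral>\<^sup>+ z. indicator (cell j x) z * ennreal (gagliardo_density s p u y z) \<partial>lborel))"
    proof (cases "y \<in> cell (Suc j) x")
      case True
      then have "y \<in> cell j x" using cell_Suc_subset by blast
      then show ?thesis using True powr_diff_avg_le[OF assms(1) s p fin, of y j x] by (simp add: v_def D_def)
    qed simp
  qed auto
  also have "\<dots> = ennreal (2 powr p / v (Suc j)) * (ennreal (2 powr p / v j * D) * (\<integral>\<^sup>+ y. indicator (cell j x) y *
        (\<integral>\<^sup>+ z. indicator (cell j x) z * ennreal (gagliardo_density s p u y z) \<partial>lborel) \<partial>lborel))"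
    by (subst nn_integral_cmult) (auto intro!: borel_measurable_times_ennreal lborel.borel_measurable_nn_integral)
  also have "(\<integral>\<^sup>+ y. indicator (cell j x) y *
        (\<integral>\<^sup>+ z. indicator (cell j x) z * ennreal (gagliardo_density s p u y z) \<partial>lborel) \<partial>lborel) = cell_energy s p j u x"
  proof -
    have "cell_energy s p j u x = (\<integral>\<^sup>+ y. \<integral>\<^sup>+ z. indicator (cell j x) y *
        (indicator (cell j x) z * ennreal (gagliardo_density s p u y z)) \<partial>lborel \<partial>lborel)"
      unfolding cell_energy_def by (subst lborel.nn_integral_fst[symmetric]) auto
    also have "\<dots> = (\<integral>\<^sup>+ y. indicator (cell j x) y *
        (\<integral>\<^sup>+ z. indicator (cell j x) z * ennreal (gagliardo_density s p u y z) \<partial>lborel) \<partial>lborel)"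
      by (intro nn_integral_cong nn_integral_cmult) auto
    finally show ?thesis ..
  qed
  also have "ennreal (2 powr p / v (Suc j)) * (ennreal (2 powr p / v j * D) * cell_energy s p j u x) =
      ennreal (2 powr p / v (Suc j) * (2 powr p / v j * D)) * cell_energy s p j u x"
  proof -
    have "0 \<le> 2 powr p / v (Suc j)" "0 \<le> 2 powr p / v j * D" using v D by (auto simp: less_imp_le)
    then show ?thesis by (simp only: ennreal_mult mult.assoc)
  qed
  finally show ?thesis unfolding c .
qed

text \<open>
  The exponent \<open>r (s + d / r - d / p)\<close> is positive exactly when \<open>r\<close> is below the critical Sobolev
  exponent. The bound \<open>r > p\<close> costs nothing because the energy of a cell is at most the full energy.
\<close>

lemma nn_integral_avg_increment_le:
  fixes u :: "real ^ 'n \<Rightarrow> real"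
  assumes [measurable]: "u \<in> borel_measurable borel" and s: "0 < s" and p: "1 < p" and r: "p \<le> r"
    and fin: "power_integral p u < \<infinity>"
    and E: "gagliardo_energy s p u \<le> ennreal M" and M: "M > 0"
  defines "d \<equiv> real CARD('n)"
  shows "(\<integral>\<^sup>+ x. ennreal (\<bar>avg (Suc j) u x - avg j u x\<bar> powr r) \<partial>lborel) \<le>
    ennreal ((4 powr p * 2 powr d * d powr (d + s * p) * M) powr (r / p) * (2 powr (- (r * (s + d / r - d / p)))) ^ j)"
proof -
  define C where "C = 4 powr p * 2 powr d * d powr (d + s * p)"
  define K where "K = C * 2 powr ((d - s * p) * real j)"
  have C: "C > 0" by (simp add: C_def d_def)
  then have K: "K > 0" by (simp add: K_def)
  define A where "A = K powr (r / p) * M powr (r / p - 1)"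
  have A: "A \<ge> 0" by (simp add: A_def)
  have le: "ennreal (\<bar>avg (Suc j) u x - avg j u x\<bar> powr r) \<le> ennreal A * cell_energy s p j u x" for x
  proof -
    have "cell_energy s p j u x \<le> ennreal M" using cell_energy_le[OF assms(1)] E by (rule order_trans)
    then obtain g where g: "cell_energy s p j u x = ennreal g" "0 \<le> g" "g \<le> M"
      using M by (cases "cell_energy s p j u x") (auto simp: top_unique)
    have "ennreal (\<bar>avg (Suc j) u x - avg j u x\<bar> powr p) \<le> ennreal K * ennreal g"
      using avg_increment_powr_le[OF assms(1) s p fin, of j x] unfolding g(1)
      by (simp add: K_def C_def d_def)
    then have "\<bar>avg (Suc j) u x - avg j u x\<bar> powr p \<le> K * g"
      using K g by (simp flip: ennreal_mult)
    then have "(\<bar>avg (Suc j) u x - avg j u x\<bar> powr p) powr (r / p) \<le> (K * g) powr (r / p)"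
      using p r by (intro powr_mono2) auto
    then have "\<bar>avg (Suc j) u x - avg j u x\<bar> powr r \<le> K powr (r / p) * g powr (r / p)"
      using p r K g by (simp add: powr_powr powr_mult)
    also have "g powr (r / p) \<le> M powr (r / p - 1) * g"
    proof (cases "g = 0")
      case False
      then have "g powr (r / p) = g powr (r / p - 1) * g" using g by (simp add: powr_diff)
      also have "\<dots> \<le> M powr (r / p - 1) * g" using g p r by (intro mult_right_mono powr_mono2) auto
      finally show ?thesis .
    qed simp
    finally have "\<bar>avg (Suc j) u x - avg j u x\<bar> powr r \<le> A * g"
      by (simp add: A_def mult_left_mono mult.assoc)
    then show ?thesis unfolding g(1) using A g by (simp add: ennreal_leI flip: ennreal_mult)
  qed
  have "(\<integral>\<^sup>+ x. ennreal (\<bar>avg (Suc j) u x - avg j u x\<bar> powr r) \<partial>lborel) \<le> (\<integral>\<^sup>+ x. ennreal A * cell_energy s p j u x \<partial>lborel)"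
    by (intro nn_integral_mono le)
  also have "\<dots> = ennreal A * (\<integral>\<^sup>+ x. cell_energy s p j u x \<partial>lborel)"
    by (rule nn_integral_cmult) simp
  also have "\<dots> \<le> ennreal A * (ennreal ((1 / 2 ^ j) ^ CARD('n)) * ennreal M)"
    by (intro mult_left_mono order_trans[OF nn_integral_cell_energy_le[OF assms(1)]] E) auto
  also have "\<dots> = ennreal (A * ((1 / 2 ^ j) ^ CARD('n) * M))"
    using A M by (simp add: ennreal_mult)
  also have "A * ((1 / 2 ^ j) ^ CARD('n) * M) = (C * M) powr (r / p) * (2 powr (- (r * (s + d / r - d / p)))) ^ j"
  proof -
    have 1: "(1 / 2 ^ j :: real) ^ CARD('n) = 2 powr (- d * real j)" by (simp add: dyadic_powr d_def)
    have 2: "(2 powr (- (r * (s + d / r - d / p)))) ^ j = (2 :: real) powr (- (r * (s + d / r - d / p)) * real j)"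
      by (simp add: powr_powr flip: powr_realpow)
    have e: "- (r * (s + d / r - d / p)) * real j = (d - s * p) * real j * (r / p) + (- d * real j)"
      using p r by (simp add: field_simps)
    have "A * M = K powr (r / p) * M powr (r / p)"
      using M by (simp add: A_def powr_diff)
    also have "\<dots> = C powr (r / p) * M powr (r / p) * 2 powr ((d - s * p) * real j * (r / p))"
      using C by (simp add: K_def powr_mult powr_powr)
    finally have AM: "A * M = (C * M) powr (r / p) * 2 powr ((d - s * p) * real j * (r / p))"
      using C M by (simp add: powr_mult)
    show ?thesis unfolding 2 e powr_add 1 using AM by (simp add: mult_ac)
  qed
  finally show ?thesis by (simp add: C_def)
qed

section \<open>Compactness\<close>

text \<open>
  With \<open>\<eta>\<^sup>r = sqrt \<theta>\<close> the function \<open>S = \<Sum>i. \<bar>f (i + 1) - f i\<bar>\<^sup>r / \<eta>\<^bsup>ir\<^esup>\<close> is integrable, and wherever it is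
  finite it bounds all increments: \<open>\<bar>f (i + 1) - f i\<bar> \<le> \<eta>\<^sup>i S\<^bsup>1/r\<^esup>\<close>.
\<close>

lemma geometric_increments_AE_limit:
  fixes f :: "nat \<Rightarrow> 'a \<Rightarrow> real"
  assumes f [measurable]: "\<And>j. f j \<in> borel_measurable M" and r: "r \<ge> 1" and C: "C \<ge> 0"
    and \<theta>: "0 < \<theta>" "\<theta> < 1"
    and le: "\<And>j. (\<integral>\<^sup>+ x. ennreal (\<bar>f (Suc j) x - f j x\<bar> powr r) \<partial>M) \<le> ennreal (C * \<theta> ^ j)"
  obtains g where "g \<in> borel_measurable M" "AE x in M. (\<lambda>j. f j x) \<longlonglongrightarrow> g x"
    "\<And>j. (\<integral>\<^sup>+ x. ennreal (\<bar>g x - f j x\<bar> powr r) \<partial>M) \<le>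
       ennreal ((1 / (1 - \<theta> powr (1 / (2 * r)))) powr r * C / (1 - sqrt \<theta>) * sqrt \<theta> ^ j)"
proof -
  define \<eta> where "\<eta> = \<theta> powr (1 / (2 * r))"
  have \<eta>: "0 < \<eta>" "\<eta> < 1" using \<theta> r powr_less_mono2[of "1 / (2 * r)" \<theta> 1] by (auto simp: \<eta>_def)
  have \<eta>r: "\<eta> powr r = sqrt \<theta>" using \<theta> r by (simp add: \<eta>_def powr_powr powr_half_sqrt)
  have sq: "0 < sqrt \<theta>" "sqrt \<theta> < 1" using \<theta> by auto
  have \<eta>j: "(\<eta> ^ j) powr r = sqrt \<theta> ^ j" for j
  proof -
    have "(\<eta> ^ j) powr r = (\<eta> powr r) powr real j"
      using \<eta> by (simp add: powr_powr mult.commute flip: powr_realpow)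
    then show ?thesis using \<eta>r sq by (simp add: powr_realpow)
  qed
  define a where "a i x = \<bar>f (Suc i) x - f i x\<bar>" for i x
  have [measurable]: "a i \<in> borel_measurable M" for i unfolding a_def[abs_def] by measurable
  define S where "S x = (\<Sum>i. ennreal (a i x powr r / sqrt \<theta> ^ i))" for x
  have [measurable]: "S \<in> borel_measurable M" unfolding S_def[abs_def] by measurable
  have S_le: "(\<integral>\<^sup>+ x. S x \<partial>M) \<le> ennreal (C / (1 - sqrt \<theta>))"
  proof -
    have "(\<integral>\<^sup>+ x. S x \<partial>M) = (\<Sum>i. \<integral>\<^sup>+ x. ennreal (a i x powr r / sqrt \<theta> ^ i) \<partial>M)"
      unfolding S_def by (rule nn_integral_suminf) measurable
    also have "\<dots> \<le> (\<Sum>i. ennreal (C * sqrt \<theta> ^ i))"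
    proof (intro suminf_le allI summableI)
      fix i
      have "(\<integral>\<^sup>+ x. ennreal (a i x powr r / sqrt \<theta> ^ i) \<partial>M) = (\<integral>\<^sup>+ x. ennreal (1 / sqrt \<theta> ^ i) * ennreal (a i x powr r) \<partial>M)"
        using sq by (intro nn_integral_cong) (simp flip: ennreal_mult)
      also have "\<dots> = ennreal (1 / sqrt \<theta> ^ i) * (\<integral>\<^sup>+ x. ennreal (a i x powr r) \<partial>M)"
        by (rule nn_integral_cmult) measurable
      also have "\<dots> \<le> ennreal (1 / sqrt \<theta> ^ i) * ennreal (C * \<theta> ^ i)"
        unfolding a_def by (intro mult_left_mono le) auto
      also have "\<dots> = ennreal (C * sqrt \<theta> ^ i)"
      proof -
        have "\<theta> ^ i = sqrt \<theta> ^ i * sqrt \<theta> ^ i" using \<theta> by (simp flip: power_mult_distrib)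
        then show ?thesis using sq C \<theta> by (simp flip: ennreal_mult)
      qed
      finally show "(\<integral>\<^sup>+ x. ennreal (a i x powr r / sqrt \<theta> ^ i) \<partial>M) \<le> ennreal (C * sqrt \<theta> ^ i)" .
    qed
    also have "\<dots> = ennreal (\<Sum>i. C * sqrt \<theta> ^ i)"
      using sq C by (intro suminf_ennreal2 summable_mult summable_geometric) auto
    also have "(\<Sum>i. C * sqrt \<theta> ^ i) = C / (1 - sqrt \<theta>)"
      using sq by (subst suminf_mult) (auto simp: suminf_geometric)
    finally show ?thesis .
  qed
  then have "(\<integral>\<^sup>+ x. S x \<partial>M) \<noteq> \<infinity>" by (auto simp: top_unique)
  then have S_fin: "AE x in M. S x \<noteq> \<infinity>" by (intro nn_integral_PInf_AE) auto
  \<comment> \<open>Where the sequence diverges \<open>lim\<close> is unspecified; this happens at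
    most on the null set where \<open>S\<close> is infinite, while \<open>g\<close> is measurable in
    any case.\<close>
  define g where "g x = lim (\<lambda>j. f j x)" for x
  have g [measurable]: "g \<in> borel_measurable M" unfolding g_def[abs_def] by measurable
  have pt: "(\<lambda>j. f j x) \<longlonglongrightarrow> g x \<and> (\<forall>j. \<bar>g x - f j x\<bar> powr r \<le> (1 / (1 - \<eta>)) powr r * sqrt \<theta> ^ j * enn2real (S x))"
    if fin: "S x \<noteq> \<infinity>" for x
  proof -
    define \<sigma> where "\<sigma> = enn2real (S x)"
    have \<sigma>: "\<sigma> \<ge> 0" "S x = ennreal \<sigma>" using fin by (auto simp: \<sigma>_def less_top)
    have ai: "a i x \<le> \<eta> ^ i * \<sigma> powr (1 / r)" for i
    proof -
      have "ennreal (a i x powr r / sqrt \<theta> ^ i) \<le> ennreal \<sigma>"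
        using sum_le_suminf[of "\<lambda>i. ennreal (a i x powr r / sqrt \<theta> ^ i)" "{i}"] \<sigma>(2) by (simp add: S_def)
      then have "a i x powr r \<le> (\<eta> ^ i) powr r * \<sigma>"
        using \<sigma> sq by (simp add: field_simps \<eta>j)
      then have "(a i x powr r) powr (1 / r) \<le> ((\<eta> ^ i) powr r * \<sigma>) powr (1 / r)"
        using r by (intro powr_mono2) auto
      then show ?thesis using r \<eta> \<sigma> by (simp add: powr_mult powr_powr a_def)
    qed
    have dist_le: "\<bar>f (j + k) x - f j x\<bar> \<le> \<eta> ^ j * (1 / (1 - \<eta>)) * \<sigma> powr (1 / r)" for j k
    proof -
      have "f (j + k) x - f j x = (\<Sum>i<k. f (Suc (j + i)) x - f (j + i) x)"
        by (induction k) auto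
      also have "\<bar>\<dots>\<bar> \<le> (\<Sum>i<k. a (j + i) x)" unfolding a_def by (rule sum_abs)
      also have "\<dots> \<le> (\<Sum>i<k. \<eta> ^ (j + i) * \<sigma> powr (1 / r))" by (intro sum_mono ai)
      also have "\<dots> = \<eta> ^ j * (\<Sum>i<k. \<eta> ^ i) * \<sigma> powr (1 / r)"
        by (simp add: power_add sum_distrib_left sum_distrib_right mult_ac)
      also have "\<dots> \<le> \<eta> ^ j * (1 / (1 - \<eta>)) * \<sigma> powr (1 / r)"
      proof -
        have "(\<Sum>i<k. \<eta> ^ i) \<le> (\<Sum>i. \<eta> ^ i)"
          using \<eta> by (intro sum_le_suminf summable_geometric) auto
        then have "(\<Sum>i<k. \<eta> ^ i) \<le> 1 / (1 - \<eta>)" using \<eta> by (simp add: suminf_geometric)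
        then show ?thesis using \<eta> by (intro mult_right_mono mult_left_mono) auto
      qed
      finally show ?thesis .
    qed
    have "Cauchy (\<lambda>j. f j x)"
    proof -
      have "(\<lambda>j. \<eta> ^ j * (1 / (1 - \<eta>)) * \<sigma> powr (1 / r)) \<longlonglongrightarrow> 0 * (1 / (1 - \<eta>)) * \<sigma> powr (1 / r)"
        using \<eta> by (intro tendsto_intros LIMSEQ_power_zero) auto
      then have lim0: "(\<lambda>j. \<eta> ^ j * (1 / (1 - \<eta>)) * \<sigma> powr (1 / r)) \<longlonglongrightarrow> 0" by simp
      show ?thesis unfolding Cauchy_altdef2
      proof (intro allI impI)
        fix e :: real assume "e > 0"
        from order_tendstoD(2)[OF lim0 this] obtain N where N: "\<eta> ^ N * (1 / (1 - \<eta>)) * \<sigma> powr (1 / r) < e"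
          by (auto simp: eventually_sequentially)
        have "dist (f n x) (f N x) < e" if "n \<ge> N" for n
          using dist_le[of N "n - N"] that N by (simp add: dist_real_def)
        then show "\<exists>N. \<forall>n\<ge>N. dist (f n x) (f N x) < e" by blast
      qed
    qed
    then have lim: "(\<lambda>j. f j x) \<longlonglongrightarrow> g x"
      unfolding g_def by (simp add: Cauchy_convergent_iff convergent_LIMSEQ_iff)
    have "\<bar>g x - f j x\<bar> powr r \<le> (1 / (1 - \<eta>)) powr r * sqrt \<theta> ^ j * \<sigma>" for j
    proof -
      have "(\<lambda>k. \<bar>f (j + k) x - f j x\<bar>) \<longlonglongrightarrow> \<bar>g x - f j x\<bar>"
        using LIMSEQ_ignore_initial_segment[OF lim, of j] by (intro tendsto_intros) (simp add: add.commute)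
      then have "\<bar>g x - f j x\<bar> \<le> \<eta> ^ j * (1 / (1 - \<eta>)) * \<sigma> powr (1 / r)"
        by (rule LIMSEQ_le_const2) (use dist_le in blast)
      then have "\<bar>g x - f j x\<bar> powr r \<le> (\<eta> ^ j * (1 / (1 - \<eta>)) * \<sigma> powr (1 / r)) powr r"
        using r by (intro powr_mono2) auto
      also have "\<dots> = (1 / (1 - \<eta>)) powr r * sqrt \<theta> ^ j * \<sigma>"
        unfolding powr_mult \<eta>j powr_powr using r \<sigma> by (simp add: mult_ac)
      finally show ?thesis .
    qed
    with lim show ?thesis by (simp add: \<sigma>_def)
  qed
  show thesis
  proof
    show "g \<in> borel_measurable M" by (rule g)
    show "AE x in M. (\<lambda>j. f j x) \<longlonglongrightarrow> g x" using S_fin by eventually_elim (use pt in blast)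
    show "(\<integral>\<^sup>+ x. ennreal (\<bar>g x - f j x\<bar> powr r) \<partial>M) \<le>
       ennreal ((1 / (1 - \<theta> powr (1 / (2 * r)))) powr r * C / (1 - sqrt \<theta>) * sqrt \<theta> ^ j)" for j
    proof -
      define c where "c = (1 / (1 - \<eta>)) powr r * sqrt \<theta> ^ j"
      have c: "c \<ge> 0" using sq by (simp add: c_def)
      have "AE x in M. ennreal (\<bar>g x - f j x\<bar> powr r) \<le> ennreal c * S x"
        using S_fin
      proof eventually_elim
        case (elim x)
        then have "ennreal (\<bar>g x - f j x\<bar> powr r) \<le> ennreal (c * enn2real (S x))"
          using pt[OF elim] by (intro ennreal_leI) (simp add: c_def)
        also have "\<dots> = ennreal c * S x" using c elim by (simp add: ennreal_mult less_top)
        finally show ?case .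
      qed
      then have "(\<integral>\<^sup>+ x. ennreal (\<bar>g x - f j x\<bar> powr r) \<partial>M) \<le> (\<integral>\<^sup>+ x. ennreal c * S x \<partial>M)"
        by (rule nn_integral_mono_AE)
      also have "\<dots> = ennreal c * (\<integral>\<^sup>+ x. S x \<partial>M)" by (rule nn_integral_cmult) measurable
      also have "\<dots> \<le> ennreal c * ennreal (C / (1 - sqrt \<theta>))" by (intro mult_left_mono S_le) auto
      also have "\<dots> = ennreal (c * (C / (1 - sqrt \<theta>)))" using c C sq by (intro ennreal_mult[symmetric]) auto
      finally show ?thesis by (simp add: c_def \<eta>_def mult_ac)
    qed
  qed
qed

section \<open>Diagonal subsequences and quasi-triangle inequalities\<close>

lemma bounded_diagonal_subsequence:
  fixes f :: "nat \<Rightarrow> 'a \<Rightarrow> real"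
  assumes "countable A" and bdd: "\<And>x n. x \<in> A \<Longrightarrow> \<bar>f n x\<bar> \<le> B x"
  obtains \<rho> :: "nat \<Rightarrow> nat" where "strict_mono \<rho>" "\<And>x. x \<in> A \<Longrightarrow> convergent (\<lambda>n. f (\<rho> n) x)"
proof (cases "A = {}")
  case True
  then show ?thesis using that[of id] by (auto simp: strict_mono_def)
next
  case False
  define e where "e = from_nat_into A"
  have eA: "e k \<in> A" for k using False by (simp add: e_def from_nat_into)
  interpret subseqs "\<lambda>k \<rho>. convergent (\<lambda>n. f (\<rho> n) (e k))"
  proof
    fix k and \<rho> :: "nat \<Rightarrow> nat" assume "strict_mono \<rho>"
    have "bounded (range (\<lambda>n. f (\<rho> n) (e k)))"
      using bdd[OF eA] by (intro boundedI[of _ "B (e k)"]) auto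
    then obtain l t where "strict_mono t" "(\<lambda>n. f (\<rho> (t n)) (e k)) \<longlonglongrightarrow> l"
      using bounded_imp_convergent_subsequence[of "\<lambda>n. f (\<rho> n) (e k)"] unfolding o_def by blast
    then show "\<exists>r'. strict_mono r' \<and> convergent (\<lambda>n. f ((\<rho> \<circ> r') n) (e k))"
      by (auto simp: convergent_def)
  qed
  have "convergent (\<lambda>n. f (diagseq n) (e k))" for k
  proof -
    \<comment> \<open>The diagonal sequence is a subsequence of the one chosen for
      \<open>e k\<close> only after its first \<open>Suc k\<close> terms are dropped.\<close>
    have "convergent (\<lambda>n. f ((diagseq \<circ> (+) (Suc k)) n) (e k))"
    proof (rule diagseq_holds)
      fix n and r s :: "nat \<Rightarrow> nat"
      assume "strict_mono r" "convergent (\<lambda>i. f (s i) (e n))"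
      then show "convergent (\<lambda>i. f ((s \<circ> r) i) (e n))"
        using LIMSEQ_subseq_LIMSEQ[of "\<lambda>i. f (s i) (e n)" _ r] by (auto simp: convergent_def o_def)
    qed
    then have "convergent (\<lambda>n. f (diagseq (n + Suc k)) (e k))" by (simp add: add.commute)
    then show ?thesis using convergent_ignore_initial_segment[of "\<lambda>n. f (diagseq n) (e k)" "Suc k"] by simp
  qed
  moreover have "\<exists>k. x = e k" if "x \<in> A" for x
    using that assms(1) from_nat_into_surj by (metis e_def)
  ultimately show ?thesis using that[OF subseq_diagseq] by metis
qed

lemma powr_add_le:
  fixes a b :: real
  assumes "q \<ge> 0"
  shows "\<bar>a + b\<bar> powr q \<le> 2 powr q * (\<bar>a\<bar> powr q + \<bar>b\<bar> powr q)"
proof -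
  have "\<bar>a + b\<bar> powr q \<le> (2 * max \<bar>a\<bar> \<bar>b\<bar>) powr q" using assms by (intro powr_mono2) auto
  also have "\<dots> = 2 powr q * max \<bar>a\<bar> \<bar>b\<bar> powr q" by (simp add: powr_mult)
  also have "\<dots> \<le> 2 powr q * (\<bar>a\<bar> powr q + \<bar>b\<bar> powr q)"
    by (intro mult_left_mono) (auto simp: max_def)
  finally show ?thesis .
qed

lemma nn_integral_powr_add_le:
  assumes [measurable]: "f \<in> borel_measurable M" "g \<in> borel_measurable M" and q: "q \<ge> 0"
  shows "(\<integral>\<^sup>+ x. ennreal (\<bar>f x + g x\<bar> powr q) \<partial>M) \<le>
    ennreal (2 powr q) * ((\<integral>\<^sup>+ x. ennreal (\<bar>f x\<bar> powr q) \<partial>M) + (\<integral>\<^sup>+ x. ennreal (\<bar>g x\<bar> powr q) \<partial>M))"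
proof -
  have "(\<integral>\<^sup>+ x. ennreal (\<bar>f x + g x\<bar> powr q) \<partial>M) \<le>
      (\<integral>\<^sup>+ x. ennreal (2 powr q) * (ennreal (\<bar>f x\<bar> powr q) + ennreal (\<bar>g x\<bar> powr q)) \<partial>M)"
    by (intro nn_integral_mono) (use powr_add_le[OF q] in \<open>simp flip: ennreal_mult ennreal_plus\<close>)
  also have "\<dots> = ennreal (2 powr q) * ((\<integral>\<^sup>+ x. ennreal (\<bar>f x\<bar> powr q) \<partial>M) + (\<integral>\<^sup>+ x. ennreal (\<bar>g x\<bar> powr q) \<partial>M))"
    by (simp add: nn_integral_cmult nn_integral_add)
  finally show ?thesis .
qed

lemma powr_zero_if_tendsto:
  fixes a :: "nat \<Rightarrow> real"
  assumes "(\<lambda>n. \<bar>a n\<bar> powr p) \<longlonglongrightarrow> 0" "p > 0"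
  shows "a \<longlonglongrightarrow> 0"
proof -
  have "(\<lambda>n. (\<bar>a n\<bar> powr p) powr (1 / p)) \<longlonglongrightarrow> 0 powr (1 / p)"
    using assms by (intro tendsto_powr' tendsto_const) auto
  then have "(\<lambda>n. \<bar>a n\<bar>) \<longlonglongrightarrow> 0" using assms(2) by (simp add: powr_powr)
  then show ?thesis by (simp add: tendsto_rabs_zero_iff)
qed

text \<open>The averages have geometrically small increments at exponent \<open>r\<close>, hence
  converge to some \<open>g\<close> at this rate. That \<open>g\<close> equals \<open>u\<close>
  almost everywhere follows from the convergence at exponent \<open>p\<close> and Fatou, in place of
  a differentiation theorem.\<close>

lemma nn_integral_avg_error_le:
  fixes u :: "real ^ 'n \<Rightarrow> real"
  assumes u [measurable]: "u \<in> borel_measurable borel" and s: "0 < s" and p: "1 < p" and r: "p \<le> r"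
    and fin: "power_integral p u < \<infinity>"
    and E: "gagliardo_energy s p u \<le> ennreal M" and M: "M > 0"
    and \<delta>: "s + real CARD('n) / r - real CARD('n) / p > 0"
  defines "C \<equiv> (4 powr p * 2 powr real CARD('n) * real CARD('n) powr (real CARD('n) + s * p) * M) powr (r / p)"
    and "\<theta> \<equiv> 2 powr (- (r * (s + real CARD('n) / r - real CARD('n) / p)))"
  shows "(\<integral>\<^sup>+ x. ennreal (\<bar>u x - avg j u x\<bar> powr r) \<partial>lborel) \<le>
       ennreal ((1 / (1 - \<theta> powr (1 / (2 * r)))) powr r * C / (1 - sqrt \<theta>) * sqrt \<theta> ^ j)"
proof -
  have r1: "r \<ge> 1" using p r by simp
  have C: "C \<ge> 0" by (simp add: C_def)
  have "r * (s + real CARD('n) / r - real CARD('n) / p) > 0" using \<delta> r1 by (intro mult_pos_pos) auto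
  then have \<theta>: "0 < \<theta>" "\<theta> < 1" by (auto simp: \<theta>_def intro!: powr_less_one)
  obtain g where g [measurable]: "g \<in> borel_measurable lborel" and lim: "AE x in lborel. (\<lambda>j. avg j u x) \<longlonglongrightarrow> g x"
    and bd: "\<And>j. (\<integral>\<^sup>+ x. ennreal (\<bar>g x - avg j u x\<bar> powr r) \<partial>lborel) \<le>
       ennreal ((1 / (1 - \<theta> powr (1 / (2 * r)))) powr r * C / (1 - sqrt \<theta>) * sqrt \<theta> ^ j)"
    using geometric_increments_AE_limit[of "\<lambda>j. avg j u" lborel r C \<theta>]
      nn_integral_avg_increment_le[OF u s p r fin E M] r1 C \<theta>
    unfolding C_def \<theta>_def by (auto simp: borel_measurable_avg)
  define c where "c j = 2 powr p * real CARD('n) powr (real CARD('n) + s * p) * 2 powr (- (s * p) * real j) * M" for j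
  have le_c: "(\<integral>\<^sup>+ x. ennreal (\<bar>u x - avg j u x\<bar> powr p) \<partial>lborel) \<le> ennreal (c j)" for j
  proof -
    have "(\<integral>\<^sup>+ x. ennreal (\<bar>u x - avg j u x\<bar> powr p) \<partial>lborel) \<le>
       ennreal (2 powr p * real CARD('n) powr (real CARD('n) + s * p) * 2 powr (- (s * p) * real j)) * gagliardo_energy s p u"
      by (rule nn_integral_diff_avg_le[OF u s p fin])
    also have "\<dots> \<le> ennreal (2 powr p * real CARD('n) powr (real CARD('n) + s * p) * 2 powr (- (s * p) * real j)) * ennreal M"
      by (intro mult_left_mono E) auto
    also have "\<dots> = ennreal (c j)" unfolding c_def using M by (intro ennreal_mult[symmetric]) auto
    finally show ?thesis .
  qed
  have c0: "c \<longlonglongrightarrow> 0"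
  proof -
    have "s * p > 0" using s p by simp
    then have "2 powr (- (s * p)) < (1 :: real)" by (intro powr_less_one) auto
    then have "(\<lambda>j. (2 powr (- (s * p))) ^ j) \<longlonglongrightarrow> (0 :: real)" by (intro LIMSEQ_power_zero) auto
    then have "(\<lambda>j. 2 powr (- (s * p) * real j)) \<longlonglongrightarrow> (0 :: real)" by (simp add: powr_powr flip: powr_realpow)
    then have "c \<longlonglongrightarrow> 2 powr p * real CARD('n) powr (real CARD('n) + s * p) * 0 * M"
      unfolding c_def[abs_def] by (intro tendsto_intros)
    then show ?thesis by simp
  qed
  have "(\<integral>\<^sup>+ x. ennreal (\<bar>u x - g x\<bar> powr p) \<partial>lborel) \<le> (\<integral>\<^sup>+ x. liminf (\<lambda>j. ennreal (\<bar>u x - avg j u x\<bar> powr p)) \<partial>lborel)"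
  proof (rule nn_integral_mono_AE)
    show "AE x in lborel. ennreal (\<bar>u x - g x\<bar> powr p) \<le> liminf (\<lambda>j. ennreal (\<bar>u x - avg j u x\<bar> powr p))"
      using lim
    proof eventually_elim
      case (elim x)
      then have "(\<lambda>j. ennreal (\<bar>u x - avg j u x\<bar> powr p)) \<longlonglongrightarrow> ennreal (\<bar>u x - g x\<bar> powr p)"
        using p by (intro tendsto_ennrealI tendsto_powr' tendsto_intros) auto
      from lim_imp_Liminf[OF sequentially_bot this] show ?case by simp
    qed
  qed
  also have "\<dots> \<le> liminf (\<lambda>j. \<integral>\<^sup>+ x. ennreal (\<bar>u x - avg j u x\<bar> powr p) \<partial>lborel)"
    by (rule nn_integral_liminf) measurable
  also have "\<dots> \<le> liminf (\<lambda>j. ennreal (c j))"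
    by (intro Liminf_mono always_eventually allI le_c)
  also have "\<dots> = 0"
    using lim_imp_Liminf[OF sequentially_bot tendsto_ennrealI[OF c0]] by simp
  finally have "AE x in lborel. ennreal (\<bar>u x - g x\<bar> powr p) = 0"
    by (subst nn_integral_0_iff_AE[symmetric]) auto
  then have "AE x in lborel. g x = u x" by eventually_elim (auto simp: ennreal_eq_0_iff)
  then have "(\<integral>\<^sup>+ x. ennreal (\<bar>u x - avg j u x\<bar> powr r) \<partial>lborel) = (\<integral>\<^sup>+ x. ennreal (\<bar>g x - avg j u x\<bar> powr r) \<partial>lborel)"
    by (intro nn_integral_cong_AE) (auto elim: eventually_mono)
  with bd[of j] show ?thesis by simp
qed

text \<open>Stated for the exponent of the normalisation: along a minimizing sequence the
  \<open>q\<close> norm is fixed, while no uniform bound on the \<open>p\<close> norms is at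
  hand.\<close>

lemma abs_avg_le:
  fixes u :: "real ^ 'n \<Rightarrow> real"
  assumes u [measurable]: "u \<in> borel_measurable borel" and q: "1 \<le> q"
    and fin: "power_integral q u \<le> 1"
  shows "\<bar>avg j u x\<bar> \<le> ((1 / 2 ^ j) ^ CARD('n) + 1) / (1 / 2 ^ j) ^ CARD('n)"
proof -
  have fin': "power_integral q u < \<infinity>"
    using fin by (auto simp: less_top[symmetric] top_unique)
  note int = integrable_on_cell[OF u q fin']
  have "ennreal (LINT y|lborel. \<bar>indicator (cell j x) y * u y\<bar>) = (\<integral>\<^sup>+ y. ennreal \<bar>indicator (cell j x) y * u y\<bar> \<partial>lborel)"
    using int(1)[of j x] by (subst nn_integral_eq_integral) auto
  also have "\<dots> \<le> ennreal ((1 / 2 ^ j) ^ CARD('n)) + 1"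
    using int(2)[of j x] fin by (meson add_left_mono order_trans)
  also have "\<dots> = ennreal ((1 / 2 ^ j) ^ CARD('n) + 1)" by (simp flip: ennreal_1 ennreal_plus)
  finally have "(LINT y|lborel. \<bar>indicator (cell j x) y * u y\<bar>) \<le> (1 / 2 ^ j) ^ CARD('n) + 1"
    by (subst (asm) ennreal_le_iff) auto
  with integral_abs_bound have "\<bar>LINT y|lborel. indicator (cell j x) y * u y\<bar> \<le> (1 / 2 ^ j) ^ CARD('n) + 1"
    by (rule order_trans)
  then have "\<bar>LINT y|lborel. indicator (cell j x) y * u y\<bar> / (1 / 2 ^ j) ^ CARD('n) \<le>
      ((1 / 2 ^ j) ^ CARD('n) + 1) / (1 / 2 ^ j) ^ CARD('n)"
    by (intro divide_right_mono) auto
  moreover have "\<bar>(1 / 2 ^ j :: real) ^ CARD('n)\<bar> = (1 / 2 ^ j) ^ CARD('n)" by simp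
  ultimately show ?thesis by (simp only: avg_def abs_divide)
qed

text \<open>Averages are constant on cells, so a dense set, which meets the interior of every cell,
  carries all their values. Convergence everywhere is thus reduced to countably many points.\<close>

lemma countable_set_meets_cells:
  obtains D :: "(real ^ 'n) set" where "countable D" "\<And>j x. \<exists>y\<in>D. y \<in> cell j x"
proof -
  obtain D :: "(real ^ 'n) set" where D: "countable D" "\<And>X. open X \<Longrightarrow> X \<noteq> {} \<Longrightarrow> \<exists>d\<in>D. d \<in> X"
    using countable_dense_setE by blast
  have "\<exists>y\<in>D. y \<in> cell j x" for j and x :: "real ^ 'n"
  proof -
    define a where "a = (\<chi> i. real_of_int \<lfloor>2 ^ j * x $ i\<rfloor> / 2 ^ j)"
    define b where "b = (\<chi> i. (real_of_int \<lfloor>2 ^ j * x $ i\<rfloor> + 1) / 2 ^ j)"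
    have "box a b \<noteq> {}"
      unfolding box_ne_empty by (auto simp: Basis_vec_def inner_axis a_def b_def divide_strict_right_mono)
    moreover have "box a b \<subseteq> cell j x"
      by (auto simp: mem_cell_iff mem_box_cart a_def b_def less_imp_le)
    ultimately show ?thesis using D(2)[of "box a b"] by blast
  qed
  with D(1) that show thesis by blast
qed

text \<open>Cells of every level have diameter at most \<open>CARD('n)\<close>, so one enlarged ball
  contains the supports of all averages.\<close>

lemma avg_outside:
  fixes u :: "real ^ 'n \<Rightarrow> real"
  assumes "u \<in> borel_measurable borel" "AE x in lborel. x \<notin> U \<longrightarrow> u x = 0" "U \<subseteq> ball 0 R"
    "norm x > R + real CARD('n)"
  shows "avg j u x = 0"
proof -
  have "AE y in lborel. indicator (cell j x) y * u y = 0"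
    using assms(2)
  proof eventually_elim
    case (elim y)
    show ?case
    proof (cases "y \<in> cell j x")
      case True
      have "norm (x - y) \<le> real CARD('n) / 2 ^ j" by (rule cell_diam[OF mem_cell_self True])
      also have "\<dots> \<le> real CARD('n)" by (simp add: divide_le_eq)
      finally have "norm y > R" using assms(4) norm_triangle_sub[of x y] by linarith
      then have "y \<notin> U" using assms(3) by auto
      then show ?thesis using elim by simp
    qed simp
  qed
  then have "(LINT y|lborel. indicator (cell j x) y * u y) = 0" by (rule integral_eq_zero_AE)
  then show ?thesis by (simp add: avg_def)
qed

text \<open>The error \<open>u - g\<close> is split at \<open>avg j u\<close> and at the limit
  \<open>w j\<close> of these averages. The outer parts are geometrically small in \<open>j\<close>,
  uniformly along the sequence; the middle part tends to 0 for fixed \<open>j\<close> by dominated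
  convergence. So \<open>n\<close> goes to infinity before \<open>j\<close> does.\<close>

lemma W0_bounded_energy_compact:
  fixes u :: "nat \<Rightarrow> real ^ 'n \<Rightarrow> real"
  assumes u: "\<And>n. u n \<in> W0 s p U" and U: "bounded U" and s: "0 < s" and p: "1 < p" and q: "1 \<le> q" and r: "p \<le> r"
    and norm: "\<And>n. power_integral q (u n) \<le> 1"
    and E: "\<And>n. gagliardo_energy s p (u n) \<le> ennreal M" and M: "M > 0"
    and \<delta>: "s + real CARD('n) / r - real CARD('n) / p > 0"
  obtains \<rho> :: "nat \<Rightarrow> nat" and g where "strict_mono \<rho>" "g \<in> borel_measurable borel"
    "(\<lambda>n. \<integral>\<^sup>+ x. ennreal (\<bar>u (\<rho> n) x - g x\<bar> powr r) \<partial>lborel) \<longlonglongrightarrow> 0"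
proof -
  note um [measurable] = W0_measurable[OF u]
  note fin = W0_nn_integral_powr[OF u]
  have r1: "r \<ge> 1" using p r by simp
  define C where "C = (4 powr p * 2 powr real CARD('n) * real CARD('n) powr (real CARD('n) + s * p) * M) powr (r / p)"
  define \<theta> :: real where "\<theta> = 2 powr (- (r * (s + real CARD('n) / r - real CARD('n) / p)))"
  define K where "K = (1 / (1 - \<theta> powr (1 / (2 * r)))) powr r * C / (1 - sqrt \<theta>)"
  have C: "C \<ge> 0" by (simp add: C_def)
  have "r * (s + real CARD('n) / r - real CARD('n) / p) > 0" using \<delta> r1 by (intro mult_pos_pos) auto
  then have \<theta>: "0 < \<theta>" "\<theta> < 1" by (auto simp: \<theta>_def intro!: powr_less_one)
  have K: "K \<ge> 0" using C \<theta> by (auto simp: K_def)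
  define B where "B j = ((1 / 2 ^ j) ^ CARD('n) + 1) / (1 / 2 ^ j :: real) ^ CARD('n)" for j
  have B: "\<bar>avg j (u n) x\<bar> \<le> B j" for j n x
    unfolding B_def by (rule abs_avg_le[OF um q norm])
  obtain D :: "(real ^ 'n) set" where D: "countable D" "\<And>j x. \<exists>y\<in>D. y \<in> cell j x"
    using countable_set_meets_cells by blast
  obtain \<rho> where \<rho>: "strict_mono \<rho>" and conv: "\<And>z. z \<in> (UNIV :: nat set) \<times> D \<Longrightarrow> convergent (\<lambda>n. avg (fst z) (u (\<rho> n)) (snd z))"
    using bounded_diagonal_subsequence[of "(UNIV :: nat set) \<times> D" "\<lambda>n z. avg (fst z) (u n) (snd z)" "\<lambda>z. B (fst z)"] D(1) B
    by (metis countable_SIGMA countableI_type)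
  define w where "w j x = lim (\<lambda>n. avg j (u (\<rho> n)) x)" for j x
  have w [measurable]: "w j \<in> borel_measurable borel" for j
    unfolding w_def[abs_def] by measurable
  have lim: "(\<lambda>n. avg j (u (\<rho> n)) x) \<longlonglongrightarrow> w j x" for j x
  proof -
    obtain y where "y \<in> D" "y \<in> cell j x" using D(2) by blast
    then have "convergent (\<lambda>n. avg j (u (\<rho> n)) x)" using conv[of "(j, y)"] avg_cong[of y j x] by simp
    then show ?thesis by (simp add: w_def convergent_LIMSEQ_iff)
  qed
  \<comment> \<open>By Fatou the limits \<open>w j\<close> inherit the increment bound of the
    averages, so they too converge at a geometric rate.\<close>
  have incr: "(\<integral>\<^sup>+ x. ennreal (\<bar>w (Suc j) x - w j x\<bar> powr r) \<partial>lborel) \<le> ennreal (C * \<theta> ^ j)" for j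
  proof -
    have "(\<integral>\<^sup>+ x. ennreal (\<bar>w (Suc j) x - w j x\<bar> powr r) \<partial>lborel) =
      (\<integral>\<^sup>+ x. liminf (\<lambda>n. ennreal (\<bar>avg (Suc j) (u (\<rho> n)) x - avg j (u (\<rho> n)) x\<bar> powr r)) \<partial>lborel)"
    proof (rule nn_integral_cong)
      fix x
      have "(\<lambda>n. ennreal (\<bar>avg (Suc j) (u (\<rho> n)) x - avg j (u (\<rho> n)) x\<bar> powr r)) \<longlonglongrightarrow> ennreal (\<bar>w (Suc j) x - w j x\<bar> powr r)"
        using r1 by (intro tendsto_ennrealI tendsto_powr' tendsto_intros lim) auto
      from lim_imp_Liminf[OF sequentially_bot this]
      show "ennreal (\<bar>w (Suc j) x - w j x\<bar> powr r) = liminf (\<lambda>n. ennreal (\<bar>avg (Suc j) (u (\<rho> n)) x - avg j (u (\<rho> n)) x\<bar> powr r))"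
        by simp
    qed
    also have "\<dots> \<le> liminf (\<lambda>n. \<integral>\<^sup>+ x. ennreal (\<bar>avg (Suc j) (u (\<rho> n)) x - avg j (u (\<rho> n)) x\<bar> powr r) \<partial>lborel)"
      by (rule nn_integral_liminf) measurable
    also have "\<dots> \<le> liminf (\<lambda>n. ennreal (C * \<theta> ^ j))"
      unfolding C_def \<theta>_def
      by (intro Liminf_mono always_eventually allI nn_integral_avg_increment_le um s p r fin E M)
    also have "\<dots> = ennreal (C * \<theta> ^ j)" by (simp add: Liminf_const)
    finally show ?thesis .
  qed
  have wl: "w j \<in> borel_measurable lborel" for j using w by simp
  obtain g where g: "g \<in> borel_measurable lborel" and "AE x in lborel. (\<lambda>j. w j x) \<longlonglongrightarrow> g x"
    and gw: "\<And>j. (\<integral>\<^sup>+ x. ennreal (\<bar>g x - w j x\<bar> powr r) \<partial>lborel) \<le> ennreal (K * sqrt \<theta> ^ j)"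
    unfolding K_def using geometric_increments_AE_limit[OF wl r1 C \<theta> incr] by blast
  then have [measurable]: "g \<in> borel_measurable borel" by simp
  obtain R where R: "U \<subseteq> ball 0 R" using bounded_subset_ballD[OF U, of 0] by blast
  define Q where "Q = cball (0 :: real ^ 'n) (R + real CARD('n))"
  have mid: "(\<lambda>n. \<integral>\<^sup>+ x. ennreal (\<bar>avg j (u (\<rho> n)) x - w j x\<bar> powr r) \<partial>lborel) \<longlonglongrightarrow> 0" for j
  proof -
    have "(\<lambda>n. \<integral>\<^sup>+ x. ennreal (\<bar>avg j (u (\<rho> n)) x - w j x\<bar> powr r) \<partial>lborel) \<longlonglongrightarrow> (\<integral>\<^sup>+ (x :: real ^ 'n). 0 \<partial>lborel)"
    proof (rule nn_integral_dominated_convergence[where w = "\<lambda>x. ennreal ((2 * B j) powr r) * indicator Q x"])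
      show "AE x in lborel. ennreal (\<bar>avg j (u (\<rho> n)) x - w j x\<bar> powr r) \<le> ennreal ((2 * B j) powr r) * indicator Q x" for n
      proof (rule AE_I2)
        fix x
        have wB: "\<bar>w j x\<bar> \<le> B j"
          using tendsto_rabs[OF lim[of j x]] by (rule LIMSEQ_le_const2) (use B in blast)
        have out: "avg j (u n) x = 0" if "x \<notin> Q" for n
          using avg_outside[OF um W0_outside[OF u] R, of x j n] that by (simp add: Q_def)
        then have wout: "w j x = 0" if "x \<notin> Q" using that lim[of j x] by (simp add: out LIMSEQ_const_iff)
        have "\<bar>avg j (u (\<rho> n)) x - w j x\<bar> \<le> 2 * B j" using B[of j "\<rho> n" x] wB by linarith
        then have "\<bar>avg j (u (\<rho> n)) x - w j x\<bar> powr r \<le> (2 * B j) powr r" using r1 by (intro powr_mono2) auto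
        then show "ennreal (\<bar>avg j (u (\<rho> n)) x - w j x\<bar> powr r) \<le> ennreal ((2 * B j) powr r) * indicator Q x"
          using out wout by (cases "x \<in> Q") (auto intro: ennreal_leI)
      qed
      have "emeasure lborel Q < \<infinity>" unfolding Q_def by (rule emeasure_lborel_cball_finite)
      moreover have "Q \<in> sets lborel" by (simp add: Q_def)
      ultimately show "(\<integral>\<^sup>+ x. ennreal ((2 * B j) powr r) * indicator Q x \<partial>lborel) < \<infinity>"
        by (simp add: nn_integral_cmult_indicator ennreal_mult_less_top)
      show "AE x in lborel. (\<lambda>n. ennreal (\<bar>avg j (u (\<rho> n)) x - w j x\<bar> powr r)) \<longlonglongrightarrow> 0"
      proof (rule AE_I2)
        fix x
        have "(\<lambda>n. \<bar>avg j (u (\<rho> n)) x - w j x\<bar> powr r) \<longlonglongrightarrow> \<bar>w j x - w j x\<bar> powr r"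
          using r1 by (intro tendsto_powr' tendsto_intros lim) auto
        then show "(\<lambda>n. ennreal (\<bar>avg j (u (\<rho> n)) x - w j x\<bar> powr r)) \<longlonglongrightarrow> 0"
          using tendsto_ennrealI by force
      qed
      have "Q \<in> sets borel" by (simp add: Q_def)
      then show "(\<lambda>x. ennreal ((2 * B j) powr r) * indicator Q x) \<in> borel_measurable lborel" by measurable
    qed measurable
    then show ?thesis by simp
  qed
  have tri: "(\<integral>\<^sup>+ x. ennreal (\<bar>u (\<rho> n) x - g x\<bar> powr r) \<partial>lborel) \<le>
      ennreal (2 powr r) * (ennreal (K * sqrt \<theta> ^ j) + ennreal (2 powr r) * ((\<integral>\<^sup>+ x. ennreal (\<bar>avg j (u (\<rho> n)) x - w j x\<bar> powr r) \<partial>lborel) + ennreal (K * sqrt \<theta> ^ j)))"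
    for n j
  proof -
    have r0: "r \<ge> 0" using r1 by simp
    have "(\<integral>\<^sup>+ x. ennreal (\<bar>u (\<rho> n) x - g x\<bar> powr r) \<partial>lborel) =
       (\<integral>\<^sup>+ x. ennreal (\<bar>(u (\<rho> n) x - avg j (u (\<rho> n)) x) + (avg j (u (\<rho> n)) x - g x)\<bar> powr r) \<partial>lborel)" by simp
    also have "\<dots> \<le> ennreal (2 powr r) * ((\<integral>\<^sup>+ x. ennreal (\<bar>u (\<rho> n) x - avg j (u (\<rho> n)) x\<bar> powr r) \<partial>lborel) + (\<integral>\<^sup>+ x. ennreal (\<bar>avg j (u (\<rho> n)) x - g x\<bar> powr r) \<partial>lborel))"
      by (rule nn_integral_powr_add_le) (use r0 in measurable)
    also have "(\<integral>\<^sup>+ x. ennreal (\<bar>avg j (u (\<rho> n)) x - g x\<bar> powr r) \<partial>lborel) =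
       (\<integral>\<^sup>+ x. ennreal (\<bar>(avg j (u (\<rho> n)) x - w j x) + (w j x - g x)\<bar> powr r) \<partial>lborel)" by simp
    also have "\<dots> \<le> ennreal (2 powr r) * ((\<integral>\<^sup>+ x. ennreal (\<bar>avg j (u (\<rho> n)) x - w j x\<bar> powr r) \<partial>lborel) + (\<integral>\<^sup>+ x. ennreal (\<bar>w j x - g x\<bar> powr r) \<partial>lborel))"
      by (rule nn_integral_powr_add_le) (use r0 in measurable)
    finally have "(\<integral>\<^sup>+ x. ennreal (\<bar>u (\<rho> n) x - g x\<bar> powr r) \<partial>lborel) \<le> ennreal (2 powr r) * ((\<integral>\<^sup>+ x. ennreal (\<bar>u (\<rho> n) x - avg j (u (\<rho> n)) x\<bar> powr r) \<partial>lborel) +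
        ennreal (2 powr r) * ((\<integral>\<^sup>+ x. ennreal (\<bar>avg j (u (\<rho> n)) x - w j x\<bar> powr r) \<partial>lborel) + (\<integral>\<^sup>+ x. ennreal (\<bar>w j x - g x\<bar> powr r) \<partial>lborel)))"
      by (simp add: add_left_mono mult_left_mono)
    also have "\<dots> \<le> ennreal (2 powr r) * (ennreal (K * sqrt \<theta> ^ j) + ennreal (2 powr r) * ((\<integral>\<^sup>+ x. ennreal (\<bar>avg j (u (\<rho> n)) x - w j x\<bar> powr r) \<partial>lborel) + ennreal (K * sqrt \<theta> ^ j)))"
      using gw[of j] nn_integral_avg_error_le[OF um s p r fin E M \<delta>, of "\<rho> n" j]
      unfolding K_def C_def \<theta>_def
      by (intro mult_left_mono add_mono order_refl) (simp_all add: abs_minus_commute)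
    finally show ?thesis .
  qed
  have "(\<lambda>n. \<integral>\<^sup>+ x. ennreal (\<bar>u (\<rho> n) x - g x\<bar> powr r) \<partial>lborel) \<longlonglongrightarrow> 0"
  proof -
    define L where "L n = (\<integral>\<^sup>+ x. ennreal (\<bar>u (\<rho> n) x - g x\<bar> powr r) \<partial>lborel)" for n
    define F where "F j = ennreal (2 powr r) * (ennreal (K * sqrt \<theta> ^ j) + ennreal (2 powr r) * (0 + ennreal (K * sqrt \<theta> ^ j)))" for j
    have "limsup L \<le> F j" for j
    proof -
      have "limsup L \<le> limsup (\<lambda>n. ennreal (2 powr r) * (ennreal (K * sqrt \<theta> ^ j) + ennreal (2 powr r) * ((\<integral>\<^sup>+ x. ennreal (\<bar>avg j (u (\<rho> n)) x - w j x\<bar> powr r) \<partial>lborel) + ennreal (K * sqrt \<theta> ^ j))))"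
        unfolding L_def by (intro Limsup_mono always_eventually allI tri)
      also have "\<dots> = F j"
        unfolding F_def
        by (rule lim_imp_Limsup[OF sequentially_bot])
          (intro tendsto_intros ennreal_tendsto_cmult mid; simp add: less_top[symmetric])
      finally show ?thesis .
    qed
    moreover have "F \<longlonglongrightarrow> 0"
    proof -
      have "sqrt \<theta> < 1" "0 \<le> sqrt \<theta>" using \<theta> by auto
      then have "(\<lambda>j. K * sqrt \<theta> ^ j) \<longlonglongrightarrow> K * 0"
        by (intro tendsto_intros LIMSEQ_power_zero) auto
      then have t: "(\<lambda>j. ennreal (K * sqrt \<theta> ^ j)) \<longlonglongrightarrow> 0" using tendsto_ennrealI by force
      have "F \<longlonglongrightarrow> ennreal (2 powr r) * (0 + ennreal (2 powr r) * (0 + 0))"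
        unfolding F_def[abs_def] by (intro tendsto_add tendsto_const ennreal_tendsto_cmult t) (auto simp: less_top[symmetric])
      then show ?thesis by simp
    qed
    ultimately have "limsup L \<le> 0" by (intro LIMSEQ_le_const) auto
    then have "limsup L = 0" by simp
    moreover have "liminf L = 0" using Liminf_le_Limsup[of sequentially L] \<open>limsup L \<le> 0\<close> by simp
    ultimately have "L \<longlonglongrightarrow> 0" by (intro limsup_le_liminf_real Liminf_eq_Limsup) auto
    then show ?thesis by (simp add: L_def[abs_def])
  qed
  then show thesis using that[of \<rho> g] \<rho> g by simp
qed

section \<open>Existence of minimizers\<close>

text \<open>Fatou is applied in each variable separately, so that almost everywhere convergence in a
  single variable can be used once for \<open>x\<close> and once for \<open>y\<close>.\<close>

lemma gagliardo_energy_le_liminf: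
  fixes u :: "nat \<Rightarrow> real ^ 'n \<Rightarrow> real"
  assumes um [measurable]: "\<And>k. u k \<in> borel_measurable borel"
    and lim: "AE x in lborel. (\<lambda>k. u k x) \<longlonglongrightarrow> g x" and p: "p > 0"
  shows "gagliardo_energy s p g \<le> liminf (\<lambda>k. gagliardo_energy s p (u k))"
proof -
  have "gagliardo_energy s p g \<le> (\<integral>\<^sup>+ x. liminf (\<lambda>k. \<integral>\<^sup>+ y. ennreal (gagliardo_density s p (u k) x y) \<partial>lborel) \<partial>lborel)"
    unfolding gagliardo_energy_density
  proof (rule nn_integral_mono_AE)
    show "AE x in lborel. (\<integral>\<^sup>+ y. ennreal (gagliardo_density s p g x y) \<partial>lborel) \<le>
        liminf (\<lambda>k. \<integral>\<^sup>+ y. ennreal (gagliardo_density s p (u k) x y) \<partial>lborel)"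
      using lim
    proof eventually_elim
      case (elim x)
      have "(\<integral>\<^sup>+ y. ennreal (gagliardo_density s p g x y) \<partial>lborel) \<le>
          (\<integral>\<^sup>+ y. liminf (\<lambda>k. ennreal (gagliardo_density s p (u k) x y)) \<partial>lborel)"
      proof (rule nn_integral_mono_AE)
        show "AE y in lborel. ennreal (gagliardo_density s p g x y) \<le> liminf (\<lambda>k. ennreal (gagliardo_density s p (u k) x y))"
          using lim
        proof eventually_elim
          case (elim y)
          have "(\<lambda>k. \<bar>u k x - u k y\<bar> powr p * inverse (norm (x - y) powr (real CARD('n) + s * p))) \<longlonglongrightarrow>
              \<bar>g x - g y\<bar> powr p * inverse (norm (x - y) powr (real CARD('n) + s * p))"
            using elim \<open>(\<lambda>k. u k x) \<longlonglongrightarrow> g x\<close> p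
            by (intro tendsto_mult tendsto_const tendsto_powr' tendsto_rabs tendsto_diff) auto
          then have "(\<lambda>k. ennreal (gagliardo_density s p (u k) x y)) \<longlonglongrightarrow> ennreal (gagliardo_density s p g x y)"
            unfolding gagliardo_density_def divide_inverse by (rule tendsto_ennrealI)
          from lim_imp_Liminf[OF sequentially_bot this] show ?case by simp
        qed
      qed
      also have "\<dots> \<le> liminf (\<lambda>k. \<integral>\<^sup>+ y. ennreal (gagliardo_density s p (u k) x y) \<partial>lborel)"
        by (rule nn_integral_liminf) measurable
      finally show ?case .
    qed
  qed
  also have "\<dots> \<le> liminf (\<lambda>k. gagliardo_energy s p (u k))"
    unfolding gagliardo_energy_density
    by (rule nn_integral_liminf) (rule lborel.borel_measurable_nn_integral, simp add: case_prod_beta' borel_measurable_gagliardo_density)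
  finally show ?thesis .
qed

text \<open>For \<open>q > p\<close> and \<open>s * p < d\<close> the subcritical condition says
  \<open>d / q > d / p - s\<close>; for \<open>q \<le> p\<close> the gap is just
  \<open>s\<close>.\<close>

lemma subcritical_gap_pos:
  fixes d s p q :: real
  assumes "d > 0" "0 < s" "1 < p" "1 \<le> q" "ereal q < sobolev_exponent d s p"
  shows "s + d / max p q - d / p > 0"
proof (cases "q \<le> p")
  case False
  then have m: "max p q = q" by simp
  show ?thesis
  proof (cases "s * p < d")
    case True
    then have "q < d * p / (d - s * p)" using assms by (simp add: sobolev_exponent_def)
    then have "q * (d - s * p) < d * p" using True by (simp add: field_simps)
    then show ?thesis unfolding m using assms by (simp add: field_simps)
  next
    case False
    then have "d / p \<le> s" using assms by (simp add: field_simps)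
    moreover have "d / q > 0" using assms by simp
    ultimately show ?thesis unfolding m by linarith
  qed
qed (use assms in simp)

text \<open>Either \<open>b\<close> is a small fraction of the sum or it is not. The first
  coefficient tends to 1 with \<open>\<epsilon>\<close>, so a lower bound on the norm survives a
  limit without loss; the fixed factor \<open>2 powr q\<close> of \<open>powr_add_le\<close> would
  spoil it.\<close>

lemma powr_le_powr_add:
  fixes a b \<epsilon> q :: real
  assumes "0 < \<epsilon>" "\<epsilon> < 1" "q \<ge> 0"
  shows "\<bar>a + b\<bar> powr q \<le> (1 - \<epsilon>) powr (- q) * \<bar>a\<bar> powr q + \<epsilon> powr (- q) * \<bar>b\<bar> powr q"
proof -
  have e: "(t powr (- q)) * \<bar>c\<bar> powr q = (\<bar>c\<bar> / t) powr q" if "t > 0" for t c :: real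
    using that by (simp add: powr_divide powr_minus_divide)
  show ?thesis
  proof (cases "\<bar>b\<bar> \<le> \<epsilon> * \<bar>a + b\<bar>")
    case True
    then have "(1 - \<epsilon>) * \<bar>a + b\<bar> \<le> \<bar>a\<bar>" by (simp add: algebra_simps)
    then have "\<bar>a + b\<bar> \<le> \<bar>a\<bar> / (1 - \<epsilon>)" using assms by (simp add: field_simps)
    then have "\<bar>a + b\<bar> powr q \<le> (\<bar>a\<bar> / (1 - \<epsilon>)) powr q" using assms by (intro powr_mono2) auto
    also have "\<dots> = (1 - \<epsilon>) powr (- q) * \<bar>a\<bar> powr q" using assms by (simp add: e)
    finally show ?thesis by (simp add: add_increasing2)
  next
    case False
    then have "\<bar>a + b\<bar> \<le> \<bar>b\<bar> / \<epsilon>" using assms by (simp add: field_simps)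
    then have "\<bar>a + b\<bar> powr q \<le> (\<bar>b\<bar> / \<epsilon>) powr q" using assms by (intro powr_mono2) auto
    also have "\<dots> = \<epsilon> powr (- q) * \<bar>b\<bar> powr q" using assms by (simp add: e)
    finally show ?thesis by (simp add: add_increasing)
  qed
qed

text \<open>Replaces Hoelder when \<open>U\<close> has finite measure, through \<open>t powr q \<le>
  \<eta> powr q + \<eta> powr (q - r) * t powr r\<close> for \<open>t \<ge> 0\<close>. The first
  term is made small by the choice of \<open>\<eta>\<close>, the second by convergence at exponent
  \<open>r\<close>.\<close>

lemma nn_integral_powr_le_of_support:
  fixes f :: "'a::euclidean_space \<Rightarrow> real"
  assumes [measurable]: "f \<in> borel_measurable borel" "U \<in> sets borel"
    and out: "AE x in lborel. x \<notin> U \<longrightarrow> f x = 0" and q: "1 \<le> q" "q \<le> r" and \<eta>: "\<eta> > 0"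
  shows "power_integral q f \<le>
    ennreal (\<eta> powr q) * emeasure lborel U + ennreal (\<eta> powr (q - r)) * power_integral r f"
proof -
  have pt: "\<bar>t\<bar> powr q \<le> \<eta> powr q + \<eta> powr (q - r) * \<bar>t\<bar> powr r" for t :: real
  proof (cases "\<bar>t\<bar> \<le> \<eta>")
    case True
    then have "\<bar>t\<bar> powr q \<le> \<eta> powr q" using q by (intro powr_mono2) auto
    then show ?thesis by (simp add: add_increasing2)
  next
    case False
    then have "\<bar>t\<bar> powr q = \<bar>t\<bar> powr (q - r) * \<bar>t\<bar> powr r" using \<eta> by (simp flip: powr_add)
    also have "\<dots> \<le> \<eta> powr (q - r) * \<bar>t\<bar> powr r" using False q \<eta> by (intro mult_right_mono powr_mono2') auto
    finally show ?thesis by (simp add: add_increasing)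
  qed
  have "power_integral q f \<le> (\<integral>\<^sup>+ x. ennreal (\<eta> powr q) * indicator U x + ennreal (\<eta> powr (q - r)) * ennreal (\<bar>f x\<bar> powr r) \<partial>lborel)"
    using out
  proof (intro nn_integral_mono_AE, eventually_elim)
    case (elim x)
    then show ?case using pt[of "f x"] by (cases "x \<in> U") (auto simp flip: ennreal_mult ennreal_plus)
  qed
  also have "\<dots> = ennreal (\<eta> powr q) * emeasure lborel U + ennreal (\<eta> powr (q - r)) * power_integral r f"
    by (subst nn_integral_add) (auto simp: nn_integral_cmult)
  finally show ?thesis .
qed

lemma nn_integral_powr_to_AE_subseq:
  fixes z :: "nat \<Rightarrow> 'a \<Rightarrow> real"
  assumes [measurable]: "\<And>n. z n \<in> borel_measurable M" and r: "r > 0"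
    and lim: "(\<lambda>n. \<integral>\<^sup>+ x. ennreal (\<bar>z n x\<bar> powr r) \<partial>M) \<longlonglongrightarrow> 0"
  obtains \<tau> :: "nat \<Rightarrow> nat" where "strict_mono \<tau>" "AE x in M. (\<lambda>n. z (\<tau> n) x) \<longlonglongrightarrow> 0"
proof -
  from order_tendstoD(2)[OF lim, of 1] obtain N where N: "\<And>n. n \<ge> N \<Longrightarrow> (\<integral>\<^sup>+ x. ennreal (\<bar>z n x\<bar> powr r) \<partial>M) < 1"
    by (auto simp: eventually_sequentially)
  \<comment> \<open>Discarding the first \<open>N\<close> terms makes every function integrable, as
    the subsequence theorem for \<open>L^1\<close> convergence requires.\<close>
  define v where "v n x = \<bar>z (n + N) x\<bar> powr r" for n x
  have [measurable]: "v n \<in> borel_measurable M" for n unfolding v_def[abs_def] by measurable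
  have v: "(\<integral>\<^sup>+ x. ennreal (v n x) \<partial>M) < 1" for n using N[of "n + N"] by (simp add: v_def)
  have int: "integrable M (v n)" for n
    by (intro integrableI_bounded) (use v[of n] in \<open>auto simp: v_def intro: less_trans\<close>)
  have "(\<lambda>n. \<integral>\<^sup>+ x. ennreal (v n x) \<partial>M) \<longlonglongrightarrow> ennreal 0"
    using LIMSEQ_ignore_initial_segment[OF lim, of N] by (simp add: v_def)
  moreover have "(\<integral>\<^sup>+ x. ennreal (v n x) \<partial>M) = ennreal (LINT x|M. norm (v n x))" for n
  proof -
    have nn: "0 \<le> v n x" for x by (simp add: v_def)
    then show ?thesis using int[of n] by (simp add: nn_integral_eq_integral)
  qed
  ultimately have "(\<lambda>n. ennreal (LINT x|M. norm (v n x))) \<longlonglongrightarrow> ennreal 0" by simp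
  then have "(\<lambda>n. LINT x|M. norm (v n x)) \<longlonglongrightarrow> 0"
    by (subst (asm) tendsto_ennreal_iff) auto
  from tendsto_L1_AE_subseq[OF int this] obtain t where t: "strict_mono t" "AE x in M. (\<lambda>n. v (t n) x) \<longlonglongrightarrow> 0"
    by blast
  show thesis
  proof (rule that)
    show "strict_mono (\<lambda>n. t n + N)" using t(1) by (simp add: strict_mono_def)
    show "AE x in M. (\<lambda>n. z (t n + N) x) \<longlonglongrightarrow> 0"
      using t(2) by eventually_elim (auto simp: v_def intro: powr_zero_if_tendsto[OF _ r])
  qed
qed

text \<open>The exponent \<open>r = max p q\<close> is at least \<open>p\<close>, as the averaging
  estimate demands, and convergence at \<open>r\<close> descends to \<open>p\<close> and
  \<open>q\<close> because \<open>U\<close> is bounded. Inequalities suffice in the conclusion: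
  together with \<open>frac_eigenvalue_le_energy\<close> they make the energy of \<open>u\<close>
  equal to the infimum.\<close>

lemma frac_eigenvalue_minimizer:
  fixes \<phi> :: "real ^ 'n \<Rightarrow> real"
  assumes U: "bounded U" "U \<in> sets borel" and s: "0 < s" and p: "1 < p" and q: "1 \<le> q"
    and crit: "ereal q < sobolev_exponent (real CARD('n)) s p"
    and \<phi>: "\<phi> \<in> W0 s p U"
      "0 < power_integral q \<phi>" "power_integral q \<phi> < \<infinity>"
  obtains u where "u \<in> W0 s p U" "\<And>x. 0 \<le> u x"
    "1 \<le> power_integral q u" "power_integral q u < \<infinity>"
    "enn2real (gagliardo_energy s p u) \<le> frac_eigenvalue s p q U"
proof -
  have p0: "p > 0" and q0: "q > 0" using p q by auto
  define r where "r = max p q"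
  have r: "p \<le> r" "q \<le> r" by (auto simp: r_def)
  have \<delta>: "s + real CARD('n) / r - real CARD('n) / p > 0"
    unfolding r_def by (rule subcritical_gap_pos[OF _ s p q crit]) simp
  define l where "l = frac_eigenvalue s p q U"
  obtain u :: "nat \<Rightarrow> real ^ 'n \<Rightarrow> real" where u: "\<And>n. u n \<in> W0 s p U"
    and u1: "\<And>n. power_integral q (u n) = 1"
    and uE: "\<And>n. gagliardo_energy s p (u n) \<le> ennreal (l + 1 / real (Suc n))" and l: "0 \<le> l"
    unfolding l_def using frac_eigenvalue_minimizing_sequence[OF \<phi>(1) U(2) p0 q0 \<phi>(2,3)] by metis
  note [measurable] = W0_measurable[OF u]
  have uE1: "gagliardo_energy s p (u n) \<le> ennreal (l + 1)" for n
    using uE[of n] by (rule order_trans) (intro ennreal_leI, simp)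
  have u1': "power_integral q (u n) \<le> 1" for n by (rule eq_refl[OF u1])
  have l1: "l + 1 > 0" using l by simp
  obtain \<rho> g where \<rho>: "strict_mono \<rho>" and g [measurable]: "g \<in> borel_measurable borel"
    and lim: "(\<lambda>n. \<integral>\<^sup>+ x. ennreal (\<bar>u (\<rho> n) x - g x\<bar> powr r) \<partial>lborel) \<longlonglongrightarrow> 0"
    by (rule W0_bounded_energy_compact[OF u U(1) s p q r(1) u1' uE1 l1 \<delta>])
  have r0: "r > 0" using r p by simp
  have zm: "(\<lambda>x. u (\<rho> n) x - g x) \<in> borel_measurable lborel" for n by measurable
  obtain \<tau> where \<tau>: "strict_mono \<tau>" and ae: "AE x in lborel. (\<lambda>n. u (\<rho> (\<tau> n)) x - g x) \<longlonglongrightarrow> 0"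
    by (rule nn_integral_powr_to_AE_subseq[OF zm r0 lim])
  define v where "v n = u (\<rho> (\<tau> n))" for n
  have v: "v n \<in> W0 s p U" for n by (simp add: v_def u)
  note vm [measurable] = W0_measurable[OF v]
  have v1: "power_integral q (v n) = 1" for n by (simp add: v_def u1)
  have aev: "AE x in lborel. (\<lambda>n. v n x) \<longlonglongrightarrow> g x"
    using ae unfolding v_def by eventually_elim (simp add: LIM_zero_iff)
  have limv: "(\<lambda>n. \<integral>\<^sup>+ x. ennreal (\<bar>v n x - g x\<bar> powr r) \<partial>lborel) \<longlonglongrightarrow> 0"
    using LIMSEQ_subseq_LIMSEQ[OF lim \<tau>] by (simp add: v_def o_def)
  have gout: "AE x in lborel. x \<notin> U \<longrightarrow> g x = 0"
  proof -
    have "AE x in lborel. \<forall>n. x \<notin> U \<longrightarrow> v n x = 0"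
      unfolding AE_all_countable using W0_outside[OF v] by blast
    with aev show ?thesis
    proof eventually_elim
      case (elim x)
      then show ?case by (auto simp: LIMSEQ_const_iff)
    qed
  qed
  have diff_out: "AE x in lborel. x \<notin> U \<longrightarrow> v n x - g x = 0" for n
    using gout W0_outside[OF v[of n]] by eventually_elim auto
  define V where "V = emeasure lborel U"
  have V: "V < \<infinity>" unfolding V_def using U(1) by (rule emeasure_bounded_finite)
  have Egl: "gagliardo_energy s p g \<le> ennreal l"
  proof -
    have "gagliardo_energy s p g \<le> liminf (\<lambda>k. gagliardo_energy s p (v k))"
      by (rule gagliardo_energy_le_liminf[OF vm aev p0])
    also have "\<dots> \<le> liminf (\<lambda>k. ennreal (l + 1 / real (Suc k)))"
    proof (intro Liminf_mono always_eventually allI)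
      fix k
      have "k \<le> \<rho> (\<tau> k)" using seq_suble[OF \<rho>] seq_suble[OF \<tau>] order_trans by blast
      then have "l + 1 / real (Suc (\<rho> (\<tau> k))) \<le> l + 1 / real (Suc k)" by (simp add: frac_le)
      then show "gagliardo_energy s p (v k) \<le> ennreal (l + 1 / real (Suc k))"
        unfolding v_def using uE[of "\<rho> (\<tau> k)"] ennreal_leI order_trans by blast
    qed
    also have "\<dots> = ennreal l"
    proof -
      have "(\<lambda>k. l + 1 / real (Suc k)) \<longlonglongrightarrow> l + 0"
        by (intro tendsto_add tendsto_const LIMSEQ_Suc[OF lim_1_over_n])
      then have "(\<lambda>k. ennreal (l + 1 / real (Suc k))) \<longlonglongrightarrow> ennreal l" using tendsto_ennrealI by fastforce
      from lim_imp_Liminf[OF sequentially_bot this] show ?thesis .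
    qed
    finally show ?thesis .
  qed
  have Lfin: "eventually (\<lambda>n. (\<integral>\<^sup>+ x. ennreal (\<bar>v n x - g x\<bar> powr r) \<partial>lborel) < 1) sequentially"
    using order_tendstoD(2)[OF limv, of 1] by simp
  then obtain N where N: "(\<integral>\<^sup>+ x. ennreal (\<bar>v N x - g x\<bar> powr r) \<partial>lborel) < 1"
    by (auto simp: eventually_sequentially)
  \<comment> \<open>A single \<open>v N\<close> close to \<open>g\<close> transfers integrability;
    it is used for \<open>t = p\<close> and \<open>t = q\<close>.\<close>
  have fin: "power_integral t g < \<infinity>" if t: "1 \<le> t" "t \<le> r" and vt: "power_integral t (v N) < \<infinity>" for t
  proof -
    have "(\<integral>\<^sup>+ x. ennreal (\<bar>v N x - g x\<bar> powr t) \<partial>lborel) \<le>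
        ennreal (1 powr t) * emeasure lborel U + ennreal (1 powr (t - r)) * (\<integral>\<^sup>+ x. ennreal (\<bar>v N x - g x\<bar> powr r) \<partial>lborel)"
      by (rule nn_integral_powr_le_of_support[OF _ U(2) diff_out t]) auto
    also have "\<dots> < \<infinity>" using V N less_trans[OF N ennreal_one_less_top] by (simp add: V_def)
    finally have d: "(\<integral>\<^sup>+ x. ennreal (\<bar>v N x - g x\<bar> powr t) \<partial>lborel) < \<infinity>" .
    have "power_integral t g = (\<integral>\<^sup>+ x. ennreal (\<bar>v N x + (g x - v N x)\<bar> powr t) \<partial>lborel)" by simp
    also have "\<dots> \<le> ennreal (2 powr t) * (power_integral t (v N) + (\<integral>\<^sup>+ x. ennreal (\<bar>g x - v N x\<bar> powr t) \<partial>lborel))"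
      by (rule nn_integral_powr_add_le) (use t in auto)
    also have "\<dots> < \<infinity>" using d vt by (simp add: ennreal_mult_less_top abs_minus_commute)
    finally show ?thesis .
  qed
  have gp: "power_integral p g < \<infinity>"
    by (rule fin) (use p r W0_nn_integral_powr[OF v] in auto)
  have gq: "power_integral q g < \<infinity>"
    by (rule fin) (use q r v1 in auto)
  have diffq: "(\<lambda>n. \<integral>\<^sup>+ x. ennreal (\<bar>v n x - g x\<bar> powr q) \<partial>lborel) \<longlonglongrightarrow> 0"
  proof -
    define Z where "Z n = (\<integral>\<^sup>+ x. ennreal (\<bar>v n x - g x\<bar> powr q) \<partial>lborel)" for n
    \<comment> \<open>The limit in \<open>n\<close> is taken for fixed \<open>\<eta>\<close> and
      leaves only this term; then \<open>\<eta>\<close> tends to 0.\<close>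
    have "limsup Z \<le> ennreal (\<eta> powr q) * V" if "\<eta> > 0" for \<eta>
    proof -
      have "limsup Z \<le> limsup (\<lambda>n. ennreal (\<eta> powr q) * V + ennreal (\<eta> powr (q - r)) * (\<integral>\<^sup>+ x. ennreal (\<bar>v n x - g x\<bar> powr r) \<partial>lborel))"
        unfolding Z_def V_def
        by (intro Limsup_mono always_eventually allI nn_integral_powr_le_of_support U diff_out q r that) measurable
      also have "\<dots> = ennreal (\<eta> powr q) * V + ennreal (\<eta> powr (q - r)) * 0"
        by (rule lim_imp_Limsup[OF sequentially_bot])
          (intro tendsto_add tendsto_const ennreal_tendsto_cmult limv; simp add: less_top[symmetric])
      finally show ?thesis by simp
    qed
    then have "limsup Z \<le> ennreal ((1 / real (Suc k)) powr q) * V" for k by simp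
    moreover have "(\<lambda>k. ennreal ((1 / real (Suc k)) powr q) * V) \<longlonglongrightarrow> ennreal (0 powr q) * V"
    proof -
      have "(\<lambda>k. 1 / real (Suc k)) \<longlonglongrightarrow> 0" by (rule LIMSEQ_Suc[OF lim_1_over_n])
      then have "(\<lambda>k. ennreal ((1 / real (Suc k)) powr q)) \<longlonglongrightarrow> ennreal (0 powr q)"
        using q0 by (intro tendsto_ennrealI tendsto_powr' tendsto_const) auto
      then have "(\<lambda>k. V * ennreal ((1 / real (Suc k)) powr q)) \<longlonglongrightarrow> V * ennreal (0 powr q)"
        using V by (intro ennreal_tendsto_cmult) auto
      then show ?thesis by (simp only: mult.commute)
    qed
    ultimately have "limsup Z \<le> ennreal (0 powr q) * V" by (intro LIMSEQ_le_const) auto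
    then have "limsup Z \<le> 0" using q0 by simp
    then have "Z \<longlonglongrightarrow> 0" using Liminf_le_Limsup[of sequentially Z]
      by (intro limsup_le_liminf_real Liminf_eq_Limsup) auto
    then show ?thesis by (simp add: Z_def[abs_def])
  qed
  have ge1: "1 \<le> power_integral q g"
  proof -
    obtain G where G: "power_integral q g = ennreal G" "G \<ge> 0"
      using gq by (cases "\<integral>\<^sup>+ x. ennreal (\<bar>g x\<bar> powr q) \<partial>lborel") auto
    have le: "1 \<le> (1 - \<epsilon>) powr (- q) * G" if \<epsilon>: "0 < \<epsilon>" "\<epsilon> < 1" for \<epsilon>
    proof -
      have "1 \<le> ennreal ((1 - \<epsilon>) powr (- q)) * ennreal G + ennreal (\<epsilon> powr (- q)) * (\<integral>\<^sup>+ x. ennreal (\<bar>v n x - g x\<bar> powr q) \<partial>lborel)" for n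
      proof -
        have "1 = (\<integral>\<^sup>+ x. ennreal (\<bar>g x + (v n x - g x)\<bar> powr q) \<partial>lborel)" using v1[of n] by simp
        also have "\<dots> \<le> (\<integral>\<^sup>+ x. ennreal ((1 - \<epsilon>) powr (- q)) * ennreal (\<bar>g x\<bar> powr q) + ennreal (\<epsilon> powr (- q)) * ennreal (\<bar>v n x - g x\<bar> powr q) \<partial>lborel)"
        proof (intro nn_integral_mono)
          fix x
          have "\<bar>g x + (v n x - g x)\<bar> powr q \<le> (1 - \<epsilon>) powr (- q) * \<bar>g x\<bar> powr q + \<epsilon> powr (- q) * \<bar>v n x - g x\<bar> powr q"
            using powr_le_powr_add[OF \<epsilon>, of q "g x" "v n x - g x"] q0 by simp
          then show "ennreal (\<bar>g x + (v n x - g x)\<bar> powr q) \<le> ennreal ((1 - \<epsilon>) powr (- q)) * ennreal (\<bar>g x\<bar> powr q) + ennreal (\<epsilon> powr (- q)) * ennreal (\<bar>v n x - g x\<bar> powr q)"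
            by (simp flip: ennreal_mult ennreal_plus)
        qed
        also have "\<dots> = ennreal ((1 - \<epsilon>) powr (- q)) * ennreal G + ennreal (\<epsilon> powr (- q)) * (\<integral>\<^sup>+ x. ennreal (\<bar>v n x - g x\<bar> powr q) \<partial>lborel)"
          unfolding G(1)[symmetric] by (subst nn_integral_add) (auto simp: nn_integral_cmult)
        finally show ?thesis .
      qed
      moreover have "(\<lambda>n. ennreal ((1 - \<epsilon>) powr (- q)) * ennreal G + ennreal (\<epsilon> powr (- q)) * (\<integral>\<^sup>+ x. ennreal (\<bar>v n x - g x\<bar> powr q) \<partial>lborel)) \<longlonglongrightarrow>
          ennreal ((1 - \<epsilon>) powr (- q)) * ennreal G + ennreal (\<epsilon> powr (- q)) * 0"
        by (intro tendsto_add tendsto_const ennreal_tendsto_cmult diffq) simp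
      ultimately have "1 \<le> ennreal ((1 - \<epsilon>) powr (- q)) * ennreal G + ennreal (\<epsilon> powr (- q)) * 0"
        by (intro LIMSEQ_le_const) auto
      then have "ennreal 1 \<le> ennreal ((1 - \<epsilon>) powr (- q) * G)" using G(2) by (simp add: ennreal_mult)
      then show ?thesis using G(2) by (subst (asm) ennreal_le_iff) auto
    qed
    \<comment> \<open>Two successors keep \<open>\<epsilon>\<close> strictly below 1 already at
      \<open>n = 0\<close>.\<close>
    have b: "(\<lambda>n. 1 / real (Suc (Suc n))) \<longlonglongrightarrow> 0" by (rule LIMSEQ_Suc[OF LIMSEQ_Suc[OF lim_1_over_n]])
    have "(\<lambda>n. (1 - 1 / real (Suc (Suc n))) powr (- q) * G) \<longlonglongrightarrow> (1 - 0) powr (- q) * G"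
      by (intro tendsto_mult tendsto_const tendsto_powr tendsto_diff b) auto
    moreover have "1 \<le> (1 - 1 / real (Suc (Suc n))) powr (- q) * G" for n
      by (rule le) auto
    ultimately have "1 \<le> (1 - 0) powr (- q) * G" by (intro LIMSEQ_le_const) auto
    then show ?thesis using G by (simp add: ennreal_ge_1)
  qed
  have abs_m: "(\<lambda>x. \<bar>g x\<bar>) \<in> borel_measurable borel" by measurable
  have Eabs: "gagliardo_energy s p (\<lambda>x. \<bar>g x\<bar>) \<le> gagliardo_energy s p g"
    by (rule gagliardo_energy_contraction[OF p0]) simp
  show thesis
  proof (rule that[of "\<lambda>x. \<bar>g x\<bar>"])
    show "(\<lambda>x. \<bar>g x\<bar>) \<in> W0 s p U"
      by (rule W0I[OF abs_m])
        (use gp gout order_trans[OF Eabs Egl] in \<open>auto simp: less_top[symmetric] top_unique elim: eventually_mono\<close>)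
    show "enn2real (gagliardo_energy s p (\<lambda>x. \<bar>g x\<bar>)) \<le> frac_eigenvalue s p q U"
      using order_trans[OF Eabs Egl] l unfolding l_def[symmetric]
      by (metis enn2real_ennreal enn2real_mono ennreal_less_top)
  qed (use ge1 gq in auto)
qed

section \<open>Polarization\<close>

lemma reflection_eq: "reflection k a x = x + (2 * (a - x $ k)) *\<^sub>R axis k 1"
  by (simp add: reflection_def vec_eq_iff axis_def)

lemma reflection_nth: "reflection k a x $ k = 2 * a - x $ k"
  by (simp add: reflection_def)

lemma reflection_reflection [simp]: "reflection k a (reflection k a x) = x"
  by (simp add: reflection_def vec_eq_iff)

lemma reflection_fixed: "x $ k = a \<Longrightarrow> reflection k a x = x"
  by (simp add: reflection_eq)

lemma mem_image_reflection: "x \<in> reflection k a ` A \<longleftrightarrow> reflection k a x \<in> A"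
  by (metis imageE image_eqI reflection_reflection)

text \<open>For two points on the same side the last term is nonnegative, so the reflected point is
  farther away. This orders the kernel weights in the polarization inequality.\<close>

lemma norm_diff_reflection:
  "(norm (x - reflection k a y))\<^sup>2 = (norm (x - y))\<^sup>2 + 4 * ((a - x $ k) * (a - y $ k))"
  unfolding reflection_eq power2_norm_eq_inner
  by (simp add: inner_simps inner_axis inner_axis' inner_axis_axis algebra_simps inner_commute)

lemma norm_reflection_diff: "norm (reflection k a x - reflection k a y) = norm (x - y)"
proof -
  have "(norm (reflection k a x - reflection k a y))\<^sup>2 = (norm (x - y))\<^sup>2"
    unfolding reflection_eq power2_norm_eq_inner
    by (simp add: inner_simps inner_axis inner_axis' inner_axis_axis algebra_simps inner_commute)
  then show ?thesis by (simp add: power2_eq_iff_nonneg)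
qed

lemma norm_reflection_diff': "norm (reflection k a x - y) = norm (x - reflection k a y)"
  using norm_reflection_diff[of k a x "reflection k a y"] by simp

lemma continuous_on_reflection: "continuous_on S (reflection k a)"
  unfolding reflection_eq[abs_def] by (intro continuous_intros)

lemma borel_measurable_reflection [measurable]: "reflection k a \<in> borel_measurable borel"
  by (intro borel_measurable_continuous_onI continuous_on_reflection)

text \<open>In the standard basis the reflection is affine and diagonal, with entries 1 except for
  one -1, so its Jacobian is 1 in absolute value.\<close>

lemma distr_reflection: "distr lborel borel (reflection k a) = (lborel :: (real ^ 'n) measure)"
proof -
  define c where "c j = (if j = axis k 1 then -1 else 1 :: real)" for j :: "real ^ 'n"
  have eq: "reflection k a = (\<lambda>x. (2 * a) *\<^sub>R axis k 1 + (\<Sum>j\<in>Basis. (c j * (x \<bullet> j)) *\<^sub>R j))"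
  proof (rule ext, rule euclidean_eqI)
    fix x b :: "real ^ 'n" assume "b \<in> Basis"
    then obtain i where b: "b = axis i 1" by (auto simp: Basis_vec_def)
    have *: "((2 * a) *\<^sub>R axis k 1 + (\<Sum>j\<in>Basis. (c j * (x \<bullet> j)) *\<^sub>R j)) \<bullet> b = 2 * a * (axis k 1 \<bullet> b) + c b * (x \<bullet> b)"
      using \<open>b \<in> Basis\<close> by (simp add: inner_add_left inner_sum_left_Basis)
    then show "reflection k a x \<bullet> b = ((2 * a) *\<^sub>R axis k 1 + (\<Sum>j\<in>Basis. (c j * (x \<bullet> j)) *\<^sub>R j)) \<bullet> b"
      unfolding * unfolding reflection_eq b
      by (cases "i = k"; simp add: c_def inner_add_left inner_axis inner_axis_axis axis_eq_axis algebra_simps; simp add: axis_def)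
  qed
  have "(lborel :: (real ^ 'n) measure) = density (distr lborel borel (\<lambda>x. (2 * a) *\<^sub>R axis k 1 + (\<Sum>j\<in>Basis. (c j * (x \<bullet> j)) *\<^sub>R j)))
      (\<lambda>x. ennreal (\<Prod>j\<in>(Basis :: (real ^ 'n) set). \<bar>c j\<bar>))"
    by (rule lborel_affine_euclidean) (simp add: c_def)
  also have "(\<Prod>j\<in>(Basis :: (real ^ 'n) set). \<bar>c j\<bar>) = 1" by (intro prod.neutral) (simp add: c_def)
  finally show ?thesis unfolding eq[symmetric] by (simp add: density_1)
qed

lemma nn_integral_reflection:
  fixes f :: "real ^ 'n \<Rightarrow> ennreal"
  assumes "f \<in> borel_measurable borel"
  shows "(\<integral>\<^sup>+ x. f (reflection k a x) \<partial>lborel) = (\<integral>\<^sup>+ x. f x \<partial>lborel)"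
  using nn_integral_distr[of "reflection k a" lborel borel f] assms by (simp add: distr_reflection)

lemma AE_reflection:
  fixes P :: "real ^ 'n \<Rightarrow> bool"
  assumes "AE x in lborel. P x"
  shows "AE x in lborel. P (reflection k a x)"
proof -
  have "AE x in distr lborel borel (reflection k a). P x" using assms by (simp only: distr_reflection)
  then show ?thesis by (rule AE_distrD[rotated]) simp
qed

section \<open>Strict convexity and the four-point inequality\<close>

lemma has_real_derivative_abs_powr:
  fixes x p :: real assumes "p > 1"
  shows "((\<lambda>t. \<bar>t\<bar> powr p) has_real_derivative p * (sgn x * \<bar>x\<bar> powr (p - 1))) (at x)"
proof -
  consider "x > 0" | "x < 0" | "x = 0" by linarith
  then show ?thesis
  proof cases
    case 1
    have "((\<lambda>t. t powr p) has_real_derivative p * (sgn x * \<bar>x\<bar> powr (p - 1))) (at x)"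
      using 1 by (auto intro!: derivative_eq_intros)
    then show ?thesis
      by (rule has_field_derivative_transform_within_open[of _ _ _ "{0<..}"]) (use 1 in auto)
  next
    case 2
    have "((\<lambda>t. (- t) powr p) has_real_derivative p * (sgn x * \<bar>x\<bar> powr (p - 1))) (at x)"
      using 2 by (auto intro!: derivative_eq_intros)
    then show ?thesis
      by (rule has_field_derivative_transform_within_open[of _ _ _ "{..<0}"]) (use 2 in auto)
  next
    case 3
    have "((\<lambda>h. \<bar>h\<bar> powr (p - 1)) \<longlongrightarrow> \<bar>0\<bar> powr (p - 1)) (at (0 :: real))"
      using assms by (intro tendsto_powr' tendsto_intros) auto
    then have "((\<lambda>h. \<bar>h\<bar> powr (p - 1)) \<longlongrightarrow> 0) (at (0 :: real))" by simp
    then have "((\<lambda>h. \<bar>h\<bar> powr p / h) \<longlongrightarrow> 0) (at (0 :: real))"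
    proof (rule Lim_null_comparison[rotated])
      show "eventually (\<lambda>h. norm (\<bar>h\<bar> powr p / h) \<le> \<bar>h\<bar> powr (p - 1)) (at (0 :: real))"
        by (rule always_eventually) (auto simp: powr_diff)
    qed
    then show ?thesis using 3 by (simp add: has_field_derivative_iff)
  qed
qed

text \<open>The derivative of \<open>|t| powr p\<close> is strictly increasing, so its increments of
  fixed length \<open>h\<close> grow with the starting point.\<close>

lemma abs_powr_diff_strict_mono:
  fixes x y h p :: real
  assumes p: "p > 1" and h: "h > 0" and xy: "x < y"
  shows "\<bar>x + h\<bar> powr p - \<bar>x\<bar> powr p < \<bar>y + h\<bar> powr p - \<bar>y\<bar> powr p"
proof (rule DERIV_pos_imp_increasing[OF xy])
  fix t
  define f where "f t = sgn t * \<bar>t\<bar> powr (p - 1)" for t :: real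
  have f_mono: "f a < f b" if "a < b" for a b
  proof -
    consider "0 \<le> a" | "a < 0" "0 \<le> b" | "b < 0" using that by linarith
    then show ?thesis
    proof cases
      case 1
      then have "a powr (p - 1) < b powr (p - 1)" using p that by (intro powr_less_mono2) auto
      then show ?thesis using 1 that by (auto simp: f_def sgn_if)
    next
      case 2
      then have "f a < 0" "0 \<le> f b" by (auto simp: f_def sgn_if)
      then show ?thesis by linarith
    next
      case 3
      then have "(- b) powr (p - 1) < (- a) powr (p - 1)" using p that by (intro powr_less_mono2) auto
      then show ?thesis using 3 that by (auto simp: f_def sgn_if)
    qed
  qed
  have "((\<lambda>t. \<bar>t + h\<bar> powr p - \<bar>t\<bar> powr p) has_real_derivative p * f (t + h) * (1 + 0) - p * f t) (at t)"
    unfolding f_def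
    by (intro DERIV_diff DERIV_chain2[where f = "\<lambda>t. \<bar>t\<bar> powr p"] has_real_derivative_abs_powr p DERIV_add DERIV_ident DERIV_const)
  moreover have "p * f (t + h) * (1 + 0) - p * f t > 0"
    using f_mono[of t "t + h"] h p by simp
  ultimately show "\<exists>y. ((\<lambda>t. \<bar>t + h\<bar> powr p - \<bar>t\<bar> powr p) has_real_derivative y) (at t) \<and> 0 < y" by blast
qed

text \<open>Both cases compare two increments of \<open>|t| powr p\<close> of the same length
  \<open>|C - D|\<close>.\<close>

lemma four_point_less:
  fixes A B C D p :: real
  assumes "p > 1" "(A - B) * (C - D) < 0"
  shows "\<bar>A - D\<bar> powr p + \<bar>B - C\<bar> powr p < \<bar>A - C\<bar> powr p + \<bar>B - D\<bar> powr p"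
proof -
  from assms(2) consider "A > B" "C < D" | "A < B" "C > D" by (auto simp: mult_less_0_iff)
  then show ?thesis
  proof cases
    case 1
    then show ?thesis using abs_powr_diff_strict_mono[OF assms(1), of "D - C" "B - D" "A - D"] by simp
  next
    case 2
    then show ?thesis using abs_powr_diff_strict_mono[OF assms(1), of "C - D" "A - C" "B - C"] by simp
  qed
qed

text \<open>Here \<open>A\<close>, \<open>B\<close> stand for the values at \<open>x\<close> and its
  reflection, \<open>C\<close>, \<open>D\<close> for those at \<open>y\<close> and its reflection,
  and \<open>K\<close>, \<open>L\<close> for the kernels at the direct and the crossed distance.
  When the pairs are ordered oppositely, polarization exchanges the sums \<open>X\<close> and
  \<open>Y\<close>, so the gain is exactly \<open>(K - L) * (X - Y)\<close>.\<close>

lemma four_point_polarized: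
  fixes A B C D p K L :: real
  assumes p: "p > 1" and prod: "(A - B) * (C - D) < 0"
  defines "S \<equiv> \<lambda>A B C D. K * (\<bar>A - C\<bar> powr p + \<bar>B - D\<bar> powr p) + L * (\<bar>A - D\<bar> powr p + \<bar>B - C\<bar> powr p)"
  shows "L \<le> K \<Longrightarrow> S (max A B) (min A B) (max C D) (min C D) \<le> S A B C D"
    and "L < K \<Longrightarrow> S (max A B) (min A B) (max C D) (min C D) < S A B C D"
proof -
  define X where "X = \<bar>A - C\<bar> powr p + \<bar>B - D\<bar> powr p"
  define Y where "Y = \<bar>A - D\<bar> powr p + \<bar>B - C\<bar> powr p"
  have YX: "Y < X" unfolding X_def Y_def by (rule four_point_less[OF p prod])
  from prod consider "A > B" "C < D" | "A < B" "C > D" by (auto simp: mult_less_0_iff)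
  then have eq: "S (max A B) (min A B) (max C D) (min C D) = K * Y + L * X"
    by cases (simp_all add: S_def X_def Y_def max_def min_def add.commute)
  have diff: "S A B C D - (K * Y + L * X) = (K - L) * (X - Y)" by (simp add: S_def X_def Y_def algebra_simps)
  show "S (max A B) (min A B) (max C D) (min C D) \<le> S A B C D" if "L \<le> K"
    unfolding eq using diff YX that mult_nonneg_nonneg[of "K - L" "X - Y"] by linarith
  show "S (max A B) (min A B) (max C D) (min C D) < S A B C D" if "L < K"
    unfolding eq using diff YX that mult_pos_pos[of "K - L" "X - Y"] by linarith
qed

section \<open>Polarization of functions\<close>

definition polarize :: "'n \<Rightarrow> real \<Rightarrow> (real ^ 'n \<Rightarrow> real) \<Rightarrow> real ^ 'n \<Rightarrow> real" where
  "polarize k a u x =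
     (if x $ k < a then max (u x) (u (reflection k a x)) else min (u x) (u (reflection k a x)))"

text \<open>A point of the hyperplane is its own reflection, so maximum and minimum agree there and
  the closed half-space may be used.\<close>

lemma polarize_lower:
  assumes "x $ k \<le> a"
  shows "polarize k a u x = max (u x) (u (reflection k a x))"
    and "polarize k a u (reflection k a x) = min (u x) (u (reflection k a x))"
  using assms by (cases "x $ k = a"; simp add: polarize_def reflection_nth reflection_fixed min.commute)+

lemma borel_measurable_vec_nth [measurable]: "(\<lambda>x :: real ^ 'n. x $ i) \<in> borel_measurable borel"
  by (intro borel_measurable_continuous_onI continuous_intros)

lemma borel_measurable_polarize [measurable]:
  fixes u :: "real ^ 'n \<Rightarrow> real"
  assumes [measurable]: "u \<in> borel_measurable borel"
  shows "polarize k a u \<in> borel_measurable borel"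
  unfolding polarize_def[abs_def] by measurable

text \<open>
  Summing over the four reflected pairs makes the polarization inequality a pointwise one, without
  splitting the domain of integration into half-spaces.
\<close>

definition reflected_density :: "real \<Rightarrow> real \<Rightarrow> 'n \<Rightarrow> real \<Rightarrow> (real ^ 'n \<Rightarrow> real) \<Rightarrow> real ^ 'n \<Rightarrow> real ^ 'n \<Rightarrow> real" where
  "reflected_density s p k a u x y =
     gagliardo_density s p u x y + gagliardo_density s p u (reflection k a x) (reflection k a y) +
     (gagliardo_density s p u x (reflection k a y) + gagliardo_density s p u (reflection k a x) y)"

lemma reflected_density_nonneg [simp]: "0 \<le> reflected_density s p k a u x y"
  by (simp add: reflected_density_def)

lemma reflected_density_reflection:
  "reflected_density s p k a u (reflection k a x) y = reflected_density s p k a u x y"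
  "reflected_density s p k a u x (reflection k a y) = reflected_density s p k a u x y"
  by (simp_all add: reflected_density_def)

lemma nn_integral_reflected_density:
  fixes u :: "real ^ 'n \<Rightarrow> real"
  assumes [measurable]: "u \<in> borel_measurable borel"
  shows "(\<integral>\<^sup>+ x. \<integral>\<^sup>+ y. ennreal (reflected_density s p k a u x y) \<partial>lborel \<partial>lborel) = 4 * gagliardo_energy s p u"
proof -
  define F where "F x = (\<integral>\<^sup>+ y. ennreal (gagliardo_density s p u x y) \<partial>lborel)" for x
  have [measurable]: "F \<in> borel_measurable borel"
    unfolding F_def[abs_def]
    by (rule lborel.borel_measurable_nn_integral) (simp add: case_prod_beta' borel_measurable_gagliardo_density)
  have r: "(\<integral>\<^sup>+ y. ennreal (gagliardo_density s p u x (reflection k a y)) \<partial>lborel) = F x" for x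
    unfolding F_def by (rule nn_integral_reflection) measurable
  have "(\<integral>\<^sup>+ y. ennreal (reflected_density s p k a u x y) \<partial>lborel) = F x + F (reflection k a x) + (F x + F (reflection k a x))" for x
  proof -
    have [measurable]: "(\<lambda>y. gagliardo_density s p u x (reflection k a y)) \<in> borel_measurable borel" for x
      by (rule measurable_compose[OF borel_measurable_reflection borel_measurable_gagliardo_density(3)[OF assms]])
    show ?thesis
      by (simp add: reflected_density_def nn_integral_add r flip: F_def)
  qed
  then have "(\<integral>\<^sup>+ x. \<integral>\<^sup>+ y. ennreal (reflected_density s p k a u x y) \<partial>lborel \<partial>lborel) =
      (\<integral>\<^sup>+ x. F x + F (reflection k a x) + (F x + F (reflection k a x)) \<partial>lborel)" by simp
  also have "\<dots> = (\<integral>\<^sup>+ x. F x \<partial>lborel) + (\<integral>\<^sup>+ x. F x \<partial>lborel) + ((\<integral>\<^sup>+ x. F x \<partial>lborel) + (\<integral>\<^sup>+ x. F x \<partial>lborel))"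
    by (simp add: nn_integral_add nn_integral_reflection[of F])
  also have "\<dots> = ((1 + 1) + (1 + 1)) * (\<integral>\<^sup>+ x. F x \<partial>lborel)"
    by (simp only: distrib_right mult_1_left)
  also have "(1 + 1) + (1 + 1) = (4 :: ennreal)" by simp
  finally show ?thesis by (simp add: F_def gagliardo_energy_density)
qed

text \<open>Reflection is an isometry, so the four pairs involve only two distances.\<close>

lemma reflected_density_eq:
  fixes u :: "real ^ 'n \<Rightarrow> real" and s p a :: real and k :: "'n"
  defines "e \<equiv> real CARD('n) + s * p" and "\<sigma> \<equiv> reflection k a"
  shows "reflected_density s p k a u x y =
    inverse (norm (x - y) powr e) * (\<bar>u x - u y\<bar> powr p + \<bar>u (\<sigma> x) - u (\<sigma> y)\<bar> powr p) +
    inverse (norm (x - \<sigma> y) powr e) * (\<bar>u x - u (\<sigma> y)\<bar> powr p + \<bar>u (\<sigma> x) - u y\<bar> powr p)"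
  unfolding reflected_density_def gagliardo_density_def \<sigma>_def norm_reflection_diff norm_reflection_diff' e_def
  by (simp add: divide_inverse algebra_simps)

text \<open>If \<open>u\<close> orders the two pairs oppositely, this is the four-point inequality;
  otherwise polarization permutes the values without changing either sum. Strictness asks for both
  points off the hyperplane, since the two distances agree as soon as one point lies on it.\<close>

lemma reflected_density_polarize:
  fixes u :: "real ^ 'n \<Rightarrow> real"
  assumes p: "1 < p" and s: "0 < s" and x: "x $ k \<le> a" and y: "y $ k \<le> a"
  shows "reflected_density s p k a (polarize k a u) x y \<le> reflected_density s p k a u x y" (is ?le)
    and "x $ k < a \<Longrightarrow> y $ k < a \<Longrightarrow> (u x - u (reflection k a x)) * (u y - u (reflection k a y)) < 0 \<Longrightarrow>
      reflected_density s p k a (polarize k a u) x y < reflected_density s p k a u x y"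
proof -
  define e where "e = real CARD('n) + s * p"
  have e: "e > 0" using p s by (simp add: e_def add_nonneg_pos)
  define K where "K = inverse (norm (x - y) powr e)"
  define L where "L = inverse (norm (x - reflection k a y) powr e)"
  note eqs = reflected_density_eq[of s p k a _ x y, folded e_def, folded K_def L_def]
  have n: "(norm (x - reflection k a y))\<^sup>2 = (norm (x - y))\<^sup>2 + 4 * ((a - x $ k) * (a - y $ k))"
    by (rule norm_diff_reflection)
  have le: "reflected_density s p k a (polarize k a u) x y \<le> reflected_density s p k a u x y \<and>
      (x $ k < a \<and> y $ k < a \<longrightarrow> reflected_density s p k a (polarize k a u) x y < reflected_density s p k a u x y)"
    if neg: "(u x - u (reflection k a x)) * (u y - u (reflection k a y)) < 0"
  proof -
    \<comment> \<open>Needed since \<open>inverse 0 = 0\<close>: on the diagonal \<open>K\<close>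
      would be 0 and the comparison \<open>L \<le> K\<close> could fail.\<close>
    have ne: "x \<noteq> y" using neg by (auto simp: mult_less_0_iff)
    have "(norm (x - y))\<^sup>2 \<le> (norm (x - reflection k a y))\<^sup>2" using n x y by simp
    then have "norm (x - y) \<le> norm (x - reflection k a y)" by (rule power2_le_imp_le) simp
    then have LK: "L \<le> K" unfolding L_def K_def using ne e
      by (intro le_imp_inverse_le powr_mono2) auto
    have LK': "L < K" if "x $ k < a" "y $ k < a"
    proof -
      have "(norm (x - y))\<^sup>2 < (norm (x - reflection k a y))\<^sup>2" using n that by simp
      then have "norm (x - y) < norm (x - reflection k a y)" by (rule power2_less_imp_less) simp
      then show ?thesis unfolding L_def K_def using ne e
        by (intro less_imp_inverse_less powr_less_mono2) auto
    qed
    show ?thesis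
      unfolding eqs polarize_lower[OF x] polarize_lower[OF y]
      using four_point_polarized[OF p neg, of L K] LK LK' by blast
  qed
  moreover have "reflected_density s p k a (polarize k a u) x y = reflected_density s p k a u x y"
    if "\<not> (u x - u (reflection k a x)) * (u y - u (reflection k a y)) < 0"
    using that unfolding eqs polarize_lower[OF x] polarize_lower[OF y]
    by (auto simp: mult_less_0_iff max_def min_def add.commute not_less)
  ultimately show ?le by fastforce
  show "reflected_density s p k a (polarize k a u) x y < reflected_density s p k a u x y"
    if "x $ k < a" "y $ k < a" "(u x - u (reflection k a x)) * (u y - u (reflection k a y)) < 0"
    using le that by blast
qed

lemma reflected_density_polarize_le:
  fixes u :: "real ^ 'n \<Rightarrow> real"
  assumes p: "1 < p" and s: "0 < s"
  shows "reflected_density s p k a (polarize k a u) x y \<le> reflected_density s p k a u x y"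
proof -
  \<comment> \<open>Both points are folded into the closed lower half-space; reflected densities are
    invariant under this.\<close>
  define f where "f z = (if z $ k \<le> a then z else reflection k a z)" for z
  have f: "f z $ k \<le> a" for z by (simp add: f_def reflection_nth)
  have r: "reflected_density s p k a v x y = reflected_density s p k a v (f x) (f y)" for v
    by (simp add: f_def reflected_density_reflection)
  show ?thesis unfolding r by (rule reflected_density_polarize(1)[OF p s f f])
qed

lemma gagliardo_energy_polarize_le:
  fixes u :: "real ^ 'n \<Rightarrow> real"
  assumes u: "u \<in> borel_measurable borel" and p: "1 < p" and s: "0 < s"
  shows "gagliardo_energy s p (polarize k a u) \<le> gagliardo_energy s p u"
proof -
  have bp: "polarize k a u \<in> borel_measurable borel" by (rule borel_measurable_polarize[OF u])
  have "4 * gagliardo_energy s p (polarize k a u) \<le> 4 * gagliardo_energy s p u"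
    unfolding nn_integral_reflected_density[OF u, symmetric, of s p k a]
      nn_integral_reflected_density[OF bp, symmetric, of s p k a]
    by (intro nn_integral_mono ennreal_leI reflected_density_polarize_le p s)
  then show ?thesis by (subst (asm) ennreal_mult_le_mult_iff) auto
qed

lemma borel_measurable_reflected_density:
  fixes u :: "real ^ 'n \<Rightarrow> real"
  assumes [measurable]: "u \<in> borel_measurable borel"
  shows "(\<lambda>z. reflected_density s p k a u (fst z) (snd z)) \<in> borel_measurable (lborel \<Otimes>\<^sub>M lborel)"
  unfolding reflected_density_def gagliardo_density_def by measurable

text \<open>Equal finite energies force equal reflected densities almost everywhere, and the strict
  four-point inequality then rules out opposite orders for almost every pair. One point with a
  strict order thus fixes the order at almost all other points.\<close>

lemma gagliardo_energy_polarize_eq: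
  fixes u :: "real ^ 'n \<Rightarrow> real"
  assumes u [measurable]: "u \<in> borel_measurable borel" and p: "1 < p" and s: "0 < s"
    and fin: "gagliardo_energy s p u < \<infinity>"
    and eq: "gagliardo_energy s p u \<le> gagliardo_energy s p (polarize k a u)"
  shows "(AE x in lborel. x $ k < a \<longrightarrow> u (reflection k a x) \<le> u x) \<or>
    (AE x in lborel. x $ k < a \<longrightarrow> u x \<le> u (reflection k a x))"
proof -
  let ?P = "lborel \<Otimes>\<^sub>M lborel :: ((real ^ 'n) \<times> (real ^ 'n)) measure"
  have bp: "polarize k a u \<in> borel_measurable borel" by (rule borel_measurable_polarize[OF u])
  define f where "f = (\<lambda>z. ennreal (reflected_density s p k a (polarize k a u) (fst z) (snd z)))"
  define g where "g = (\<lambda>z. ennreal (reflected_density s p k a u (fst z) (snd z)))"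
  have fgm [measurable]: "f \<in> borel_measurable ?P" "g \<in> borel_measurable ?P"
    unfolding f_def g_def
    using borel_measurable_reflected_density[OF u] borel_measurable_reflected_density[OF borel_measurable_polarize[OF u]]
    by (auto intro: measurable_compose[OF _ measurable_ennreal])
  have fg: "f z \<le> g z" for z unfolding f_def g_def by (intro ennreal_leI reflected_density_polarize_le p s)
  have If: "(\<integral>\<^sup>+ z. f z \<partial>?P) = 4 * gagliardo_energy s p (polarize k a u)"
    using lborel.nn_integral_fst[OF fgm(1)] nn_integral_reflected_density[OF bp, of s p k a]
    by (simp add: f_def)
  have Ig: "(\<integral>\<^sup>+ z. g z \<partial>?P) = 4 * gagliardo_energy s p u"
    using lborel.nn_integral_fst[OF fgm(2)] nn_integral_reflected_density[OF u, of s p k a]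
    by (simp add: g_def)
  have Ifin: "(\<integral>\<^sup>+ z. f z \<partial>?P) \<noteq> \<infinity>"
    unfolding If using order.strict_trans1[OF gagliardo_energy_polarize_le[OF u p s] fin, of k a]
    by (simp add: ennreal_mult_eq_top_iff)
  have "(\<integral>\<^sup>+ z. g z - f z \<partial>?P) = (\<integral>\<^sup>+ z. g z \<partial>?P) - (\<integral>\<^sup>+ z. f z \<partial>?P)"
    by (rule nn_integral_diff) (use Ifin fg in auto)
  also have "\<dots> = 0"
  proof -
    have "(\<integral>\<^sup>+ z. g z \<partial>?P) \<le> (\<integral>\<^sup>+ z. f z \<partial>?P)"
      unfolding If Ig using eq by (rule mult_left_mono) simp
    then show ?thesis using Ifin by (intro diff_eq_0_ennreal) (auto simp: less_top[symmetric] top_unique)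
  qed
  finally have "AE z in ?P. g z - f z = 0" by (subst nn_integral_0_iff_AE[symmetric]) auto
  then have "AE z in ?P. \<not> f z < g z" 
    by eventually_elim (simp add: f_def g_def ennreal_minus ennreal_eq_0_iff ennreal_less_iff not_less)
  then have "AE z in ?P. fst z $ k < a \<longrightarrow> snd z $ k < a \<longrightarrow>
      0 \<le> (u (fst z) - u (reflection k a (fst z))) * (u (snd z) - u (reflection k a (snd z)))"
  proof eventually_elim
    case (elim z)
    show ?case
    proof (intro impI, rule ccontr)
      assume "fst z $ k < a" "snd z $ k < a"
        "\<not> 0 \<le> (u (fst z) - u (reflection k a (fst z))) * (u (snd z) - u (reflection k a (snd z)))"
      then have "reflected_density s p k a (polarize k a u) (fst z) (snd z) < reflected_density s p k a u (fst z) (snd z)"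
        by (intro reflected_density_polarize(2)[OF p s]) auto
      with elim show False by (simp add: f_def g_def ennreal_less_iff)
    qed
  qed
  from lborel_pair.AE_pair[OF this]
  have ae: "AE x in lborel. AE y in lborel. x $ k < a \<longrightarrow> y $ k < a \<longrightarrow>
      0 \<le> (u x - u (reflection k a x)) * (u y - u (reflection k a y))" by simp
  show ?thesis
  proof (cases "AE x in lborel. x $ k < a \<longrightarrow> u x \<le> u (reflection k a x)")
    case False
    \<comment> \<open>Failure of the second alternative yields a point of strict order at which the
      almost everywhere statement in \<open>y\<close> holds as well.\<close>
    have "\<exists>x. x $ k < a \<and> u (reflection k a x) < u x \<and> (AE y in lborel. x $ k < a \<longrightarrow> y $ k < a \<longrightarrow>
      0 \<le> (u x - u (reflection k a x)) * (u y - u (reflection k a y)))"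
    proof (rule ccontr)
      assume none: "\<not> ?thesis"
      have "AE x in lborel. x $ k < a \<longrightarrow> u x \<le> u (reflection k a x)"
        using ae by eventually_elim (use none in \<open>force simp: not_le\<close>)
      with False show False by simp
    qed
    then obtain x where x: "x $ k < a" "u (reflection k a x) < u x"
      and xy: "AE y in lborel. x $ k < a \<longrightarrow> y $ k < a \<longrightarrow>
      0 \<le> (u x - u (reflection k a x)) * (u y - u (reflection k a y))" by blast
    have "AE y in lborel. y $ k < a \<longrightarrow> u (reflection k a y) \<le> u y"
      using xy by eventually_elim (use x in \<open>auto simp: zero_le_mult_iff\<close>)
    then show ?thesis ..
  qed simp
qed

text \<open>Polarization permutes the two values at each reflected pair, so the sum over the pair,
  which integrates to twice the power integral, is unchanged.\<close>

lemma nn_integral_polarize_powr: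
  fixes u :: "real ^ 'n \<Rightarrow> real"
  assumes u [measurable]: "u \<in> borel_measurable borel"
  shows "(\<integral>\<^sup>+ x. ennreal (\<bar>polarize k a u x\<bar> powr q) \<partial>lborel) = power_integral q u"
proof -
  have two: "(\<integral>\<^sup>+ x. ennreal (\<bar>v x\<bar> powr q) + ennreal (\<bar>v (reflection k a x)\<bar> powr q) \<partial>lborel) = 2 * power_integral q v"
    if v [measurable]: "v \<in> borel_measurable borel" for v :: "real ^ 'n \<Rightarrow> real"
    using nn_integral_reflection[of "\<lambda>x. ennreal (\<bar>v x\<bar> powr q)" k a]
    by (subst nn_integral_add) (auto simp: mult_2)
  have pt: "ennreal (\<bar>polarize k a u x\<bar> powr q) + ennreal (\<bar>polarize k a u (reflection k a x)\<bar> powr q) =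
      ennreal (\<bar>u x\<bar> powr q) + ennreal (\<bar>u (reflection k a x)\<bar> powr q)" for x
  proof (cases "x $ k \<le> a")
    case True
    then show ?thesis by (simp add: polarize_lower max_def min_def add.commute)
  next
    case False
    then have "reflection k a x $ k \<le> a" by (simp add: reflection_nth)
    from polarize_lower[OF this, of u] show ?thesis by (simp add: max_def min_def add.commute)
  qed
  have "2 * (\<integral>\<^sup>+ x. ennreal (\<bar>polarize k a u x\<bar> powr q) \<partial>lborel) = 2 * power_integral q u"
    unfolding two[OF u, symmetric] two[OF borel_measurable_polarize[OF u, of k a], symmetric] pt ..
  then show ?thesis by (subst (asm) ennreal_mult_cancel_left) auto
qed

section \<open>Minimizers do not vanish on balls\<close>

lemma W0_bump:
  fixes z :: "real ^ 'n"
  assumes "0 < s" "s < 1" "1 < p" "r \<ge> 0" "ball z r \<subseteq> U"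
  shows "bump z r \<in> W0 s p U"
proof (rule W0I)
  show "AE x in lborel. x \<notin> U \<longrightarrow> bump z r x = 0"
    using assms(5) bump_outside by (intro AE_I2) blast
qed (use assms nn_integral_bump_powr_finite[of r p z] gagliardo_energy_bump_finite in auto)

text \<open>
  A substitute for the strong maximum principle: if \<open>u\<close> vanishes on a ball, adding \<open>\<epsilon>\<close> times a cone
  function there lowers the energy by an amount of order \<open>\<epsilon>\<close> (through the interaction with
  \<open>{u \<ge> \<eta>}\<close>) and raises it by at most \<open>O(\<epsilon>\<^sup>p)\<close>, and \<open>p > 1\<close>.
\<close>

lemma frac_eigenvalue_minimizer_not_zero_on_ball:
  fixes u :: "real ^ 'n \<Rightarrow> real"
  assumes s: "0 < s" "s < 1" and p: "1 < p" and q: "1 \<le> q" and U: "U \<in> sets borel"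
    and u: "u \<in> W0 s p U" "\<And>x. 0 \<le> u x"
      "1 \<le> power_integral q u" "power_integral q u < \<infinity>"
      "enn2real (gagliardo_energy s p u) \<le> frac_eigenvalue s p q U"
    and ball: "ball z r \<subseteq> U" "r > 0"
  shows "\<not> (AE x in lborel. x \<in> ball z r \<longrightarrow> u x = 0)"
proof
  assume zero: "AE x in lborel. x \<in> ball z r \<longrightarrow> u x = 0"
  note um [measurable] = W0_measurable[OF u(1)]
  define \<phi> where "\<phi> = bump z r"
  have \<phi>m [measurable]: "\<phi> \<in> borel_measurable borel" unfolding \<phi>_def by measurable
  have \<phi>0: "0 \<le> \<phi> x" "\<phi> x \<le> r" for x using ball(2) by (auto simp: \<phi>_def bump_le)
  have \<phi>out: "x \<notin> ball z r \<Longrightarrow> \<phi> x = 0" for x unfolding \<phi>_def by (rule bump_outside)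
  have \<phi>W: "\<phi> \<in> W0 s p U" unfolding \<phi>_def using s p ball by (intro W0_bump) auto
  \<comment> \<open>Since \<open>u\<close> is not zero almost everywhere, it reaches some positive
    level on a set that is not null.\<close>
  obtain \<eta> where \<eta>: "\<eta> > 0" "\<not> (AE y in lborel. u y < \<eta>)"
  proof (rule ccontr)
    assume no: "\<not> thesis"
    have "AE y in lborel. u y < 1 / real (Suc n)" for n
      using no that[of "1 / real (Suc n)"] by auto
    then have "AE y in lborel. \<forall>n. u y < 1 / real (Suc n)" by (simp add: AE_all_countable)
    then have "AE y in lborel. u y = 0"
    proof eventually_elim
      case (elim y)
      then have "u y \<le> 0"
        using LIMSEQ_le_const[OF LIMSEQ_Suc[OF lim_1_over_n], of "u y"] by (auto intro: less_imp_le)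
      then show ?case using u(2)[of y] by simp
    qed
    then have "power_integral q u = 0"
      by (subst nn_integral_0_iff_AE) (auto elim: eventually_mono)
    with u(3) show False by simp
  qed
  define S where "S = {y. \<eta> \<le> u y}"
  have S [measurable]: "S \<in> sets borel" unfolding S_def by measurable
  define e where "e = real CARD('n) + s * p"
  \<comment> \<open>For \<open>0 \<le> a \<le> u y\<close> and \<open>u y \<ge> \<eta>\<close>,
    lowering \<open>u y\<close> by \<open>a\<close> reduces its \<open>p\<close>-th power by at
    least \<open>u y powr (p - 1) * a\<close>, hence by \<open>c * a\<close>.\<close>
  define c where "c = \<eta> powr (p - 1)"
  have c: "c > 0" using \<eta> by (simp add: c_def)
  define G where "G x y = \<phi> x * indicator S y / norm (x - y) powr e" for x y
  have G0: "0 \<le> G x y" for x y using \<phi>0 by (simp add: G_def)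
  have Gm: "(\<lambda>z. ennreal (G (fst z) (snd z))) \<in> borel_measurable (borel \<Otimes>\<^sub>M borel)"
    unfolding G_def by measurable
  have Gm1 [measurable]: "(\<lambda>y. ennreal (G x y)) \<in> borel_measurable borel" for x
    unfolding G_def by measurable
  define I where "I = (\<integral>\<^sup>+ x. \<integral>\<^sup>+ y. ennreal (G x y) \<partial>lborel \<partial>lborel)"
  have Gm2: "(\<lambda>x. \<integral>\<^sup>+ y. ennreal (G x y) \<partial>lborel) \<in> borel_measurable lborel"
    by (rule lborel.borel_measurable_nn_integral) (use Gm in \<open>simp add: case_prod_beta'\<close>)
  have dm: "(\<lambda>x. \<integral>\<^sup>+ y. ennreal (gagliardo_density s p w x y) \<partial>lborel) \<in> borel_measurable lborel"
    if w: "w \<in> borel_measurable borel" for w :: "real ^ 'n \<Rightarrow> real"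
    by (rule lborel.borel_measurable_nn_integral) (use borel_measurable_gagliardo_density[OF w] in \<open>simp add: case_prod_beta'\<close>)
  have key: "ennreal (c * \<epsilon>) * I \<le> ennreal (\<epsilon> powr p) * gagliardo_energy s p \<phi>" if \<epsilon>: "\<epsilon> > 0" "\<epsilon> * r \<le> \<eta>" for \<epsilon>
  proof -
    define v where "v x = u x + \<epsilon> * \<phi> x" for x
    have vm [measurable]: "v \<in> borel_measurable borel" unfolding v_def[abs_def] by measurable
    have pt: "\<bar>v x - v y\<bar> powr p + c * \<epsilon> * (\<phi> x * indicator S y) \<le> \<bar>u x - u y\<bar> powr p + \<epsilon> powr p * \<bar>\<phi> x - \<phi> y\<bar> powr p"
      if zx: "x \<in> ball z r \<longrightarrow> u x = 0" and zy: "y \<in> ball z r \<longrightarrow> u y = 0" for x y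
    proof -
      have scale: "\<epsilon> powr p * \<bar>t\<bar> powr p = \<bar>\<epsilon> * t\<bar> powr p" for t
        using \<epsilon> by (simp add: abs_mult powr_mult)
      have sub: "\<bar>b - a\<bar> powr p \<le> b powr p + a powr p" if "0 \<le> a" "0 \<le> b" for a b :: real
      proof -
        have "\<bar>b - a\<bar> powr p \<le> max b a powr p" using that p by (intro powr_mono2) auto
        also have "\<dots> \<le> b powr p + a powr p" by (simp add: max_def)
        finally show ?thesis .
      qed
      show ?thesis
      proof (cases "x \<in> ball z r"; cases "y \<in> ball z r")
        assume x: "x \<in> ball z r" and y: "y \<in> ball z r"
        then have "indicator S y = (0 :: real)" using zy \<eta> by (simp add: S_def)
        then show ?thesis using x y zx zy scale[of "\<phi> x - \<phi> y"] by (simp add: v_def right_diff_distrib)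
      next
        assume x: "x \<in> ball z r" and y: "y \<notin> ball z r"
        define a where "a = \<epsilon> * \<phi> x"
        have a: "0 \<le> a" using \<epsilon> \<phi>0 by (simp add: a_def)
        have "a \<le> \<epsilon> * r" unfolding a_def using \<epsilon> \<phi>0 by (intro mult_left_mono) auto
        then have a\<eta>: "a \<le> \<eta>" using \<epsilon> by simp
        have "\<bar>u y - a\<bar> powr p + c * a * indicator S y \<le> u y powr p + a powr p"
        proof (cases "y \<in> S")
          case True
          then have b: "\<eta> \<le> u y" by (simp add: S_def)
          have "c * a \<le> u y powr (p - 1) * a"
            unfolding c_def using b \<eta> p a by (intro mult_right_mono powr_mono2) auto
          moreover have "\<bar>u y - a\<bar> powr p \<le> u y powr (p - 1) * (u y - a)"
          proof (cases "u y = a")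
            case False
            then have pos: "u y - a > 0" using b a\<eta> by simp
            have "\<bar>u y - a\<bar> powr p = (u y - a) powr (p - 1) * (u y - a)" using pos by (simp add: powr_diff)
            also have "\<dots> \<le> u y powr (p - 1) * (u y - a)" using pos p a by (intro mult_right_mono powr_mono2) auto
            finally show ?thesis .
          qed simp
          ultimately have "\<bar>u y - a\<bar> powr p + c * a \<le> u y powr (p - 1) * u y" by (simp add: algebra_simps)
          also have "\<dots> = u y powr p" using b \<eta> by (simp add: powr_diff)
          finally show ?thesis using True by (simp add: add_increasing2)
        next
          case False
          then show ?thesis using sub[OF a u(2)[of y]] by simp
        qed
        moreover have "c * \<epsilon> * (\<phi> x * indicator S y) = c * a * indicator S y" by (simp add: a_def)
        moreover have "\<bar>v x - v y\<bar> = \<bar>u y - a\<bar>"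
          using x zx \<phi>out[OF y] by (simp add: v_def a_def abs_minus_commute)
        moreover have "\<bar>u x - u y\<bar> powr p = u y powr p" using x zx u(2)[of y] by simp
        moreover have "\<epsilon> powr p * \<bar>\<phi> x - \<phi> y\<bar> powr p = a powr p"
          using scale[of "\<phi> x"] a \<phi>out[OF y] by (simp add: a_def)
        ultimately show ?thesis by (simp only:)
      next
        \<comment> \<open>The mirror image of the previous case, but the crude bound suffices: the
          gain term is supported on \<open>x\<close> in the ball.\<close>
        assume x: "x \<notin> ball z r" and y: "y \<in> ball z r"
        have "0 \<le> \<epsilon> * \<phi> y" using \<epsilon> \<phi>0 by simp
        from sub[OF this u(2)[of x]] this show ?thesis
          using x y zy \<phi>out[OF x] scale[of "\<phi> y"] u(2)[of x] by (simp add: v_def)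
      next
        assume x: "x \<notin> ball z r" and y: "y \<notin> ball z r"
        then show ?thesis using \<phi>out by (simp add: v_def)
      qed
    qed
    have den: "ennreal (gagliardo_density s p v x y) + ennreal (c * \<epsilon>) * ennreal (G x y) \<le>
        ennreal (gagliardo_density s p u x y) + ennreal (\<epsilon> powr p) * ennreal (gagliardo_density s p \<phi> x y)"
      if zx: "x \<in> ball z r \<longrightarrow> u x = 0" and zy: "y \<in> ball z r \<longrightarrow> u y = 0" for x y
    proof -
      have "gagliardo_density s p v x y + c * \<epsilon> * G x y \<le> gagliardo_density s p u x y + \<epsilon> powr p * gagliardo_density s p \<phi> x y"
        using divide_right_mono[OF pt[OF zx zy], of "norm (x - y) powr e"]
        by (simp add: gagliardo_density_def G_def e_def add_divide_distrib mult.assoc)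
      then show ?thesis using c \<epsilon> G0
        by (simp flip: ennreal_mult ennreal_plus)
    qed
    have "gagliardo_energy s p v + ennreal (c * \<epsilon>) * I = (\<integral>\<^sup>+ x. \<integral>\<^sup>+ y. ennreal (gagliardo_density s p v x y) + ennreal (c * \<epsilon>) * ennreal (G x y) \<partial>lborel \<partial>lborel)"
      unfolding gagliardo_energy_density I_def
      using dm[OF vm] Gm2 borel_measurable_gagliardo_density(3)[OF vm]
      by (simp add: nn_integral_add nn_integral_cmult)
    also have "\<dots> \<le> (\<integral>\<^sup>+ x. \<integral>\<^sup>+ y. ennreal (gagliardo_density s p u x y) + ennreal (\<epsilon> powr p) * ennreal (gagliardo_density s p \<phi> x y) \<partial>lborel \<partial>lborel)"
    proof (rule nn_integral_mono_AE)
      show "AE x in lborel. (\<integral>\<^sup>+ y. ennreal (gagliardo_density s p v x y) + ennreal (c * \<epsilon>) * ennreal (G x y) \<partial>lborel) \<le>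
          (\<integral>\<^sup>+ y. ennreal (gagliardo_density s p u x y) + ennreal (\<epsilon> powr p) * ennreal (gagliardo_density s p \<phi> x y) \<partial>lborel)"
        using zero
      proof eventually_elim
        case (elim x)
        show ?case using zero
          by (intro nn_integral_mono_AE, eventually_elim) (rule den[OF elim])
      qed
    qed
    also have "\<dots> = gagliardo_energy s p u + ennreal (\<epsilon> powr p) * gagliardo_energy s p \<phi>"
      unfolding gagliardo_energy_density
      using dm[OF um] dm[OF \<phi>m] borel_measurable_gagliardo_density(3)[OF um] borel_measurable_gagliardo_density(3)[OF \<phi>m]
      by (simp add: nn_integral_add nn_integral_cmult)
    finally have sum_le: "gagliardo_energy s p v + ennreal (c * \<epsilon>) * I \<le> gagliardo_energy s p u + ennreal (\<epsilon> powr p) * gagliardo_energy s p \<phi>" .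
    have vW: "v \<in> W0 s p U"
    proof (rule W0I[OF vm])
      have "(\<integral>\<^sup>+ x. ennreal (\<bar>u x + \<epsilon> * \<phi> x\<bar> powr p) \<partial>lborel) \<le>
        ennreal (2 powr p) * (power_integral p u + (\<integral>\<^sup>+ x. ennreal (\<bar>\<epsilon> * \<phi> x\<bar> powr p) \<partial>lborel))"
        by (rule nn_integral_powr_add_le) (use p in auto)
      also have "\<dots> < \<infinity>"
        using W0_nn_integral_powr[OF u(1)] W0_nn_integral_powr[OF W0_scale[OF \<phi>W, of \<epsilon>]] p by (simp add: ennreal_mult_less_top)
      finally show "power_integral p v < \<infinity>" by (simp add: v_def)
      have "gagliardo_energy s p v \<le> gagliardo_energy s p v + ennreal (c * \<epsilon>) * I" by simp
      also note sum_le
      also have "gagliardo_energy s p u + ennreal (\<epsilon> powr p) * gagliardo_energy s p \<phi> < \<infinity>"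
        using W0_energy[OF u(1)] W0_energy[OF \<phi>W] by (simp add: ennreal_mult_less_top)
      finally show "gagliardo_energy s p v < \<infinity>" .
      show "AE x in lborel. x \<notin> U \<longrightarrow> v x = 0"
        using W0_outside[OF u(1)] W0_outside[OF \<phi>W] by eventually_elim (auto simp: v_def)
    qed
    have "1 \<le> power_integral q u" by (rule u(3))
    also have "\<dots> \<le> power_integral q v"
      by (intro nn_integral_mono ennreal_leI powr_mono2) (use q u(2) \<phi>0 \<epsilon> in \<open>auto simp: v_def\<close>)
    finally have v1: "1 \<le> power_integral q v" .
    have "(\<integral>\<^sup>+ x. ennreal (\<bar>u x + \<epsilon> * \<phi> x\<bar> powr q) \<partial>lborel) \<le>
        ennreal (2 powr q) * (power_integral q u + (\<integral>\<^sup>+ x. ennreal (\<bar>\<epsilon> * \<phi> x\<bar> powr q) \<partial>lborel))"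
      by (rule nn_integral_powr_add_le) (use q in auto)
    also have "(\<integral>\<^sup>+ x. ennreal (\<bar>\<epsilon> * \<phi> x\<bar> powr q) \<partial>lborel) = ennreal (\<epsilon> powr q) * power_integral q \<phi>"
      using \<epsilon>(1) by (simp add: abs_mult powr_mult ennreal_mult nn_integral_cmult)
    also have "ennreal (2 powr q) * (power_integral q u + ennreal (\<epsilon> powr q) * power_integral q \<phi>) < \<infinity>"
      using u(4) nn_integral_bump_powr_finite[of r q z] ball(2) q by (simp add: ennreal_mult_less_top \<phi>_def)
    finally have v2: "power_integral q v < \<infinity>" by (simp add: v_def)
    \<comment> \<open>\<open>v\<close> is admissible with norm at least 1, so minimality of
      \<open>u\<close> bounds its energy from below and the energy of \<open>v\<close> cancels in
      \<open>sum_le\<close>.\<close>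
    have "enn2real (gagliardo_energy s p u) \<le> enn2real (gagliardo_energy s p v)"
      using u(5) frac_eigenvalue_le_energy[OF vW U _ _ v1 v2] p q by simp
    then have "gagliardo_energy s p u \<le> gagliardo_energy s p v"
      using W0_energy[OF u(1)] W0_energy[OF vW] ennreal_leI by (fastforce simp: less_top)
    then have "gagliardo_energy s p v + ennreal (c * \<epsilon>) * I \<le> gagliardo_energy s p v + ennreal (\<epsilon> powr p) * gagliardo_energy s p \<phi>"
      using sum_le by (meson add_right_mono order_trans)
    then show ?thesis using W0_energy[OF vW] by (auto simp: ennreal_add_left_cancel_le)
  qed
  obtain E where E: "gagliardo_energy s p \<phi> = ennreal E" "E \<ge> 0"
    using W0_energy[OF \<phi>W] by (cases "gagliardo_energy s p \<phi>") auto
  \<comment> \<open>Chosen so that \<open>\<epsilon> n * r \<le> \<eta>\<close>: the perturbation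
    never exceeds the values of \<open>u\<close> on \<open>S\<close>.\<close>
  define \<epsilon> where "\<epsilon> n = \<eta> / r / real (Suc n)" for n
  have \<epsilon>: "\<epsilon> n > 0" "\<epsilon> n * r \<le> \<eta>" for n
    using \<eta> ball(2) by (auto simp: \<epsilon>_def divide_le_eq)
  have Ile: "ennreal c * I \<le> ennreal (\<epsilon> n powr (p - 1) * E)" for n
  proof -
    have "ennreal (\<epsilon> n) * (ennreal c * I) \<le> ennreal (\<epsilon> n) * ennreal (\<epsilon> n powr (p - 1) * E)"
    proof -
      have 1: "ennreal (\<epsilon> n) * (ennreal c * I) = ennreal (c * \<epsilon> n) * I"
        using c \<epsilon>(1)[of n] by (simp add: ennreal_mult mult_ac)
      have "\<epsilon> n powr p = \<epsilon> n * \<epsilon> n powr (p - 1)" using \<epsilon>(1)[of n] by (simp add: powr_diff)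
      then have 2: "ennreal (\<epsilon> n) * ennreal (\<epsilon> n powr (p - 1) * E) = ennreal (\<epsilon> n powr p) * ennreal E"
        using \<epsilon>(1)[of n] E(2) by (simp add: mult.assoc flip: ennreal_mult)
      show ?thesis unfolding 1 2 using key[OF \<epsilon>, of n] E(1) by simp
    qed
    then show ?thesis using \<epsilon>(1)[of n] by (subst (asm) ennreal_mult_le_mult_iff) auto
  qed
  have "(\<lambda>n. \<epsilon> n powr (p - 1) * E) \<longlonglongrightarrow> 0 powr (p - 1) * E"
  proof -
    have "(\<lambda>n. \<eta> / r * (1 / real (Suc n))) \<longlonglongrightarrow> \<eta> / r * 0"
      by (intro tendsto_mult tendsto_const LIMSEQ_Suc[OF lim_1_over_n])
    then have "\<epsilon> \<longlonglongrightarrow> 0" by (simp add: \<epsilon>_def[abs_def])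
    then show ?thesis using p \<epsilon>(1) by (intro tendsto_mult tendsto_const tendsto_powr') (auto intro!: always_eventually less_imp_le)
  qed
  then have "(\<lambda>n. ennreal (\<epsilon> n powr (p - 1) * E)) \<longlonglongrightarrow> ennreal 0" by (intro tendsto_ennrealI) simp
  then have "ennreal c * I \<le> ennreal 0" by (rule LIMSEQ_le_const) (use Ile in blast)
  then have "I = 0" using c by (simp add: ennreal_eq_0_iff)
  then have "AE x in lborel. (\<integral>\<^sup>+ y. ennreal (G x y) \<partial>lborel) = 0"
    unfolding I_def using Gm2 by (subst (asm) nn_integral_0_iff_AE) auto
  then have "AE x in lborel. x \<notin> ball z r"
  proof eventually_elim
    case (elim x)
    show ?case
    proof
      assume x: "x \<in> ball z r"
      have "AE y in lborel. ennreal (G x y) = 0"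
        using elim by (subst (asm) nn_integral_0_iff_AE) auto
      moreover have "AE y in lborel. y \<noteq> x" by (rule AE_lborel_singleton)
      ultimately have "AE y in lborel. u y < \<eta>"
      proof eventually_elim
        case (elim y)
        have "\<phi> x > 0" using x bump_pos_iff[of z r x] by (simp add: \<phi>_def)
        moreover have "norm (x - y) powr e > 0" using elim by auto
        ultimately show ?case using elim(1) by (auto simp: G_def ennreal_eq_0_iff S_def divide_le_0_iff mult_le_0_iff not_le split: split_indicator_asm)
      qed
      with \<eta>(2) show False by simp
    qed
  qed
  then have "emeasure lborel (ball z r) = 0"
    by (subst (asm) AE_iff_measurable[of "ball z r"]) auto
  moreover have "emeasure lborel (ball z r) > 0"
    using ball(2) by (subst emeasure_ball) (auto simp: ennreal_zero_less_mult_iff)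
  ultimately show False by simp
qed

section \<open>Steiner symmetric sets\<close>

lemma steiner_symmetric_reflect_lower:
  assumes "steiner_symmetric k 0 A" "0 \<le> a" "reflection k a x \<in> A" "x $ k < a"
  shows "x \<in> A"
proof -
  have "polarization_lower k a A = A" using assms by (simp add: steiner_symmetric_def)
  moreover have "x \<in> polarization_lower k a A"
    using assms by (simp add: polarization_lower_def mem_image_reflection halfspace_def)
  ultimately show ?thesis by simp
qed

lemma steiner_symmetric_reflection:
  assumes "steiner_symmetric k 0 A" "x \<in> A"
  shows "reflection k 0 x \<in> A"
proof (cases "x $ k > 0")
  case True
  then show ?thesis
    using steiner_symmetric_reflect_lower[OF assms(1), of 0 "reflection k 0 x"] assms(2) by (simp add: reflection_nth)
next
  case False
  have "polarization_upper k 0 A = A" using assms by (simp add: steiner_symmetric_def)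
  moreover have "reflection k 0 x \<in> polarization_upper k 0 A"
    using assms False by (simp add: polarization_upper_def mem_image_reflection halfspace_def reflection_nth)
  ultimately show ?thesis by simp
qed

text \<open>A Steiner symmetric set meets each line in direction \<open>k\<close> in a symmetric
  interval. A point \<open>w\<close> at most as far from the symmetry plane as \<open>x\<close> is
  either the copy \<open>y\<close> of \<open>x\<close> with nonnegative coordinate or is reflected
  onto \<open>y\<close> in the hyperplane midway between them, whose position \<open>a\<close> is
  nonnegative.\<close>

lemma steiner_symmetric_translate:
  assumes A: "steiner_symmetric k 0 A" and x: "x \<in> A" and t: "\<bar>x $ k + t\<bar> \<le> \<bar>x $ k\<bar>"
  shows "x + t *\<^sub>R axis k 1 \<in> A"
proof -
  define y where "y = (if x $ k \<ge> 0 then x else reflection k 0 x)"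
  have y: "y \<in> A" "y $ k = \<bar>x $ k\<bar>" using steiner_symmetric_reflection[OF A] x by (auto simp: y_def reflection_nth)
  define w where "w = x + t *\<^sub>R axis k 1"
  have w: "w $ k = x $ k + t" by (simp add: w_def axis_def)
  have wi: "w $ i = x $ i" "y $ i = x $ i" if "i \<noteq> k" for i
    using that by (auto simp: w_def y_def axis_def reflection_def)
  show "x + t *\<^sub>R axis k 1 \<in> A"
  proof (cases "w $ k = y $ k")
    case True
    then have "w $ i = y $ i" for i using wi by (cases "i = k") auto
    then have "w = y" by (simp add: vec_eq_iff)
    then show ?thesis using y by (simp add: w_def)
  next
    case False
    define a where "a = (w $ k + y $ k) / 2"
    have "w $ k < y $ k" "- (y $ k) \<le> w $ k" using False w y(2) t by auto
    moreover have "reflection k a w $ i = y $ i" for i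
      using wi[of i] by (cases "i = k") (auto simp: reflection_def a_def field_simps)
    then have "reflection k a w = y" by (simp add: vec_eq_iff)
    ultimately show ?thesis
      using steiner_symmetric_reflect_lower[OF A, of a w] y by (simp add: a_def w_def)
  qed
qed

section \<open>Translates and the hyperplane midway between them\<close>

lemma mem_shift: "x \<in> shift k t A \<longleftrightarrow> x - t *\<^sub>R axis k 1 \<in> A"
  unfolding shift_def by (auto simp: image_iff) (metis add.commute diff_add_cancel)

lemma reflection_minus_shift:
  "reflection k a x - t *\<^sub>R axis k 1 = reflection k (a - t) (x - t *\<^sub>R axis k 1)"
  by (simp add: reflection_def vec_eq_iff axis_def)

lemma reflection_mem_shift:
  assumes "steiner_symmetric k 0 A"
  shows "reflection k ((t1 + t2) / 2) x \<in> shift k t1 A \<longleftrightarrow> x \<in> shift k t2 A"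
proof -
  have sym: "z \<in> A \<longleftrightarrow> reflection k 0 z \<in> A" for z
    using steiner_symmetric_reflection[OF assms] reflection_reflection by metis
  have "reflection k ((t1 + t2) / 2) x - t1 *\<^sub>R axis k 1 = reflection k 0 (x - t2 *\<^sub>R axis k 1)"
    by (auto simp: reflection_def vec_eq_iff axis_def field_simps)
  then show ?thesis unfolding mem_shift using sym by simp
qed

text \<open>Seen from the centre of the translate by \<open>t1\<close>, the hyperplane sits at
  \<open>(t2 - t1) / 2\<close>, which is nonnegative, so lower polarization applies to
  \<open>A\<close>.\<close>

lemma shift_lower:
  assumes "steiner_symmetric k 0 A" "t1 \<le> t2" "x \<in> shift k t2 A" "x $ k < (t1 + t2) / 2"
  shows "x \<in> shift k t1 A"
proof -
  have "reflection k ((t1 + t2) / 2) x \<in> shift k t1 A" using reflection_mem_shift[OF assms(1)] assms(3) by blast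
  then have 1: "reflection k ((t1 + t2) / 2 - t1) (x - t1 *\<^sub>R axis k 1) \<in> A"
    unfolding mem_shift reflection_minus_shift .
  have 2: "0 \<le> (t1 + t2) / 2 - t1" using assms(2) by simp
  have 3: "(x - t1 *\<^sub>R axis k 1) $ k < (t1 + t2) / 2 - t1" using assms(4) by (simp add: axis_def)
  show ?thesis unfolding mem_shift by (rule steiner_symmetric_reflect_lower[OF assms(1) 2 1 3])
qed

text \<open>Iterating the translation would leave every bounded set.\<close>

lemma shift_image_subset_unbounded:
  assumes "A \<noteq> {}" "bounded A" "\<delta> \<noteq> 0"
  shows "\<not> (\<lambda>x. x + \<delta> *\<^sub>R axis k 1) ` A \<subseteq> (A :: (real ^ 'n) set)"
proof
  assume sub: "(\<lambda>x. x + \<delta> *\<^sub>R axis k 1) ` A \<subseteq> A"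
  obtain x where x: "x \<in> A" using assms(1) by blast
  have it: "x + (real n * \<delta>) *\<^sub>R axis k 1 \<in> A" for n
  proof (induction n)
    case (Suc n)
    then have "(x + (real n * \<delta>) *\<^sub>R axis k 1) + \<delta> *\<^sub>R axis k 1 \<in> A" using sub by blast
    then show ?case by (simp add: algebra_simps)
  qed (use x in simp)
  obtain B where B: "\<And>y. y \<in> A \<Longrightarrow> norm y \<le> B" using assms(2) by (auto simp: bounded_iff)
  obtain n where n: "real n * \<bar>\<delta>\<bar> > B + norm x"
    using reals_Archimedean3[of "\<bar>\<delta>\<bar>"] assms(3) by auto
  have "norm ((real n * \<delta>) *\<^sub>R axis k (1 :: real) :: real ^ 'n) \<le> norm (x + (real n * \<delta>) *\<^sub>R axis k 1) + norm x"
    using norm_triangle_ineq4[of "x + (real n * \<delta>) *\<^sub>R axis k 1" x] by simp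
  also have "\<dots> \<le> B + norm x" using B[OF it] by simp
  finally show False using n by (simp add: norm_axis_1 abs_mult)
qed

text \<open>Otherwise a translation would map the bounded set \<open>interior A\<close> into itself.
  This supplies the ball that refutes the first comparison.\<close>

lemma interior_shift_minus_nonempty:
  assumes "interior A \<noteq> {}" "bounded A" "t1 \<noteq> t2"
  shows "\<not> interior (shift k t2 A) \<subseteq> (shift k t1 A :: (real ^ 'n) set)"
proof
  assume sub: "interior (shift k t2 A) \<subseteq> shift k t1 A"
  have sh: "shift k t A = (\<lambda>x. t *\<^sub>R axis k 1 + x) ` A" for t by (simp add: shift_def)
  have int: "interior (shift k t A) = (\<lambda>x. t *\<^sub>R axis k 1 + x) ` interior A" for t
    unfolding sh by (rule interior_translation)
  have "interior (shift k t2 A) \<subseteq> interior (shift k t1 A)"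
    using sub by (simp add: interior_maximal)
  then have "(\<lambda>x. x + (t2 - t1) *\<^sub>R axis k 1) ` interior A \<subseteq> interior A"
    unfolding int by (auto simp: image_iff algebra_simps)
  then show False
    using shift_image_subset_unbounded[of "interior A" "t2 - t1" k] assms bounded_subset[OF assms(2) interior_subset] by auto
qed

text \<open>By symmetry the reflection at \<open>a\<close> moves \<open>A\<close> to its translate
  by \<open>2 * a\<close>. The closure is taken so that for open \<open>A\<close> the difference is
  open and contains a ball.\<close>

lemma open_minus_closure_reflection_nonempty:
  assumes A: "steiner_symmetric k 0 A" "A \<noteq> {}" "bounded A" and a: "a > 0"
  shows "\<not> A \<subseteq> closure (reflection k a ` (A :: (real ^ 'n) set))"
proof
  assume sub: "A \<subseteq> closure (reflection k a ` A)"
  have "reflection k a ` A = (\<lambda>x. (2 * a) *\<^sub>R axis k 1 + x) ` A"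
  proof -
    have "reflection k a x = (2 * a) *\<^sub>R axis k 1 + reflection k 0 x" for x
      by (simp add: reflection_def vec_eq_iff axis_def)
    moreover have "reflection k 0 ` A = A"
      using steiner_symmetric_reflection[OF A(1)] by (force simp: mem_image_reflection)
    ultimately show ?thesis by (metis (no_types, lifting) image_cong image_image)
  qed
  then have "closure A \<subseteq> (\<lambda>x. (2 * a) *\<^sub>R axis k 1 + x) ` closure A"
    using sub closure_minimal[OF sub closed_closure] by (simp add: closure_translation)
  then have "(\<lambda>x. x + (- (2 * a)) *\<^sub>R axis k 1) ` closure A \<subseteq> closure A"
    by (force simp: image_iff)
  then show False
    using shift_image_subset_unbounded[of "closure A" "- (2 * a)" k] A a by auto
qed

section \<open>Topology of the annulus and of the set of shifts\<close>

lemma compact_open_of_C11_annulus: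
  assumes "A \<subset>\<subset> B" "bounded_C11_domain (B - A)"
  shows "compact A" "open B" "bounded B"
proof -
  have opn: "open (B - A)" and bd: "bounded (B - A)" using assms(2) by (auto simp: bounded_C11_domain_def)
  have cl: "compact (closure A)" "closure A \<subseteq> interior B" using assms(1) by (auto simp: compactly_inside_def)
  have "closure A \<subseteq> A"
  proof
    fix x assume x: "x \<in> closure A"
    show "x \<in> A"
    proof (rule ccontr)
      assume "x \<notin> A"
      then have "x \<in> B - A" using x cl(2) interior_subset by blast
      \<comment> \<open>The open set \<open>B - A\<close> misses \<open>A\<close>, hence also its
        closure.\<close>
      then show False using open_Int_closure_eq_empty[OF opn, of A] x by blast
    qed
  qed
  then have "closure A = A" using closure_subset by blast
  then show "compact A" using cl by simp
  have "B = (B - A) \<union> interior B" using \<open>closure A = A\<close> cl(2) interior_subset by blast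
  then show "open B" using opn by (metis open_Un open_interior)
  have "bounded A" using \<open>compact A\<close> by (rule compact_imp_bounded)
  with bd have "bounded ((B - A) \<union> A)" unfolding bounded_Un by blast
  then show "bounded B" by (rule bounded_subset) blast
qed

lemma C11_function_continuous: "C11_function \<gamma> \<Longrightarrow> continuous_on S \<gamma>"
  unfolding C11_function_def
  by (metis continuous_at_imp_continuous_on has_derivative_continuous)

text \<open>Near a frontier point of \<open>A\<close> the set \<open>B - A\<close> is a strict
  epigraph, so the open strict subgraph lies in \<open>A\<close>. It contains points close to the
  frontier point, which itself lies on or below the graph.\<close>

lemma interior_nonempty_of_C11_annulus:
  fixes A B :: "(real ^ 'n) set"
  assumes "A \<noteq> {}" "A \<subset>\<subset> B" "bounded_C11_domain (B - A)"
  shows "interior A \<noteq> {}"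
proof -
  note AB = compact_open_of_C11_annulus[OF assms(2,3)]
  have clA: "closed A" using AB(1) by (rule compact_imp_closed)
  have AsB: "A \<subseteq> B" using assms(2) closure_subset interior_subset by (fastforce simp: compactly_inside_def)
  have opn: "open (B - A)" using assms(3) by (simp add: bounded_C11_domain_def)
  have "A \<noteq> UNIV" using compact_imp_bounded[OF AB(1)] not_bounded_UNIV by blast
  then obtain z where z: "z \<in> frontier A" using assms(1) frontier_not_empty by blast
  then have zA: "z \<in> A" using clA frontier_subset_closed by blast
  have "z \<in> frontier (B - A)"
  proof -
    have "z \<in> closure (- A)" using z by (simp add: frontier_closures)
    then have "z \<in> closure (B \<inter> - A)" using open_Int_closure_subset[OF AB(2), of "- A"] zA AsB by blast
    then have "z \<in> closure (B - A)" by (simp add: Diff_eq)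
    then show ?thesis using opn zA by (simp add: frontier_def interior_open)
  qed
  then obtain r \<nu> \<gamma> where r: "r > 0" and \<nu>: "norm \<nu> = 1" and \<gamma>: "C11_function \<gamma>"
    and eq: "(B - A) \<inter> ball z r = {x \<in> ball z r. x \<bullet> \<nu> > \<gamma> (x - (x \<bullet> \<nu>) *\<^sub>R \<nu>)}"
    using assms(3) unfolding bounded_C11_domain_def C11_boundary_def by meson
  define h where "h x = \<gamma> (x - (x \<bullet> \<nu>) *\<^sub>R \<nu>) - x \<bullet> \<nu>" for x
  have hc: "continuous_on UNIV h"
    unfolding h_def by (intro continuous_intros continuous_on_compose2[OF C11_function_continuous[OF \<gamma>, of UNIV]]) auto
  define W where "W = {x. 0 < h x} \<inter> (ball z r \<inter> B)"
  have "open {x. 0 < h x}" using hc by (intro open_Collect_less continuous_on_const)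
  then have Wo: "open W" unfolding W_def using AB(2) by (intro open_Int open_ball)
  have "W \<subseteq> A"
  proof (intro subsetI, rule ccontr)
    fix x assume x: "x \<in> W" "x \<notin> A"
    then have "x \<in> (B - A) \<inter> ball z r" by (auto simp: W_def)
    then show False unfolding eq using x(1) by (simp add: W_def h_def)
  qed
  then have WA: "W \<subseteq> interior A" using Wo by (rule interior_maximal)
  have hz: "h z \<ge> 0"
  proof -
    have "z \<notin> (B - A) \<inter> ball z r" using zA by simp
    then show ?thesis unfolding eq using r by (simp add: h_def)
  qed
  have "open (ball z r \<inter> B)" using AB(2) by auto
  then obtain e where e: "e > 0" "ball z e \<subseteq> ball z r \<inter> B"
    using zA AsB r by (meson Int_iff centre_in_ball open_contains_ball subset_eq)
  \<comment> \<open>Moving against \<open>\<nu>\<close> keeps the argument of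
    \<open>\<gamma>\<close> and raises \<open>h\<close> by \<open>e / 2\<close>.\<close>
  define x where "x = z - (e / 2) *\<^sub>R \<nu>"
  have \<nu>\<nu>: "\<nu> \<bullet> \<nu> = 1" using \<nu> by (simp add: norm_eq_1)
  have x\<nu>: "x \<bullet> \<nu> = z \<bullet> \<nu> - e / 2" by (simp add: x_def inner_diff_left \<nu>\<nu>)
  then have pr: "x - (x \<bullet> \<nu>) *\<^sub>R \<nu> = z - (z \<bullet> \<nu>) *\<^sub>R \<nu>"
    by (simp add: x_def algebra_simps)
  have "h x = h z + e / 2" unfolding h_def pr by (simp add: x\<nu>)
  then have "h x > 0" using hz e by simp
  moreover have "x \<in> ball z e" using e \<nu> by (simp add: x_def dist_norm)
  ultimately have "x \<in> W" using e by (auto simp: W_def)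
  then show ?thesis using WA by blast
qed

text \<open>The set contains 0, is bounded and closed downwards, and never attains its supremum,
  since a compact set inside an open one can be moved a little further.\<close>

lemma admissible_shifts_eq:
  fixes A B :: "(real ^ 'n) set"
  assumes A: "compact A" "A \<noteq> {}" "A \<subseteq> B" and B: "open B" "bounded B" "steiner_symmetric k 0 B"
  shows "admissible_shifts k A B = {0..<Sup (admissible_shifts k A B)}"
proof -
  let ?L = "admissible_shifts k A B"
  have L: "t \<in> ?L \<longleftrightarrow> 0 \<le> t \<and> (\<forall>x\<in>A. x + t *\<^sub>R axis k 1 \<in> B)" for t
    by (auto simp: admissible_shifts_def shift_def add.commute)
  have L0: "0 \<in> ?L" using A(3) by (auto simp: L)
  have down: "t' \<in> ?L" if "t \<in> ?L" "0 \<le> t'" "t' \<le> t" for t t'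
    unfolding L
  proof (intro conjI ballI)
    fix x assume x: "x \<in> A"
    have 1: "x \<in> B" "x + t *\<^sub>R axis k 1 \<in> B" using x A(3) that(1) by (auto simp: L)
    \<comment> \<open>As \<open>x $ k + t'\<close> lies between \<open>x $ k\<close> and
      \<open>x $ k + t\<close>, its modulus is at most that of one of them, and \<open>B\<close> is
      a symmetric interval along the line.\<close>
    show "x + t' *\<^sub>R axis k 1 \<in> B"
    proof (cases "\<bar>x $ k + t'\<bar> \<le> \<bar>x $ k\<bar>")
      case True
      then show ?thesis using steiner_symmetric_translate[OF B(3) 1(1)] by blast
    next
      case False
      then have "\<bar>(x + t *\<^sub>R axis k 1) $ k + (t' - t)\<bar> \<le> \<bar>(x + t *\<^sub>R axis k 1) $ k\<bar>"
        using that by (auto simp: axis_def)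
      from steiner_symmetric_translate[OF B(3) 1(2) this] show ?thesis by (simp add: algebra_simps)
    qed
  qed (use that in simp)
  have up: "\<exists>t'>t. t' \<in> ?L" if t: "t \<in> ?L" for t
  proof -
    have cpt: "compact ((\<lambda>x. x + t *\<^sub>R axis k 1) ` A)"
      by (intro compact_continuous_image continuous_intros A)
    have "(\<lambda>x. x + t *\<^sub>R axis k 1) ` A \<subseteq> B" using t by (auto simp: L)
    then obtain e where e0: "e > 0" "(\<Union>y\<in>(\<lambda>x. x + t *\<^sub>R axis k 1) ` A. ball y e) \<subseteq> B"
      using compact_subset_open_imp_ball_epsilon_subset[OF cpt B(1)] by blast
    then have e: "e > 0" "\<And>y w. y \<in> (\<lambda>x. x + t *\<^sub>R axis k 1) ` A \<Longrightarrow> dist y w < e \<Longrightarrow> w \<in> B"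
      by (auto simp: subset_eq)
    have "t + e / 2 \<in> ?L" unfolding L
    proof (intro conjI ballI)
      fix x assume x: "x \<in> A"
      show "x + (t + e / 2) *\<^sub>R axis k 1 \<in> B"
        by (rule e(2)[of "x + t *\<^sub>R axis k 1"]) (use x e(1) in \<open>auto simp: dist_norm scaleR_left_distrib norm_axis_1\<close>)
    qed (use t e(1) in \<open>auto simp: L\<close>)
    then show ?thesis using e(1) by (intro exI[of _ "t + e / 2"]) auto
  qed
  have bdd: "bdd_above ?L"
  proof -
    obtain M where M: "\<And>y. y \<in> B \<Longrightarrow> norm y \<le> M" using B(2) by (auto simp: bounded_iff)
    obtain x where x: "x \<in> A" using A(2) by blast
    show ?thesis
    proof (rule bdd_aboveI[of _ "M + norm x"])
      fix t assume t: "t \<in> ?L"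
      then have "norm (x + t *\<^sub>R axis k 1) \<le> M" using x M by (auto simp: L)
      moreover have "norm (t *\<^sub>R axis k (1 :: real) :: real ^ 'n) \<le> norm (x + t *\<^sub>R axis k 1) + norm x"
        using norm_triangle_ineq4[of "x + t *\<^sub>R axis k 1" x] by simp
      ultimately show "t \<le> M + norm x" using t by (auto simp: norm_axis_1 L)
    qed
  qed
  show ?thesis
  proof (intro equalityI subsetI)
    fix t assume t: "t \<in> ?L"
    obtain t' where t': "t' > t" "t' \<in> ?L" using up[OF t] by blast
    then have "t' \<le> Sup ?L" using bdd by (intro cSup_upper)
    then show "t \<in> {0..<Sup ?L}" using t t' by (auto simp: L)
  next
    fix t assume t: "t \<in> {0..<Sup ?L}"
    then obtain t' where "t' \<in> ?L" "t < t'" using less_cSupD[of ?L t] L0 by auto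
    then show "t \<in> ?L" using down[of t' t] t by auto
  qed
qed

section \<open>Strict monotonicity\<close>

theorem theorem3p4:
  fixes k :: "'n::finite"
    and \<O> \<Omega> :: "(real ^ 'n) set"
    and p s q :: real
  assumes "\<O> \<noteq> {}" and "\<O> \<subset>\<subset> \<Omega>"
    and "bounded_C11_domain (\<Omega> - \<O>)"
    and "1 < p" and "0 < s" and "s < 1"
    and "1 \<le> q" and "ereal q < sobolev_exponent (real CARD('n)) s p"
    and "steiner_symmetric k 0 \<O>" and "steiner_symmetric k 0 \<Omega>"
  shows "admissible_shifts k \<O> \<Omega> = {0..<Sup (admissible_shifts k \<O> \<Omega>)} \<and>
         strict_antimono_on {0..<Sup (admissible_shifts k \<O> \<Omega>)}
           (\<lambda>t. frac_eigenvalue s p q (\<Omega> - shift k t \<O>))"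
proof -
  note p = \<open>1 < p\<close> and s = \<open>0 < s\<close> \<open>s < 1\<close> and q = \<open>1 \<le> q\<close>
  note top = compact_open_of_C11_annulus[OF \<open>\<O> \<subset>\<subset> \<Omega>\<close> \<open>bounded_C11_domain (\<Omega> - \<O>)\<close>]
  have sub: "\<O> \<subseteq> \<Omega>"
    using \<open>\<O> \<subset>\<subset> \<Omega>\<close> closure_subset interior_subset by (fastforce simp: compactly_inside_def)
  note int = interior_nonempty_of_C11_annulus[OF assms(1-3)]
  note L = admissible_shifts_eq[OF top(1) assms(1) sub top(2,3) assms(10)]
  have "frac_eigenvalue s p q (\<Omega> - shift k t2 \<O>) < frac_eigenvalue s p q (\<Omega> - shift k t1 \<O>)"
    if t1: "t1 \<in> {0..<Sup (admissible_shifts k \<O> \<Omega>)}" and t2: "t2 \<in> {0..<Sup (admissible_shifts k \<O> \<Omega>)}"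
      and t12: "t1 < t2" for t1 t2
  proof -
    define A1 where "A1 = shift k t1 \<O>"
    define A2 where "A2 = shift k t2 \<O>"
    define a where "a = (t1 + t2) / 2"
    have a: "a > 0" using t1 t12 by (simp add: a_def)
    have A: "A1 \<subseteq> \<Omega>" "A2 \<subseteq> \<Omega>"
      using t1 t2 unfolding L[symmetric] by (auto simp: admissible_shifts_def A1_def A2_def)
    have "compact (shift k t \<O>)" for t unfolding shift_def by (rule compact_translation[OF top(1)])
    then have closed: "closed A1" "closed A2" by (auto simp: A1_def A2_def intro: compact_imp_closed)
    have swap: "reflection k a x \<in> A1 \<longleftrightarrow> x \<in> A2" for x
      unfolding A1_def A2_def a_def by (rule reflection_mem_shift[OF assms(9)])
    then have swap': "reflection k a x \<in> A2 \<longleftrightarrow> x \<in> A1" for x by (metis reflection_reflection)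
    have lowA: "x \<in> A1" if "x \<in> A2" "x $ k < a" for x
      using shift_lower[OF assms(9), of t1 t2 x] that t12 by (simp add: A1_def A2_def a_def)
    have low\<Omega>: "x \<in> \<Omega>" if "reflection k a x \<in> \<Omega>" "x $ k < a" for x
      using steiner_symmetric_reflect_lower[OF assms(10), of a x] that a by simp
    define U1 where "U1 = \<Omega> - A1"
    define U2 where "U2 = \<Omega> - A2"
    have U: "open U1" "open U2" "bounded U1"
      using top closed unfolding U1_def U2_def by (auto intro: open_Diff bounded_subset)
    then have Ub: "U1 \<in> sets borel" "U2 \<in> sets borel" by auto
    have \<Omega>0: "\<Omega> \<noteq> {}" using assms(1) sub by blast
    \<comment> \<open>The ball found here serves twice: its cone is a competitor on
      \<open>U1\<close>, and it refutes the second comparison.\<close>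
    obtain z where "z \<in> \<Omega> - closure (reflection k a ` \<Omega>)"
      using open_minus_closure_reflection_nonempty[OF assms(10) \<Omega>0 top(3) a] by blast
    moreover have "open (\<Omega> - closure (reflection k a ` \<Omega>))" using top(2) by (simp add: open_Diff)
    ultimately obtain r where r: "r > 0" "ball z r \<subseteq> \<Omega> - closure (reflection k a ` \<Omega>)"
      using open_contains_ball by blast
    have zr: "x \<in> \<Omega>" "reflection k a x \<notin> \<Omega>" if "x \<in> ball z r" for x
      using that r(2) closure_subset[of "reflection k a ` \<Omega>"] unfolding mem_image_reflection[symmetric] by blast+
    have zrU: "ball z r \<subseteq> U1"
      using zr A(2) swap' unfolding U1_def by blast
    obtain u where u: "u \<in> W0 s p U1" "\<And>x. 0 \<le> u x"
      "1 \<le> power_integral q u" "power_integral q u < \<infinity>"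
      "enn2real (gagliardo_energy s p u) \<le> frac_eigenvalue s p q U1"
    proof (rule frac_eigenvalue_minimizer[OF U(3) Ub(1) s(1) p q assms(8)])
      show "bump z r \<in> W0 s p U1" using r(1) by (intro W0_bump s p zrU) simp
      show "0 < (\<integral>\<^sup>+ x. ennreal (\<bar>bump z r x\<bar> powr q) \<partial>lborel)" by (rule nn_integral_bump_powr_pos[OF r(1)])
      show "(\<integral>\<^sup>+ x. ennreal (\<bar>bump z r x\<bar> powr q) \<partial>lborel) < \<infinity>"
        using r(1) q by (intro nn_integral_bump_powr_finite) auto
    qed (blast intro: that)
    note um = W0_measurable[OF u(1)]
    note not_zero = frac_eigenvalue_minimizer_not_zero_on_ball[OF s p q Ub(1) u]
    have out: "AE x in lborel. x \<notin> U1 \<longrightarrow> u x = 0" by (rule W0_outside[OF u(1)])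
    have out': "AE x in lborel. reflection k a x \<notin> U1 \<longrightarrow> u (reflection k a x) = 0" by (rule AE_reflection[OF out])
    define v where "v = polarize k a u"
    have vm: "v \<in> borel_measurable borel" unfolding v_def by (rule borel_measurable_polarize[OF um])
    have Ev: "gagliardo_energy s p v \<le> gagliardo_energy s p u"
      unfolding v_def by (rule gagliardo_energy_polarize_le[OF um p s(1)])
    have v: "v \<in> W0 s p U2"
    proof (rule W0I[OF vm])
      show "power_integral p v < \<infinity>"
        unfolding v_def nn_integral_polarize_powr[OF um] by (rule W0_nn_integral_powr[OF u(1)])
      show "gagliardo_energy s p v < \<infinity>" using Ev W0_energy[OF u(1)] by (rule order.strict_trans1)
      show "AE x in lborel. x \<notin> U2 \<longrightarrow> v x = 0"
        using out out'
      proof eventually_elim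
        case (elim x)
        show ?case
        proof
          assume x: "x \<notin> U2"
          \<comment> \<open>Below the hyperplane \<open>v\<close> is a maximum, so both points must
            lie outside \<open>U1\<close>; elsewhere it is a minimum of nonnegative values, and one
            of them suffices.\<close>
          show "v x = 0"
          proof (cases "x $ k < a")
            case True
            have "x \<notin> U1" using x lowA[of x] True unfolding U1_def U2_def by blast
            moreover have "reflection k a x \<notin> U1"
              using x low\<Omega>[of x] True swap[of x] unfolding U1_def U2_def by blast
            ultimately show ?thesis using elim True by (simp add: v_def polarize_def)
          next
            case False
            have "x \<notin> U1 \<or> reflection k a x \<notin> U1"
              using x swap[of x] unfolding U1_def U2_def by blast
            then show ?thesis using elim False u(2) by (auto simp: v_def polarize_def min_def intro: antisym)
          qed
        qed
      qed
    qed
    have vq: "power_integral q v = power_integral q u"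
      unfolding v_def by (rule nn_integral_polarize_powr[OF um])
    have le2: "frac_eigenvalue s p q U2 \<le> enn2real (gagliardo_energy s p v)"
      using frac_eigenvalue_le_energy[OF v Ub(2), of q] u(3,4) p q by (simp add: vq)
    \<comment> \<open>Since \<open>u\<close> attains the infimum on \<open>U1\<close>, a strict drop
      of its energy is a strict drop of the infimum.\<close>
    have "\<not> gagliardo_energy s p u \<le> gagliardo_energy s p v"
    proof
      assume "gagliardo_energy s p u \<le> gagliardo_energy s p v"
      then consider "AE x in lborel. x $ k < a \<longrightarrow> u (reflection k a x) \<le> u x"
        | "AE x in lborel. x $ k < a \<longrightarrow> u x \<le> u (reflection k a x)"
        using gagliardo_energy_polarize_eq[OF um p s(1) W0_energy[OF u(1)], of k a] unfolding v_def by blast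
      then show False
      proof cases
        case 1
        \<comment> \<open>Points of \<open>A2\<close> outside \<open>A1\<close> lie above the
          hyperplane and reflect into \<open>A1\<close>, where \<open>u\<close> vanishes.\<close>
        obtain w where "w \<in> interior A2 - A1"
          using interior_shift_minus_nonempty[OF int compact_imp_bounded[OF top(1)], of t1 t2 k] t12
          by (auto simp: A1_def A2_def)
        moreover have "open (interior A2 - A1)" using closed by (simp add: open_Diff)
        ultimately obtain \<rho> where \<rho>: "\<rho> > 0" "ball w \<rho> \<subseteq> interior A2 - A1"
          using open_contains_ball by blast
        have w\<rho>: "x \<in> A2" "x \<notin> A1" if "x \<in> ball w \<rho>" for x
          using that \<rho>(2) interior_subset by blast+
        have "AE x in lborel. x \<in> ball w \<rho> \<longrightarrow> u x = 0"
          using AE_reflection[OF 1, of k a] out'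
        proof eventually_elim
          case (elim x)
          show ?case
          proof
            assume x: "x \<in> ball w \<rho>"
            have rx: "reflection k a x \<in> A1" using swap w\<rho>(1)[OF x] by blast
            have "x $ k \<noteq> a" using rx w\<rho>(2)[OF x] reflection_fixed[of x k a] by auto
            moreover have "\<not> x $ k < a" using lowA w\<rho>[OF x] by blast
            ultimately have "u x \<le> u (reflection k a x)" using elim(1) by (simp add: reflection_nth)
            moreover have "u (reflection k a x) = 0" using elim(2) rx by (simp add: U1_def)
            ultimately show "u x = 0" using u(2)[of x] by simp
          qed
        qed
        moreover have "ball w \<rho> \<subseteq> U1" using w\<rho> A(2) unfolding U1_def by blast
        ultimately show False using not_zero \<rho>(1) by blast
      next
        case 2
        \<comment> \<open>Points of \<Omega> whose reflections leave \<Omega> lie below the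
          hyperplane, so the comparison bounds \<open>u\<close> by its value 0 at the
          reflection.\<close>
        have "AE x in lborel. x \<in> ball z r \<longrightarrow> u x = 0"
          using 2 out'
        proof eventually_elim
          case (elim x)
          show ?case
          proof
            assume x: "x \<in> ball z r"
            have "x $ k \<noteq> a" using zr[OF x] reflection_fixed[of x k a] by auto
            moreover have "\<not> x $ k > a"
              using low\<Omega>[of "reflection k a x"] zr[OF x] by (auto simp: reflection_nth)
            ultimately have "u x \<le> u (reflection k a x)" using elim(1) by simp
            moreover have "u (reflection k a x) = 0" using elim(2) zr(2)[OF x] by (simp add: U1_def)
            ultimately show "u x = 0" using u(2)[of x] by simp
          qed
        qed
        then show False using not_zero[OF zrU r(1)] by blast
      qed
    qed
    then have "gagliardo_energy s p v < gagliardo_energy s p u" by simp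
    then have "enn2real (gagliardo_energy s p v) < enn2real (gagliardo_energy s p u)"
      using W0_energy[OF u(1)] W0_energy[OF v]
      by (cases "gagliardo_energy s p v"; cases "gagliardo_energy s p u"; simp add: ennreal_less_iff)
    then show ?thesis using le2 u(5) by (simp add: U1_def U2_def A1_def A2_def)
  qed
  then show ?thesis using L by (auto simp: monotone_on_def)
qed

end
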